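(* Let $\omega=(\omega_x)_{x\in\mathbb Z}$ be i.i.d. random variables with values in $(0,1)$ and joint law $\mathbb P$, and set $\rho_x=(1-\omega_x)/\omega_x$. Assume: (i) there exists $\varepsilon_0\in(0,1/2)$ with $\mathbb P[\omega_0\in[\varepsilon_0,1-\varepsilon_0]]=1$; (ii) $\mathbb E(\log\rho_0)<0$; (iii) there exists $0<\kappa<1$ such that $\mathbb E(\rho_0^\kappa)=1$. Let $d\ge 2$ and let $x_1,\dots,x_d\in\mathbb Z$ all have the same parity. Then $\mathbb P^{(x_1,\dots,x_d)}$-almost surely there exist infinitely many $n\in\mathbb N$ such that $S^{(1)}_n=S^{(2)}_n=\dots=S^{(d)}_n$.
   Context: Given an environment $\omega$, under the quenched law $P_\omega^{(x_1,\dots,x_d)}$ the processes $S^{(j)}=(S^{(j)}_n)_{n\in\mathbb N}$, $1\le j\le d$, are independent Markov chains on $\mathbb Z$ with $S^{(j)}_0=x_j$ and transition probabilities $P(S^{(j)}_{n+1}=y+1\mid S^{(j)}_n=y)=\omega_y$, $P(S^{(j)}_{n+1}=y-1\mid S^{(j)}_n=y)=1-\omega_y$ (random walks in the same random environment $\omega$). The annealed law is $\mathbb P^{(x_1,\dots,x_d)}(\cdot)=\int P_\omega^{(x_1,\dots,x_d)}(\cdot)\,\mathbb P(d\omega)$. Here $\mathbb N=\{0,1,2,\dots\}$. *)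

theory Defs
  imports "HOL-Probability.Probability"
begin

definition env_law :: "real measure \<Rightarrow> (int \<Rightarrow> real) measure" where
  "env_law \<mu> = PiM UNIV (\<lambda>_. \<mu>)"

text \<open>Driving randomness: i.i.d. uniform [0,1] variables U(j,n), one for walker j at time n.\<close>
definition drive_law :: "(nat \<times> nat \<Rightarrow> real) measure" where
  "drive_law = PiM UNIV (\<lambda>_. uniform_measure lborel {0..1})"

text \<open>A walk in environment w started at y0 driven by uniforms U: from site y it steps
  to y+1 iff U n < w y, which has probability w y, otherwise to y-1.\<close>
fun walk :: "(int \<Rightarrow> real) \<Rightarrow> int \<Rightarrow> (nat \<Rightarrow> real) \<Rightarrow> nat \<Rightarrow> int" where
  "walk w y0 U 0 = y0"
| "walk w y0 U (Suc n) = (let y = walk w y0 U n in if U n < w y then y + 1 else y - 1)"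

text \<open>Annealed law (realized on the underlying space): environment times driving variables.
  Under fixed environment w, the walkers below are independent Markov chains with the
  quenched law P_w; integrating over w gives the annealed law.\<close>
definition annealed_space :: "real measure \<Rightarrow> ((int \<Rightarrow> real) \<times> (nat \<times> nat \<Rightarrow> real)) measure" where
  "annealed_space \<mu> = env_law \<mu> \<Otimes>\<^sub>M drive_law"

definition walker :: "(int \<Rightarrow> real) \<times> (nat \<times> nat \<Rightarrow> real) \<Rightarrow> (nat \<Rightarrow> int) \<Rightarrow> nat \<Rightarrow> nat \<Rightarrow> int" where
  "walker p x j n = walk (fst p) (x j) (\<lambda>m. snd p (j, m)) n"

end

theory Submission
  imports Defs
begin

text \<open>
  Write \<open>\<rho> = (1 - w) / w\<close> and call \<open>b\<close> the bottom of a deep valley if the product of the \<open>\<rho>\<close>'s over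
  some interval starting at \<open>b + 1\<close> exceeds a level \<open>T\<close> much larger than the expected time to reach \<open>b\<close>.
  Walkers that arrive at \<open>b\<close> before a time \<open>n\<close> of order \<open>T\<close> have not crossed the barrier by then, and
  reversibility with the Cauchy--Schwarz inequality bounds the return probability to \<open>b\<close> at every even time
  up to \<open>n\<close> below by the inverse of the reversible mass of the valley (normalised at \<open>b\<close>). Hence all walkers
  sit at \<open>b\<close> at time \<open>n\<close> with a probability that is bounded below uniformly in their starting points,
  and the Markov property gives infinitely many meetings almost surely.

  The existence of such valleys, with bounded reversible mass, rests on \<open>E \<rho>\<^sup>\<kappa> = 1\<close> with \<open>\<kappa> < 1\<close>: a barrier of
  height \<open>T\<close> starts at a given site with probability of exact order \<open>T powr - \<kappa>\<close>, so about \<open>T powr \<kappa>\<close> sites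
  are needed to find one, whereas by a truncated first moment the time to cross \<open>\<eta> * T powr \<kappa>\<close> sites
  is, with probability close to 1, at most a small multiple of \<open>T\<close>. All these bounds use only the moments \<open>E \<rho>\<^sup>\<kappa> = 1\<close>
  and \<open>E \<rho>\<^sup>s < 1\<close> for one \<open>s < \<kappa>\<close>.
\<close>

text \<open>The obstacle is that the time to reach \<open>b\<close> is governed by \<open>W\<close>,
  which sees the whole environment to the left, whereas repeated trials need fresh, independent
  stretches. Each stretch is therefore started from a deterministic number \<open>\<beta>\<close>
  that bounds both \<open>W\<close> at its left end and the time spent before it. Such a bound holds
  up to probability \<open>\<epsilon>\<close>, and its influence decays geometrically inside the
  stretch.

  The order of the constants matters. The mass bound \<open>C\<close> depends only on
  \<open>s\<close>, \<open>\<kappa>\<close> and \<open>r\<close>; next comes the spacing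
  \<open>J\<close> of candidate sites, then the length factor \<open>\<eta>\<close>, which sees the
  time ratio \<open>\<delta>\<close>. The scale \<open>t\<close> is chosen last, after
  \<open>\<beta>\<close>. Hence the success probability \<open>q\<close> of a stretch is the same
  for every past, and the meeting probability depends only on \<open>h\<close>, \<open>C\<close> and
  the number of walkers.\<close>

definition dep :: "'i set \<Rightarrow> (('i \<Rightarrow> real) \<Rightarrow> 'b) \<Rightarrow> bool" where
  "dep I f \<longleftrightarrow> (\<forall>u v. (\<forall>i\<in>I. u i = v i) \<longrightarrow> f u = f v)"

lemma depI:
  assumes "\<And>u v. (\<And>i. i \<in> I \<Longrightarrow> u i = v i) \<Longrightarrow> f u = f v"
  shows "dep I f"
  unfolding dep_def
proof (intro allI impI)
  fix u v assume uv: "\<forall>i\<in>I. u i = (v i :: real)"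
  show "f u = f v" by (rule assms) (rule bspec[OF uv])
qed

lemma depD:
  assumes "dep I f" and uv: "\<And>i. i \<in> I \<Longrightarrow> u i = v i"
  shows "f u = f v"
proof -
  have "(\<forall>i\<in>I. u i = v i) \<longrightarrow> f u = f v"
    using assms(1)[unfolded dep_def] by (elim allE)
  then show ?thesis by (rule mp) (rule ballI, rule uv)
qed

lemma dep_mono:
  assumes "dep I f" "I \<subseteq> J"
  shows "dep J f"
proof (rule depI)
  fix u v assume uv: "\<And>i. i \<in> J \<Longrightarrow> u i = (v i :: real)"
  show "f u = f v" by (rule depD[OF assms(1)], rule uv, rule subsetD[OF assms(2)])
qed

lemma dep_const [simp]: "dep I (\<lambda>_. c)"
  by (simp add: dep_def)

lemma dep_coord: "i \<in> I \<Longrightarrow> dep I (\<lambda>\<omega>. \<omega> i)"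
  by (simp add: dep_def)

lemma dep_comp: 
  assumes "dep I f" 
  shows "dep I (\<lambda>\<omega>. g (f \<omega>))"
proof (rule depI)
  fix u v assume uv: "\<And>i. i \<in> I \<Longrightarrow> u i = (v i :: real)"
  have "f u = f v" by (rule depD[OF assms uv])
  then show "g (f u) = g (f v)" by (rule arg_cong)
qed

lemma dep_comp2:
  assumes "dep I f" "dep I f'"
  shows "dep I (\<lambda>\<omega>. g (f \<omega>) (f' \<omega>))"
proof (rule depI)
  fix u v assume uv: "\<And>i. i \<in> I \<Longrightarrow> u i = (v i :: real)"
  have "f u = f v" "f' u = f' v" by (rule depD[OF assms(1) uv], assumption, rule depD[OF assms(2) uv])
  then show "g (f u) (f' u) = g (f v) (f' v)" by (rule arg_cong2)
qed

text \<open>The second premise says that \<open>G\<close> looks at its argument only on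
  \<open>S\<close>; sums, products and bounded quantifiers are instances.\<close>

lemma dep_family:
  assumes "\<And>x. x \<in> S \<Longrightarrow> dep I (f x)" "\<And>h h'. (\<And>x. x \<in> S \<Longrightarrow> h x = h' x) \<Longrightarrow> G h = G h'"
  shows "dep I (\<lambda>\<omega>. G (\<lambda>x. f x \<omega>))"
proof (rule depI)
  fix u v assume uv: "\<And>i. i \<in> I \<Longrightarrow> u i = (v i :: real)"
  have "f x u = f x v" if "x \<in> S" for x
    by (rule depD[OF assms(1)[OF that] uv])
  then show "G (\<lambda>x. f x u) = G (\<lambda>x. f x v)" by (rule assms(2))
qed

lemma dep_sum: "(\<And>x. x \<in> S \<Longrightarrow> dep I (f x)) \<Longrightarrow> dep I (\<lambda>\<omega>. \<Sum>x\<in>S. f x \<omega>)"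
  by (rule dep_family[where S = S]) (auto intro: sum.cong)

lemma dep_prod: "(\<And>x. x \<in> S \<Longrightarrow> dep I (f x)) \<Longrightarrow> dep I (\<lambda>\<omega>. \<Prod>x\<in>S. f x \<omega>)"
  by (rule dep_family[where S = S]) (auto intro: prod.cong)

lemma dep_ball: "(\<And>x. x \<in> S \<Longrightarrow> dep I (f x)) \<Longrightarrow> dep I (\<lambda>\<omega>. \<forall>x\<in>S. f x \<omega>)"
  by (rule dep_family[where S = S]) auto

lemma dep_bex: "(\<And>x. x \<in> S \<Longrightarrow> dep I (f x)) \<Longrightarrow> dep I (\<lambda>\<omega>. \<exists>x\<in>S. f x \<omega>)"
  by (rule dep_family[where S = S]) auto

section \<open>Independence, tail bounds and null events for products of one law\<close>

locale iid = prob_space \<nu> for \<nu> :: "real measure" +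
  assumes sets_nu [measurable_cong, simp]: "sets \<nu> = sets borel"
begin

abbreviation PP :: "('i \<Rightarrow> real) measure" where
  "PP \<equiv> PiM UNIV (\<lambda>_. \<nu>)"

lemma space_nu [simp]: "space \<nu> = UNIV"
  using sets_eq_imp_space_eq[OF sets_nu] by simp

lemma prob_space_PP: "prob_space (PP :: ('i \<Rightarrow> real) measure)"
  by (intro prob_space_PiM prob_space_axioms)

lemma space_PP [simp]: "space (PP :: ('i \<Rightarrow> real) measure) = UNIV"
  by (simp add: space_PiM)

lemma measurable_coord [measurable]: "(\<lambda>\<omega>. \<omega> i) \<in> borel_measurable (PP :: ('i \<Rightarrow> real) measure)"
  by measurable

lemma measurable_pred_iff_sets: "Measurable.pred (PP :: ('i \<Rightarrow> real) measure) P \<longleftrightarrow> {\<omega>. P \<omega>} \<in> sets PP"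
  by (simp add: pred_def)

lemma integrable_bounded:
  fixes f :: "('i \<Rightarrow> real) \<Rightarrow> real"
  assumes [measurable]: "f \<in> borel_measurable PP" and "\<And>\<omega>. \<bar>f \<omega>\<bar> \<le> B"
  shows "integrable PP f"
proof -
  interpret PP: prob_space "PP :: ('i \<Rightarrow> real) measure" by (rule prob_space_PP)
  show ?thesis by (rule PP.integrable_const_bound[where B = B]) (use assms in auto)
qed

lemma integrable_of_bool:
  "Measurable.pred (PP :: ('i \<Rightarrow> real) measure) P \<Longrightarrow> integrable PP (\<lambda>\<omega>. of_bool (P \<omega>) :: real)"
  by (rule integrable_bounded[where B = 1]) auto

lemma indep_coords:
  "prob_space.indep_vars (PP :: ('i \<Rightarrow> real) measure) (\<lambda>_. \<nu>) (\<lambda>i \<omega>. \<omega> i) UNIV"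
proof -
  interpret PP: prob_space "PP :: ('i \<Rightarrow> real) measure" by (rule prob_space_PP)
  have "distr PP \<nu> (\<lambda>\<omega>. \<omega> i) = \<nu>" for i :: 'i
    by (rule distr_PiM_component) (auto intro: prob_space_axioms)
  moreover have "(\<lambda>x. \<lambda>i\<in>UNIV. x i) = (\<lambda>x::'i \<Rightarrow> real. x)"
    by (simp add: fun_eq_iff)
  ultimately show ?thesis
    by (subst PP.indep_vars_iff_distr_eq_PiM) (auto simp: distr_id)
qed

lemma expectation_mult:
  fixes f g :: "('i \<Rightarrow> real) \<Rightarrow> real"
  assumes f: "integrable PP f" "dep I f" and g: "integrable PP g" "dep J g"
    and disj: "I \<inter> J = {}"
  shows "(\<integral>\<omega>. f \<omega> * g \<omega> \<partial>PP) = (\<integral>\<omega>. f \<omega> \<partial>PP) * (\<integral>\<omega>. g \<omega> \<partial>PP)"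
proof -
  interpret PP: prob_space "PP :: ('i \<Rightarrow> real) measure" by (rule prob_space_PP)
  \<comment> \<open>Filling the missing coordinates with 0 turns \<open>f\<close> into a measurable
    function of the restriction to \<open>I\<close>, since \<open>f\<close> does not see the filled
    values.\<close>
  define ext where "ext K x = (\<lambda>i. if i \<in> K then x i else (0::real))" for K :: "'i set" and x
  have ext: "ext K \<in> PiM K (\<lambda>_. \<nu>) \<rightarrow>\<^sub>M PP" for K
  proof -
    have "(\<lambda>x. \<lambda>i\<in>UNIV. ext K x i) \<in> PiM K (\<lambda>_. \<nu>) \<rightarrow>\<^sub>M PP"
      by (rule measurable_restrict) (case_tac "i \<in> K"; simp add: ext_def)
    then show ?thesis by (simp add: restrict_def)
  qed
  have ind: "PP.indep_var (PiM I (\<lambda>_. \<nu>)) (\<lambda>\<omega>. restrict (\<lambda>i. \<omega> i) I)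
                   (PiM J (\<lambda>_. \<nu>)) (\<lambda>\<omega>. restrict (\<lambda>i. \<omega> i) J)"
    using PP.indep_var_restrict[OF indep_coords disj] by simp
  have m: "f \<circ> ext I \<in> PiM I (\<lambda>_. \<nu>) \<rightarrow>\<^sub>M borel" "g \<circ> ext J \<in> PiM J (\<lambda>_. \<nu>) \<rightarrow>\<^sub>M borel"
    using borel_measurable_integrable[OF f(1)] borel_measurable_integrable[OF g(1)] ext
    by (auto intro: measurable_comp)
  have "PP.indep_var borel ((f \<circ> ext I) \<circ> (\<lambda>\<omega>. restrict (\<lambda>i. \<omega> i) I))
                     borel ((g \<circ> ext J) \<circ> (\<lambda>\<omega>. restrict (\<lambda>i. \<omega> i) J))"
    by (rule PP.indep_var_compose[OF ind m])
  moreover have "(f \<circ> ext I) \<circ> (\<lambda>\<omega>. restrict (\<lambda>i. \<omega> i) I) = f"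
    by (rule HOL.ext, simp, rule depD[OF f(2)], simp add: ext_def)
  moreover have "(g \<circ> ext J) \<circ> (\<lambda>\<omega>. restrict (\<lambda>i. \<omega> i) J) = g"
    by (rule HOL.ext, simp, rule depD[OF g(2)], simp add: ext_def)
  ultimately have "PP.indep_var borel f borel g" by simp
  from PP.indep_var_lebesgue_integral[OF this f(1) g(1)] show ?thesis .
qed

lemma prob_eq_expectation:
  fixes R :: "('i \<Rightarrow> real) \<Rightarrow> bool"
  assumes "Measurable.pred PP R"
  shows "measure PP {\<omega>. R \<omega>} = (\<integral>\<omega>. of_bool (R \<omega>) \<partial>PP)"
proof -
  have "(\<integral>\<omega>. of_bool (R \<omega>) \<partial>PP) = (\<integral>\<omega>. indicat_real {\<omega>. R \<omega>} \<omega> \<partial>PP)"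
    by (intro Bochner_Integration.integral_cong) (auto simp: indicator_def)
  then show ?thesis using assms by (simp add: pred_def)
qed

lemma prob_conj_eq_mult:
  fixes P Q :: "('i \<Rightarrow> real) \<Rightarrow> bool"
  assumes P: "Measurable.pred PP P" "dep I P" and Q: "Measurable.pred PP Q" "dep J Q"
    and disj: "I \<inter> J = {}"
  shows "measure PP {\<omega>. P \<omega> \<and> Q \<omega>} = measure PP {\<omega>. P \<omega>} * measure PP {\<omega>. Q \<omega>}"
proof -
  have [measurable]: "Measurable.pred PP P" "Measurable.pred PP Q" using P Q by auto
  show ?thesis
    using expectation_mult[OF integrable_of_bool[OF P(1)] dep_comp[OF P(2)]
        integrable_of_bool[OF Q(1)] dep_comp[OF Q(2)] disj]
    by (simp add: prob_eq_expectation of_bool_conj)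
qed

lemma expectation_coord:
  fixes g :: "real \<Rightarrow> real" and i :: 'i
  assumes "g \<in> borel_measurable borel"
  shows "(\<integral>\<omega>. g (\<omega> i) \<partial>PP) = (\<integral>x. g x \<partial>\<nu>)"
proof -
  have d: "distr PP \<nu> (\<lambda>\<omega>. \<omega> i) = \<nu>"
    by (rule distr_PiM_component) (auto intro: prob_space_axioms)
  have "(\<integral>x. g x \<partial>(distr PP \<nu> (\<lambda>\<omega>. \<omega> i))) = (\<integral>\<omega>. g (\<omega> i) \<partial>PP)"
    by (rule integral_distr) (use assms in \<open>auto simp: measurable_cong_sets[OF sets_nu refl]\<close>)
  then show ?thesis by (simp add: d)
qed

lemma prob_mono_pred:
  fixes P Q :: "('i \<Rightarrow> real) \<Rightarrow> bool"
  assumes "\<And>\<omega>. P \<omega> \<Longrightarrow> Q \<omega>" and [measurable]: "Measurable.pred PP Q"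
  shows "measure PP {\<omega>. P \<omega>} \<le> measure PP {\<omega>. Q \<omega>}"
proof -
  interpret PP: prob_space "PP :: ('i \<Rightarrow> real) measure" by (rule prob_space_PP)
  show ?thesis
    using assms(2) by (intro PP.finite_measure_mono) (auto intro: assms(1) simp: pred_def)
qed

lemma prob_disj_le:
  fixes P Q :: "('i \<Rightarrow> real) \<Rightarrow> bool"
  assumes "Measurable.pred PP P" "Measurable.pred PP Q"
  shows "measure PP {\<omega>. P \<omega> \<or> Q \<omega>} \<le> measure PP {\<omega>. P \<omega>} + measure PP {\<omega>. Q \<omega>}"
proof -
  interpret PP: prob_space "PP :: ('i \<Rightarrow> real) measure" by (rule prob_space_PP)
  have "{\<omega>. P \<omega> \<or> Q \<omega>} = {\<omega>. P \<omega>} \<union> {\<omega>. Q \<omega>}" by auto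
  then show ?thesis
    using assms measure_Un_le[of "{\<omega>. P \<omega>}" PP "{\<omega>. Q \<omega>}"] by (simp add: pred_def)
qed

lemma prob_bex_le:
  fixes P :: "'b \<Rightarrow> ('i \<Rightarrow> real) \<Rightarrow> bool"
  assumes "finite S" "\<And>j. j \<in> S \<Longrightarrow> Measurable.pred PP (P j)"
  shows "measure PP {\<omega>. \<exists>j\<in>S. P j \<omega>} \<le> (\<Sum>j\<in>S. measure PP {\<omega>. P j \<omega>})"
proof -
  interpret PP: prob_space "PP :: ('i \<Rightarrow> real) measure" by (rule prob_space_PP)
  have "{\<omega>. \<exists>j\<in>S. P j \<omega>} = (\<Union>j\<in>S. {\<omega>. P j \<omega>})" by auto
  moreover have "(\<lambda>j. {\<omega>. P j \<omega>}) ` S \<subseteq> sets PP" using assms(2) by (auto simp: pred_def)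
  ultimately show ?thesis
    using PP.finite_measure_subadditive_finite[OF assms(1), of "\<lambda>j. {\<omega>. P j \<omega>}"] by simp
qed

lemma prob_le_expectation:
  fixes P :: "('i \<Rightarrow> real) \<Rightarrow> bool"
  assumes "Measurable.pred PP P" "integrable PP f" "\<And>\<omega>. 0 \<le> f \<omega>" "\<And>\<omega>. P \<omega> \<Longrightarrow> 1 \<le> f \<omega>"
  shows "measure PP {\<omega>. P \<omega>} \<le> (\<integral>\<omega>. f \<omega> \<partial>PP)"
  unfolding prob_eq_expectation[OF assms(1)]
  by (intro integral_mono integrable_of_bool assms) (auto intro: assms)

text \<open>An elementary substitute for a zero-one law: from any past that has not yet excluded \<open>H\<close>,
  the future excludes it with probability at least \<open>q\<close>.\<close>
lemma prob_eq_0_by_contraction: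
  fixes H :: "('i \<Rightarrow> real) \<Rightarrow> bool" and \<I> :: "'i set set"
  assumes H [measurable]: "Measurable.pred PP H" and q: "0 < q" and I0: "I0 \<in> \<I>"
    and step: "\<And>I G \<epsilon>. I \<in> \<I> \<Longrightarrow> Measurable.pred PP G \<Longrightarrow> dep I G \<Longrightarrow> 0 < \<epsilon> \<Longrightarrow>
      \<exists>J\<in>\<I>. \<exists>G'. Measurable.pred PP G' \<and> dep J G' \<and>
        measure PP {\<omega>. G' \<omega>} \<le> (1 - q) * measure PP {\<omega>. G \<omega>} \<and>
        measure PP {\<omega>. H \<omega> \<and> G \<omega> \<and> \<not> G' \<omega>} \<le> \<epsilon>"
  shows "measure PP {\<omega>. H \<omega>} = 0"
proof -
  interpret PP: prob_space "PP :: ('i \<Rightarrow> real) measure" by (rule prob_space_PP)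
  \<comment> \<open>Applied to the sure event, \<open>step\<close> produces an event of probability
    at most \<open>1 - q\<close>, so this number cannot be negative.\<close>
  have q1: "0 \<le> 1 - q"
  proof -
    obtain G' :: "('i \<Rightarrow> real) \<Rightarrow> bool" where
      "measure PP {\<omega>. G' \<omega>} \<le> (1 - q) * measure PP {\<omega> :: 'i \<Rightarrow> real. True}"
      using step[OF I0, of "\<lambda>_. True" 1] by (simp del: Collect_const) blast
    from order_trans[OF measure_nonneg this] show ?thesis using PP.prob_space by simp
  qed
  \<comment> \<open>With \<open>\<epsilon>\<close> arbitrary in the induction, each round can spend
    one half of the error on the past and the other half on the new step.\<close>
  have iter: "\<exists>I\<in>\<I>. \<exists>G. Measurable.pred PP G \<and> dep I G \<and> measure PP {\<omega>. G \<omega>} \<le> (1 - q) ^ K \<and>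
      measure PP {\<omega>. H \<omega> \<and> \<not> G \<omega>} \<le> \<epsilon>" if "0 < \<epsilon>" for K \<epsilon>
    using that
  proof (induction K arbitrary: \<epsilon>)
    case 0
    then show ?case using I0 PP.prob_space by (intro bexI[of _ I0] exI[of _ "\<lambda>_. True"]) auto
  next
    case (Suc K)
    obtain I G where IG: "I \<in> \<I>" "Measurable.pred PP G" "dep I G" "measure PP {\<omega>. G \<omega>} \<le> (1 - q) ^ K"
      "measure PP {\<omega>. H \<omega> \<and> \<not> G \<omega>} \<le> \<epsilon> / 2"
      using Suc.IH[OF half_gt_zero[OF Suc.prems]] by blast
    obtain J G' where JG: "J \<in> \<I>" "Measurable.pred PP G'" "dep J G'"
      "measure PP {\<omega>. G' \<omega>} \<le> (1 - q) * measure PP {\<omega>. G \<omega>}"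
      "measure PP {\<omega>. H \<omega> \<and> G \<omega> \<and> \<not> G' \<omega>} \<le> \<epsilon> / 2"
      using step[OF IG(1-3) half_gt_zero[OF Suc.prems]] by blast
    note [measurable] = IG(2) JG(2)
    have "measure PP {\<omega>. G' \<omega>} \<le> (1 - q) * (1 - q) ^ K"
      using JG(4) mult_left_mono[OF IG(4) q1] by simp
    moreover have "measure PP {\<omega>. H \<omega> \<and> \<not> G' \<omega>} \<le> \<epsilon>"
    proof -
      have "measure PP {\<omega>. H \<omega> \<and> \<not> G' \<omega>}
          \<le> measure PP {\<omega>. (H \<omega> \<and> \<not> G \<omega>) \<or> (H \<omega> \<and> G \<omega> \<and> \<not> G' \<omega>)}"
        by (rule prob_mono_pred) auto
      also have "\<dots> \<le> measure PP {\<omega>. H \<omega> \<and> \<not> G \<omega>} + measure PP {\<omega>. H \<omega> \<and> G \<omega> \<and> \<not> G' \<omega>}"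
        by (rule prob_disj_le) auto
      finally show ?thesis using IG(5) JG(5) by simp
    qed
    ultimately show ?case using JG(1-3) by (intro bexI[of _ J] exI[of _ G']) auto
  qed
  have le: "measure PP {\<omega>. H \<omega>} \<le> (1 - q) ^ K + \<epsilon>" if \<epsilon>: "0 < \<epsilon>" for K \<epsilon>
  proof -
    obtain I G where IG: "Measurable.pred PP G" "measure PP {\<omega>. G \<omega>} \<le> (1 - q) ^ K"
      "measure PP {\<omega>. H \<omega> \<and> \<not> G \<omega>} \<le> \<epsilon>"
      using iter[OF \<epsilon>, of K] by blast
    note [measurable] = IG(1)
    have "measure PP {\<omega>. H \<omega>} \<le> measure PP {\<omega>. G \<omega> \<or> (H \<omega> \<and> \<not> G \<omega>)}"
      by (rule prob_mono_pred) auto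
    also have "\<dots> \<le> measure PP {\<omega>. G \<omega>} + measure PP {\<omega>. H \<omega> \<and> \<not> G \<omega>}"
      by (rule prob_disj_le) auto
    finally show ?thesis using IG by simp
  qed
  have "measure PP {\<omega>. H \<omega>} \<le> 0 + \<epsilon>" if \<epsilon>: "0 < \<epsilon>" for \<epsilon>
  proof -
    obtain K where "(1 - q) ^ K < \<epsilon> / 2"
      using real_arch_pow_inv[of "\<epsilon> / 2" "1 - q"] \<epsilon> q by auto
    then show ?thesis using le[of "\<epsilon> / 2" K] \<epsilon> by simp
  qed
  then have "measure PP {\<omega>. H \<omega>} \<le> 0" by (rule field_le_epsilon)
  then show ?thesis using measure_nonneg by (rule antisym)
qed

lemma AE_of_prob_eq_0:
  fixes H :: "('i \<Rightarrow> real) \<Rightarrow> bool"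
  assumes "Measurable.pred PP H" "measure PP {\<omega>. H \<omega>} = 0"
  shows "AE \<omega> in PP. \<not> H \<omega>"
proof -
  interpret PP: prob_space "PP :: ('i \<Rightarrow> real) measure" by (rule prob_space_PP)
  show ?thesis using PP.prob_Collect_eq_0[of H] assms by (simp add: pred_def)
qed

text \<open>Tightness of a single random variable; it supplies the deterministic bound
  \<open>\<beta>\<close> on what the past of the environment contributes.\<close>

lemma prob_gt_small:
  fixes X :: "('i \<Rightarrow> real) \<Rightarrow> real"
  assumes [measurable]: "X \<in> borel_measurable PP" and "0 < \<epsilon>"
  obtains n :: nat where "measure PP {\<omega>. real n < X \<omega>} \<le> \<epsilon>"
proof -
  interpret PP: prob_space "PP :: ('i \<Rightarrow> real) measure" by (rule prob_space_PP)
  define A where "A n = {\<omega>. real n < X \<omega>}" for n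
  have "A n \<in> sets PP" for n
    unfolding A_def measurable_pred_iff_sets[symmetric] by measurable
  then have "(\<lambda>n. measure PP (A n)) \<longlonglongrightarrow> measure PP (\<Inter>n. A n)"
    by (intro PP.finite_Lim_measure_decseq) (auto simp: decseq_def A_def)
  moreover have "(\<Inter>n. A n) = {}"
  proof (rule equals0I)
    fix \<omega> assume "\<omega> \<in> (\<Inter>n. A n)"
    moreover obtain n where "X \<omega> < real n" using reals_Archimedean2 by blast
    ultimately show False by (auto simp: A_def dest!: spec[of _ n])
  qed
  ultimately have "(\<lambda>n. measure PP (A n)) \<longlonglongrightarrow> 0" by simp
  then have "eventually (\<lambda>n. measure PP (A n) < \<epsilon>) sequentially"
    using assms(2) by (rule order_tendstoD)
  then obtain n where "measure PP (A n) < \<epsilon>" by (auto simp: eventually_sequentially)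
  then show thesis using that[of n] by (simp add: A_def)
qed

end

section \<open>Walks in a fixed environment\<close>

locale quenched =
  fixes w :: "int \<Rightarrow> real"
  assumes w_pos: "0 < w z" and w_less_1: "w z < 1"
begin

definition rho :: "int \<Rightarrow> real" where
  "rho z = (1 - w z) / w z"

text \<open>Quenched transition probabilities by recursion on the last step, without any probability
  space; \<open>prob_walk_eq\<close> ties them to the driven walks.\<close>

fun pk :: "nat \<Rightarrow> int \<Rightarrow> int \<Rightarrow> real" where
  "pk 0 x y = of_bool (x = y)"
| "pk (Suc n) x y = pk n x (y - 1) * w (y - 1) + pk n x (y + 1) * (1 - w (y + 1))"

lemma rho_pos: "0 < rho z"
  using w_pos[of z] w_less_1[of z] by (simp add: rho_def)

lemma w_mult_rho: "w z * rho z = 1 - w z"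
  using w_pos[of z] by (simp add: rho_def)

lemma pk_nonneg: "0 \<le> pk n x y"
proof (induction n arbitrary: y)
  case (Suc n)
  show ?case
    using Suc[of "y - 1"] Suc[of "y + 1"] w_pos[of "y - 1"] w_less_1[of "y + 1"] by simp
qed simp

lemma pk_eq_0: "int n < \<bar>y - x\<bar> \<Longrightarrow> pk n x y = 0"
  by (induction n arbitrary: y) auto

lemma pk_Suc_left: "pk (Suc n) x y = w x * pk n (x + 1) y + (1 - w x) * pk n (x - 1) y"
proof (induction n arbitrary: y)
  case 0
  have "x = y - 1 \<longleftrightarrow> x + 1 = y" "x = y + 1 \<longleftrightarrow> x - 1 = y" by auto
  then show ?case by auto
next
  case (Suc n)
  show ?case
    by (subst pk.simps(2), subst Suc, subst Suc) (simp add: algebra_simps)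
qed

lemma pk_le_1: "pk n x y \<le> 1"
proof (induction n arbitrary: x)
  case (Suc n)
  have "w x * pk n (x + 1) y + (1 - w x) * pk n (x - 1) y \<le> w x * 1 + (1 - w x) * 1"
    using Suc w_pos[of x] w_less_1[of x] by (intro add_mono mult_left_mono) auto
  also have "\<dots> = 1" by simp
  finally show ?case by (simp only: pk_Suc_left)
qed simp

lemma pk_add_ge:
  assumes "finite F"
  shows "(\<Sum>z\<in>F. pk m x z * pk n z y) \<le> pk (m + n) x y"
proof (induction n arbitrary: y)
  case 0
  have "(\<Sum>z\<in>F. pk m x z * pk 0 z y) = (\<Sum>z\<in>F. if z = y then pk m x z else 0)"
    by (intro sum.cong) auto
  also have "\<dots> \<le> pk m x y"
    using assms pk_nonneg[of m x y] by (simp add: sum.delta)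
  finally show ?case by simp
next
  case (Suc n)
  have "(\<Sum>z\<in>F. pk m x z * pk (Suc n) z y)
      = (\<Sum>z\<in>F. pk m x z * pk n z (y - 1)) * w (y - 1)
        + (\<Sum>z\<in>F. pk m x z * pk n z (y + 1)) * (1 - w (y + 1))"
    unfolding sum_distrib_right sum.distrib[symmetric]
    by (intro sum.cong refl) (simp add: algebra_simps)
  also have "\<dots> \<le> pk (m + n) x (y - 1) * w (y - 1) + pk (m + n) x (y + 1) * (1 - w (y + 1))"
    using Suc w_pos[of "y - 1"] w_less_1[of "y + 1"]
    by (intro add_mono mult_right_mono) (auto simp: less_imp_le)
  finally show ?case by simp
qed

text \<open>\<open>c z\<close> is the conductance of the edge between \<open>z\<close> and
  \<open>z + 1\<close>, so \<open>c (z - 1) + c z\<close> is the reversible mass of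
  \<open>z\<close>. Detailed balance for one step turns the last step of a path from
  \<open>x\<close> to \<open>y\<close> into the first step of the reversed path.\<close>

lemma pk_reversible:
  assumes c: "\<And>z. c (z - 1) = rho z * c z"
  shows "(c (x - 1) + c x) * pk n x y = (c (y - 1) + c y) * pk n y x"
proof -
  define m where "m z = c (z - 1) + c z" for z
  have mw: "m z * w z = c z" "m z * (1 - w z) = c (z - 1)" for z
    using w_pos[of z] by (auto simp: m_def c[of z] rho_def field_simps)
  have "m x * pk n x y = m y * pk n y x"
  proof (induction n arbitrary: y)
    case 0
    show ?case by auto
  next
    case (Suc n)
    have "m x * pk (Suc n) x y = (m x * pk n x (y - 1)) * w (y - 1) + (m x * pk n x (y + 1)) * (1 - w (y + 1))"
      by (simp add: algebra_simps)
    also have "\<dots> = (m (y - 1) * w (y - 1)) * pk n (y - 1) x + (m (y + 1) * (1 - w (y + 1))) * pk n (y + 1) x"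
      by (simp only: Suc) (simp add: algebra_simps)
    also have "\<dots> = c (y - 1) * pk n (y - 1) x + c y * pk n (y + 1) x"
      by (simp only: mw) simp
    also have "\<dots> = (m y * (1 - w y)) * pk n (y - 1) x + (m y * w y) * pk n (y + 1) x"
      by (simp only: mw)
    also have "\<dots> = m y * pk (Suc n) y x"
      by (simp only: pk_Suc_left) (simp add: algebra_simps)
    finally show ?case .
  qed
  then show ?thesis by (simp add: m_def)
qed

text \<open>In one step the interval loses at most the mass sitting at \<open>M\<close>, which may
  jump right. Nothing leaves on the left, because the end \<open>b - int R\<close> cannot be
  occupied before time \<open>R\<close>.\<close>

lemma mass_left_of_barrier:
  assumes "b \<le> M" "n \<le> R"
  shows "1 - (\<Sum>k<n. pk k b M) \<le> (\<Sum>z\<in>{b - int R..M}. pk n b z)"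
  using assms(2)
proof (induction n)
  case 0
  have "(\<Sum>z\<in>{b - int R..M}. pk 0 b z) = (\<Sum>z\<in>{b - int R..M}. if z = b then 1 else 0)"
    by (intro sum.cong) auto
  also have "\<dots> = 1" using assms(1) by (simp add: sum.delta)
  finally show ?case by simp
next
  case (Suc n)
  define a where "a = b - int R"
  have aM: "a \<le> M" using assms by (simp add: a_def)
  have pa: "pk n b a = 0" using Suc.prems by (intro pk_eq_0) (auto simp: a_def)
  have wnn: "0 \<le> w z" "0 \<le> 1 - w z" for z
    using w_pos[of z] w_less_1[of z] by auto
  have "(\<Sum>z\<in>{a..M}. pk n b z * w z) \<le> (\<Sum>z\<in>{a..M - 1}. pk n b z * w z) + pk n b M"
  proof -
    have "{a..M} = insert M {a..M - 1}" using aM by auto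
    moreover have "pk n b M * w M \<le> pk n b M * 1"
      using w_less_1[of M] pk_nonneg[of n b M] by (intro mult_left_mono) auto
    ultimately show ?thesis by simp
  qed
  moreover have "(\<Sum>z\<in>{a..M}. pk n b z * (1 - w z)) = (\<Sum>z\<in>{a + 1..M}. pk n b z * (1 - w z))"
  proof -
    have "{a..M} = insert a {a + 1..M}" using aM by auto
    then show ?thesis using pa by simp
  qed
  moreover have "(\<Sum>z\<in>{a..M}. pk n b (z - 1) * w (z - 1)) \<ge> (\<Sum>z\<in>{a..M - 1}. pk n b z * w z)"
  proof -
    have "(\<Sum>z\<in>{a..M}. pk n b (z - 1) * w (z - 1)) = (\<Sum>z\<in>{a - 1..M - 1}. pk n b z * w z)"
      by (rule sum.reindex_bij_witness[of _ "\<lambda>z. z + 1" "\<lambda>z. z - 1"]) auto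
    also have "\<dots> \<ge> (\<Sum>z\<in>{a..M - 1}. pk n b z * w z)"
      by (intro sum_mono2) (auto intro!: mult_nonneg_nonneg pk_nonneg wnn)
    finally show ?thesis .
  qed
  moreover have "(\<Sum>z\<in>{a..M}. pk n b (z + 1) * (1 - w (z + 1))) \<ge> (\<Sum>z\<in>{a + 1..M}. pk n b z * (1 - w z))"
  proof -
    have "(\<Sum>z\<in>{a..M}. pk n b (z + 1) * (1 - w (z + 1))) = (\<Sum>z\<in>{a + 1..M + 1}. pk n b z * (1 - w z))"
      by (rule sum.reindex_bij_witness[of _ "\<lambda>z. z - 1" "\<lambda>z. z + 1"]) auto
    also have "\<dots> \<ge> (\<Sum>z\<in>{a + 1..M}. pk n b z * (1 - w z))"
      by (intro sum_mono2) (auto intro!: mult_nonneg_nonneg pk_nonneg wnn)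
    finally show ?thesis .
  qed
  moreover have "(\<Sum>z\<in>{a..M}. pk n b z) = (\<Sum>z\<in>{a..M}. pk n b z * w z) + (\<Sum>z\<in>{a..M}. pk n b z * (1 - w z))"
    by (simp add: sum.distrib[symmetric] algebra_simps)
  moreover have "(\<Sum>z\<in>{a..M}. pk (Suc n) b z)
      = (\<Sum>z\<in>{a..M}. pk n b (z - 1) * w (z - 1)) + (\<Sum>z\<in>{a..M}. pk n b (z + 1) * (1 - w (z + 1)))"
    by (simp add: sum.distrib)
  ultimately show ?case using Suc by (simp add: a_def)
qed

text \<open>By reversibility the sum of \<open>pk n b z * pk n z b\<close> over a finite interval is a weighted sum of
  squares, which Cauchy--Schwarz bounds below by the mass that stays in the interval.\<close>
lemma return_prob_ge:
  assumes c: "\<And>z. c (z - 1) = rho z * c z" and c_pos: "\<And>z. 0 < c z" and "b \<le> M"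
    and exit: "real n * (c (M - 1) + c M) \<le> (c (b - 1) + c b) / 2"
  shows "(c (b - 1) + c b) / (4 * (\<Sum>z\<in>{b - int n..M}. c (z - 1) + c z)) \<le> pk (2 * n) b b"
proof -
  define m where "m z = c (z - 1) + c z" for z
  define F where "F = {b - int n..M}"
  have m_pos: "0 < m z" for z using c_pos by (simp add: m_def add_pos_pos)
  have F: "finite F" "b \<in> F" using assms(3) by (auto simp: F_def)
  have rev: "m x * pk k x y = m y * pk k y x" for k x y
    using pk_reversible[of c, OF c] by (simp add: m_def)
  \<comment> \<open>Reversibility bounds the chance of sitting at the far end \<open>M\<close> by a
    ratio of masses. Summed over \<open>n\<close> times this is at most 1/2 by \<open>exit\<close>,
    so half of the mass is still in \<open>F\<close>.\<close>
  have "pk k b M \<le> m M / m b" for k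
  proof -
    have "m b * pk k b M \<le> m M * 1"
      unfolding rev[of b] by (intro mult_left_mono pk_le_1) (use m_pos[of M] in simp)
    then show ?thesis using m_pos[of b] by (simp add: field_simps)
  qed
  then have "(\<Sum>k<n. pk k b M) \<le> (\<Sum>k<n. m M / m b)" by (intro sum_mono)
  also have "\<dots> \<le> 1 / 2"
    using exit[folded m_def] m_pos[of b] by (simp add: field_simps)
  finally have half: "1 / 2 \<le> (\<Sum>z\<in>F. pk n b z)"
    using mass_left_of_barrier[OF assms(3), of n n] by (simp add: F_def)
  have mF: "0 < (\<Sum>z\<in>F. m z)" by (intro sum_pos) (use F m_pos in auto)
  have "(\<Sum>z\<in>F. pk n b z) = (\<Sum>z\<in>F. (pk n b z / sqrt (m z)) * sqrt (m z))"
    using m_pos by (intro sum.cong) (auto simp: less_le)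
  then have "(\<Sum>z\<in>F. pk n b z)\<^sup>2 \<le> (\<Sum>z\<in>F. (pk n b z / sqrt (m z))\<^sup>2) * (\<Sum>z\<in>F. (sqrt (m z))\<^sup>2)"
    using Cauchy_Schwarz_ineq_sum[of "\<lambda>z. pk n b z / sqrt (m z)" "\<lambda>z. sqrt (m z)" F] by simp
  also have "\<dots> = (\<Sum>z\<in>F. (pk n b z)\<^sup>2 / m z) * (\<Sum>z\<in>F. m z)"
    using m_pos by (simp add: power_divide less_imp_le)
  finally have CS: "(1 / 2)\<^sup>2 \<le> (\<Sum>z\<in>F. (pk n b z)\<^sup>2 / m z) * (\<Sum>z\<in>F. m z)"
    using power_mono[OF half, of 2] by simp
  have "(\<Sum>z\<in>F. pk n b z * pk n z b) = m b * (\<Sum>z\<in>F. (pk n b z)\<^sup>2 / m z)"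
    unfolding sum_distrib_left
  proof (intro sum.cong refl)
    fix z
    have "pk n z b = m b * pk n b z / m z"
      using rev[of z n b] m_pos[of z] by (simp add: field_simps)
    then show "pk n b z * pk n z b = m b * ((pk n b z)\<^sup>2 / m z)"
      by (simp add: power2_eq_square)
  qed
  then have "m b * (\<Sum>z\<in>F. (pk n b z)\<^sup>2 / m z) \<le> pk (2 * n) b b"
    using pk_add_ge[OF F(1), of n b n b] by (simp add: mult_2)
  moreover have "m b / (4 * (\<Sum>z\<in>F. m z)) \<le> m b * (\<Sum>z\<in>F. (pk n b z)\<^sup>2 / m z)"
  proof -
    have "1 / (4 * (\<Sum>z\<in>F. m z)) \<le> (\<Sum>z\<in>F. (pk n b z)\<^sup>2 / m z)"
      using CS mF by (simp add: field_simps power2_eq_square)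
    then have "m b * (1 / (4 * (\<Sum>z\<in>F. m z))) \<le> m b * (\<Sum>z\<in>F. (pk n b z)\<^sup>2 / m z)"
      using m_pos[of b] by (intro mult_left_mono) auto
    then show ?thesis by simp
  qed
  ultimately show ?thesis by (simp add: m_def F_def)
qed

text \<open>Probability of visiting \<open>b\<close> by time \<open>n\<close>, by recursion on the
  first step with \<open>b\<close> absorbing.\<close>

fun hit :: "int \<Rightarrow> nat \<Rightarrow> int \<Rightarrow> real" where
  "hit b 0 x = of_bool (x = b)"
| "hit b (Suc n) x = (if x = b then 1 else w x * hit b n (x + 1) + (1 - w x) * hit b n (x - 1))"

lemma hit_Suc_ge: "hit b n x \<le> hit b (Suc n) x"
proof (induction n arbitrary: x)
  case 0
  show ?case using w_pos[of x] w_less_1[of x] by auto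
next
  case (Suc n)
  show ?case
  proof (cases "x = b")
    case False
    have "w x * hit b n (x + 1) + (1 - w x) * hit b n (x - 1)
        \<le> w x * hit b (Suc n) (x + 1) + (1 - w x) * hit b (Suc n) (x - 1)"
      using w_pos[of x] w_less_1[of x] by (intro add_mono mult_left_mono Suc) auto
    then show ?thesis using False by (simp only: hit.simps if_False)
  qed simp
qed

lemma hit_mono: "m \<le> n \<Longrightarrow> hit b m x \<le> hit b n x"
  using lift_Suc_mono_le[of "\<lambda>n. hit b n x"] hit_Suc_ge by blast

text \<open>The sum of \<open>1 - hit b k x\<close> over \<open>k < n\<close> is the expected
  hitting time truncated at \<open>n\<close>, and the supersolution \<open>f\<close> dominates it.
  The summands decrease in \<open>k\<close>, so the last step is Markov's inequality.\<close>

lemma hit_ge_of_lyapunov: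
  assumes f: "\<And>x. x < b \<Longrightarrow> w x * f (x + 1) + (1 - w x) * f (x - 1) + 1 \<le> f x"
    and f_nonneg: "\<And>x. x \<le> b \<Longrightarrow> 0 \<le> f x" and "x \<le> b"
  shows "real n * (1 - hit b n x) \<le> f x"
proof -
  have "(\<Sum>k<n. 1 - hit b k x) \<le> f x"
    using assms(3)
  proof (induction n arbitrary: x)
    case 0
    then show ?case using f_nonneg by simp
  next
    case (Suc n)
    show ?case
    proof (cases "x = b")
      case True
      then have "1 - hit b k x = 0" for k by (cases k) auto
      then show ?thesis using f_nonneg[of x] Suc.prems by simp
    next
      case False
      have "(\<Sum>k<Suc n. 1 - hit b k x) = 1 + (\<Sum>k<n. 1 - hit b (Suc k) x)"
        by (subst sum.lessThan_Suc_shift) (use False in simp)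
      also have "(\<Sum>k<n. 1 - hit b (Suc k) x)
          = (\<Sum>k<n. w x * (1 - hit b k (x + 1)) + (1 - w x) * (1 - hit b k (x - 1)))"
        using False by (intro sum.cong) (auto simp: algebra_simps)
      also have "\<dots> = w x * (\<Sum>k<n. 1 - hit b k (x + 1)) + (1 - w x) * (\<Sum>k<n. 1 - hit b k (x - 1))"
        by (simp add: sum.distrib sum_distrib_left)
      also have "\<dots> \<le> w x * f (x + 1) + (1 - w x) * f (x - 1)"
        using w_pos[of x] w_less_1[of x] False Suc.prems
        by (intro add_mono mult_left_mono Suc.IH) auto
      finally show ?thesis using f[of x] False Suc.prems by simp
    qed
  qed
  moreover have "(\<Sum>k<n. 1 - hit b k x) \<ge> (\<Sum>k<n. 1 - hit b n x)"
    by (intro sum_mono) (auto intro: hit_mono)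
  ultimately show ?thesis by simp
qed

text \<open>Decomposition at the first visit to \<open>b\<close>: by parity the time left after it
  is even, so the return bound \<open>c\<close> applies.\<close>

lemma pk_ge_hit:
  assumes ret: "\<And>k. 2 * k \<le> n \<Longrightarrow> c \<le> pk (2 * k) b b" and "0 \<le> c"
    and par: "even (int n + x - b)"
  shows "c * hit b n x \<le> pk n x b"
  using ret par
proof (induction n arbitrary: x)
  case 0
  have "c \<le> pk (2 * 0) b b" by (rule 0) simp
  then show ?case by auto
next
  case (Suc n)
  show ?case
  proof (cases "x = b")
    case True
    then have "even (Suc n)" using Suc.prems(2) by simp
    then obtain k where "Suc n = 2 * k" by (rule evenE)
    moreover have "hit b (Suc n) x = 1" using True by simp
    ultimately show ?thesis using Suc.prems(1)[of k] True by simp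
  next
    case False
    have "c * hit b n y \<le> pk n y b" if "y = x + 1 \<or> y = x - 1" for y
      using Suc.prems that by (intro Suc.IH) auto
    then have IH: "c * hit b n (x + 1) \<le> pk n (x + 1) b" "c * hit b n (x - 1) \<le> pk n (x - 1) b"
      by auto
    have "c * hit b (Suc n) x = w x * (c * hit b n (x + 1)) + (1 - w x) * (c * hit b n (x - 1))"
      using False by (simp add: algebra_simps)
    also have "\<dots> \<le> w x * pk n (x + 1) b + (1 - w x) * pk n (x - 1) b"
      using IH w_pos[of x] w_less_1[of x] by (intro add_mono mult_left_mono) auto
    finally show ?thesis by (simp only: pk_Suc_left)
  qed
qed

text \<open>The product of two bounds: \<open>b\<close> is visited by time \<open>n'\<close> with
  probability at least 1/2, and the return probability to \<open>b\<close> at even times is at least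
  \<open>1 / (8 * (1 + h) * C)\<close>. The barrier is calibrated to the horizon \<open>n\<close>; a
  separate \<open>n'\<close> leaves room for a parity correction.\<close>

lemma trap_prob_ge:
  fixes W :: "int \<Rightarrow> real"
  assumes W: "\<And>i. W i = 1 + rho i * W (i - 1)" and W_nonneg: "\<And>i. 0 \<le> W i"
    and rho_le: "\<And>i. rho i \<le> h"
    and left: "W b \<le> C" and right: "(\<Sum>z\<in>{b + 1..M}. 1 / prod rho {b + 1..z}) \<le> C"
    and barrier: "2 * (1 + h) * real n \<le> prod rho {b + 1..M}"
    and time: "(1 + h) * (\<Sum>i\<in>{y..b - 1}. W i) \<le> real n / 4"
    and "b < M" "0 < n" "y \<le> x" "x \<le> b"
    and n': "n' \<le> n" "n \<le> 2 * n'" and par: "even (int n' + x - b)"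
  shows "1 / (16 * (1 + h) * C) \<le> pk n' x b"
proof -
  have h0: "0 < h" using rho_pos[of 0] rho_le[of 0] by simp
  have W1: "1 \<le> W i" for i
    using W[of i] mult_nonneg_nonneg[of "rho i" "W (i - 1)"] W_nonneg[of "i - 1"] rho_pos[of i] by simp
  then have C1: "1 \<le> C" using left order_trans by blast
  have rprod: "0 < prod rho S" for S using rho_pos by (simp add: prod_pos)
  \<comment> \<open>Conductances normalised by \<open>c b = 1\<close>; on either side of
    \<open>b\<close> one of the two products is empty.\<close>
  define c where "c z = prod rho {z + 1..b} / prod rho {b + 1..z}" for z
  have c_pos: "0 < c z" for z using rprod by (simp add: c_def)
  have c_rec: "c (z - 1) = rho z * c z" for z
  proof (cases "z \<le> b")
    case True
    then have "{z..b} = insert z {z + 1..b}" by auto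
    then show ?thesis using True by (simp add: c_def)
  next
    case False
    then have "{b + 1..z} = insert z {b + 1..z - 1}" by auto
    then show ?thesis using False rho_pos[of z] by (simp add: c_def)
  qed
  define m where "m z = c (z - 1) + c z" for z
  have m_le: "m z \<le> (1 + h) * c z" for z
    using mult_right_mono[OF rho_le[of z], of "c z"] c_pos[of z] by (simp add: m_def c_rec algebra_simps)
  have cb: "c b = 1" by (simp add: c_def)
  have mb: "1 \<le> m b" using cb c_pos[of "b - 1"] by (simp add: m_def)
  \<comment> \<open>Unrolling the recursion of \<open>W\<close> from \<open>b\<close> to the left
    produces exactly the conductances left of \<open>b\<close>, with a nonnegative remainder. Thus
    \<open>W b\<close> bounds the left half of the valley's mass.\<close>
  have left_sum: "(\<Sum>z\<in>{b - int R..b}. prod rho {z + 1..b}) + prod rho {b - int R..b} * W (b - int R - 1) = W b" for R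
  proof (induction R)
    case 0
    then show ?case using W[of b] by simp
  next
    case (Suc R)
    have "{b - int (Suc R)..b} = insert (b - int R - 1) {b - int R..b}" by auto
    then show ?case using Suc W[of "b - int R - 1"]
      by (simp add: algebra_simps)
  qed
  have mF: "(\<Sum>z\<in>{b - int R..M}. m z) \<le> 2 * (1 + h) * C" for R
  proof -
    have split: "{b - int R..M} = {b - int R..b} \<union> {b + 1..M}" using \<open>b < M\<close> by auto
    have "(\<Sum>z\<in>{b - int R..M}. m z) \<le> (\<Sum>z\<in>{b - int R..M}. (1 + h) * c z)"
      by (intro sum_mono m_le)
    also have "\<dots> = (1 + h) * ((\<Sum>z\<in>{b - int R..b}. c z) + (\<Sum>z\<in>{b + 1..M}. c z))"
      unfolding sum_distrib_left[symmetric] split by (subst sum.union_disjoint) auto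
    also have "(\<Sum>z\<in>{b - int R..b}. c z) = (\<Sum>z\<in>{b - int R..b}. prod rho {z + 1..b})"
      by (intro sum.cong) (auto simp: c_def)
    also have "\<dots> \<le> C"
      using left left_sum[of R] mult_nonneg_nonneg[of "prod rho {b - int R..b}" "W (b - int R - 1)"]
        W_nonneg[of "b - int R - 1"] rprod[of "{b - int R..b}"] by linarith
    also have "(\<Sum>z\<in>{b + 1..M}. c z) = (\<Sum>z\<in>{b + 1..M}. 1 / prod rho {b + 1..z})"
      by (intro sum.cong) (auto simp: c_def)
    also have "\<dots> \<le> C" by (rule right)
    also have "(1 + h) * (C + C) = 2 * (1 + h) * C" by (simp add: algebra_simps)
    finally show ?thesis using h0 by simp
  qed
  have ret: "1 / (8 * (1 + h) * C) \<le> pk (2 * k) b b" if "2 * k \<le> n" for k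
  proof -
    have "real n * m M \<le> m b / 2"
    proof -
      have "c M = 1 / prod rho {b + 1..M}" using \<open>b < M\<close> by (simp add: c_def)
      also have "\<dots> \<le> 1 / (2 * (1 + h) * real n)"
        using barrier h0 \<open>0 < n\<close> rprod by (intro divide_left_mono) auto
      finally have "(1 + h) * c M \<le> (1 + h) * (1 / (2 * (1 + h) * real n))"
        using h0 by (intro mult_left_mono) auto
      also have "\<dots> = ((1 + h) * 1) / ((1 + h) * (2 * real n))"
        by (simp add: ac_simps)
      also have "\<dots> = 1 / (2 * real n)"
        by (subst mult_divide_mult_cancel_left) (use h0 in auto)
      finally have "m M \<le> 1 / (2 * real n)" using m_le[of M] by linarith
      then have "real n * m M \<le> real n * (1 / (2 * real n))"
        by (rule mult_left_mono) simp
      also have "\<dots> = 1 / 2" using \<open>0 < n\<close> by simp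
      finally show ?thesis using mb by simp
    qed
    moreover have "real k * m M \<le> real n * m M"
      using that c_pos[of M] c_pos[of "M - 1"] by (intro mult_right_mono) (auto simp: m_def)
    ultimately have "m b / (4 * (\<Sum>z\<in>{b - int k..M}. m z)) \<le> pk (2 * k) b b"
      unfolding m_def by (intro return_prob_ge c_rec c_pos) (use \<open>b < M\<close> in auto)
    moreover have "1 / (4 * (2 * (1 + h) * C)) \<le> m b / (4 * (\<Sum>z\<in>{b - int k..M}. m z))"
    proof (intro frac_le mb)
      show "0 < 4 * (\<Sum>z\<in>{b - int k..M}. m z)"
        using \<open>b < M\<close> c_pos by (auto intro!: sum_pos simp: m_def add_pos_pos)
    qed (use mF[of k] mb in auto)
    moreover have "1 / (4 * (2 * (1 + h) * C)) = 1 / (8 * (1 + h) * C)"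
      by (simp add: algebra_simps)
    ultimately show ?thesis by linarith
  qed
  \<comment> \<open>The expected time to go from \<open>i\<close> to \<open>i + 1\<close> satisfies
    the recursion of \<open>W\<close> with \<open>1 / w i = 1 + rho i\<close> in place of 1. Since
    this is at most \<open>1 + h\<close>, the function \<open>f\<close> is a supersolution for the
    time to reach \<open>b\<close>.\<close>
  define f where "f x = (1 + h) * (\<Sum>i\<in>{x..b - 1}. W i)" for x
  have f_nonneg: "0 \<le> f x" for x
    using h0 W_nonneg by (simp add: f_def sum_nonneg)
  have hit: "real n' * (1 - hit b n' x) \<le> f x"
  proof (rule hit_ge_of_lyapunov)
    fix x assume "x < b"
    then have "{x..b - 1} = insert x {x + 1..b - 1}" "{x - 1..b - 1} = insert (x - 1) (insert x {x + 1..b - 1})"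
      by auto
    then have "f x = (1 + h) * W x + f (x + 1)" "f (x - 1) = (1 + h) * W (x - 1) + f x"
      by (auto simp: f_def algebra_simps)
    moreover have "1 \<le> (1 + h) * w x"
    proof -
      have "w x * rho x \<le> w x * h" using w_pos[of x] rho_le[of x] by (intro mult_left_mono) auto
      then show ?thesis by (simp add: w_mult_rho algebra_simps)
    qed
    moreover have "w x * ((1 + h) * W x) = (1 + h) * w x + (1 - w x) * ((1 + h) * W (x - 1))"
    proof -
      have "w x * W x = w x + (w x * rho x) * W (x - 1)"
        by (subst W) (simp add: algebra_simps)
      then have "(1 + h) * (w x * W x) = (1 + h) * (w x + (1 - w x) * W (x - 1))"
        by (simp only: w_mult_rho)
      then show ?thesis by (simp add: algebra_simps)
    qed
    moreover have "w x * f (x + 1) + (1 - w x) * f (x - 1) + 1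
      = f x - w x * (f x - f (x + 1)) + (1 - w x) * (f (x - 1) - f x) + 1"
      by (simp add: algebra_simps)
    ultimately show "w x * f (x + 1) + (1 - w x) * f (x - 1) + 1 \<le> f x"
      by simp
  qed (use f_nonneg \<open>x \<le> b\<close> in auto)
  have "f x \<le> (1 + h) * (\<Sum>i\<in>{y..b - 1}. W i)"
    unfolding f_def using h0 \<open>y \<le> x\<close> W_nonneg by (intro mult_left_mono sum_mono2) auto
  then have "real n' * (1 - hit b n' x) \<le> real n' * (1 / 2)"
    using hit time n' by linarith
  moreover have "0 < real n'" using n' \<open>0 < n\<close> by simp
  ultimately have "1 / 2 \<le> hit b n' x" by simp
  then have "1 / (8 * (1 + h) * C) * (1 / 2) \<le> 1 / (8 * (1 + h) * C) * hit b n' x"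
    using h0 C1 by (intro mult_left_mono) auto
  also have "\<dots> \<le> pk n' x b"
  proof (rule pk_ge_hit[OF _ _ par])
    show "1 / (8 * (1 + h) * C) \<le> pk (2 * k) b b" if "2 * k \<le> n'" for k
      using that n' by (intro ret) simp
  qed (use h0 C1 in simp)
  also have "1 / (8 * (1 + h) * C) * (1 / 2) = 1 / (16 * (1 + h) * C)"
    by (simp add: algebra_simps)
  finally show ?thesis .
qed

end

section \<open>Valleys of a random environment\<close>

lemma sum_triangle_le:
  fixes g :: "nat \<Rightarrow> nat \<Rightarrow> real"
  assumes "\<And>j l. 0 \<le> g j l"
  shows "(\<Sum>i<k. \<Sum>j\<in>{1..i}. g j (i - j)) \<le> (\<Sum>j\<in>{1..k}. \<Sum>l<k. g j l)"
proof -
  have "(\<Sum>i<k. \<Sum>j\<in>{1..i}. g j (i - j)) = (\<Sum>i<k. \<Sum>j\<in>{1..k}. if j \<le> i then g j (i - j) else 0)"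
  proof (rule sum.cong[OF refl])
    fix i assume "i \<in> {..<k}"
    then have "{1..i} = {j \<in> {1..k}. j \<le> i}" by auto
    then show "(\<Sum>j\<in>{1..i}. g j (i - j)) = (\<Sum>j\<in>{1..k}. if j \<le> i then g j (i - j) else 0)"
      by (simp only: sum.inter_filter[OF finite_atLeastAtMost])
  qed
  also have "\<dots> = (\<Sum>j\<in>{1..k}. \<Sum>i<k. if j \<le> i then g j (i - j) else 0)" by (rule sum.swap)
  also have "\<dots> \<le> (\<Sum>j\<in>{1..k}. \<Sum>l<k. g j l)"
  proof (rule sum_mono)
    fix j
    have "(\<Sum>i<k. if j \<le> i then g j (i - j) else 0) = (\<Sum>i\<in>{i \<in> {..<k}. j \<le> i}. g j (i - j))"
      by (simp only: sum.inter_filter[OF finite_lessThan])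
    also have "\<dots> = (\<Sum>l\<in>(\<lambda>i. i - j) ` {i \<in> {..<k}. j \<le> i}. g j l)"
      by (subst sum.reindex) (auto simp: inj_on_def)
    also have "\<dots> \<le> (\<Sum>l<k. g j l)"
      by (rule sum_mono2) (auto simp: assms)
    finally show "(\<Sum>i<k. if j \<le> i then g j (i - j) else 0) \<le> (\<Sum>l<k. g j l)" .
  qed
  finally show ?thesis .
qed

lemma powr_eventually_ge:
  fixes p :: real
  assumes "0 < p"
  shows "eventually (\<lambda>t. Y \<le> real t powr p) sequentially"
proof (rule eventually_sequentiallyI[of "nat \<lceil>(max Y 0) powr (1 / p)\<rceil>"])
  fix t assume "nat \<lceil>(max Y 0) powr (1 / p)\<rceil> \<le> t"
  then have "(max Y 0) powr (1 / p) \<le> real t" by linarith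
  then have "((max Y 0) powr (1 / p)) powr p \<le> real t powr p"
    using assms by (intro powr_mono2) auto
  then show "Y \<le> real t powr p" using assms by (simp add: powr_powr)
qed

lemma powr_add_le:
  fixes a b s :: real
  assumes "0 \<le> a" "0 \<le> b" "0 < s" "s \<le> 1"
  shows "(a + b) powr s \<le> a powr s + b powr s"
proof (cases "a + b = 0")
  case True
  then have "a = 0" "b = 0" using assms by auto
  then show ?thesis by simp
next
  case False
  then have ab: "0 < a + b" using assms by auto
  have le: "x / (a + b) \<le> (x / (a + b)) powr s" if "0 \<le> x" "x \<le> a + b" for x
  proof (cases "x = 0")
    case False
    have "(x / (a + b)) powr 1 \<le> (x / (a + b)) powr s"
      using that ab assms False by (intro powr_mono') auto
    then show ?thesis using that ab False by simp
  qed simp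
  have "1 = a / (a + b) + b / (a + b)" using ab by (simp add: add_divide_distrib[symmetric])
  also have "\<dots> \<le> (a / (a + b)) powr s + (b / (a + b)) powr s"
    using le[of a] le[of b] assms by simp
  also have "\<dots> = (a powr s + b powr s) / (a + b) powr s"
    using assms ab by (simp add: powr_divide add_divide_distrib)
  finally show ?thesis using ab by (simp add: field_simps)
qed

lemma sum_powr_le:
  fixes f :: "'b \<Rightarrow> real"
  assumes "finite S" "\<And>x. x \<in> S \<Longrightarrow> 0 \<le> f x" "0 < s" "s \<le> 1"
  shows "(\<Sum>x\<in>S. f x) powr s \<le> (\<Sum>x\<in>S. f x powr s)"
  using assms(1,2)
proof (induction S)
  case (insert x S)
  have "(f x + sum f S) powr s \<le> f x powr s + sum f S powr s"
    using insert assms by (intro powr_add_le sum_nonneg) auto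
  also have "\<dots> \<le> f x powr s + (\<Sum>x\<in>S. f x powr s)"
    using insert by simp
  finally show ?case using insert by simp
qed simp

lemma geometric_partial_sum_le:
  fixes r :: real
  assumes "0 \<le> r" "r < 1" "finite S"
  shows "(\<Sum>k\<in>S. r ^ k) \<le> 1 / (1 - r)"
proof -
  have "(\<Sum>k\<in>S. r ^ k) \<le> (\<Sum>k. r ^ k)"
    using assms by (intro sum_le_suminf summable_geometric) auto
  then show ?thesis using assms by (simp add: suminf_geometric)
qed

text \<open>A value \<open>a\<close> between \<open>x * (1/2) ^ Suc i\<close> and
  \<open>x * (1/2) ^ i\<close> is paid for by the \<open>i\<close>-th term, a smaller one by the
  first summand. In this form truncated expectations reduce to tail probabilities at dyadic
  levels.\<close>

lemma min_le_dyadic: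
  fixes a x :: real
  assumes "0 \<le> x"
  shows "min a x \<le> x * (1/2) ^ n + (\<Sum>i<n. x * (1/2) ^ i * of_bool (x * (1/2) ^ Suc i \<le> a))"
proof (induction n)
  case (Suc n)
  show ?case
  proof (cases "x * (1/2) ^ Suc n \<le> a")
    case True
    then have "(\<Sum>i<Suc n. x * (1/2) ^ i * of_bool (x * (1/2) ^ Suc i \<le> a))
        = (\<Sum>i<n. x * (1/2) ^ i * of_bool (x * (1/2) ^ Suc i \<le> a)) + x * (1/2) ^ n"
      by (simp del: power_Suc)
    moreover have "0 \<le> x * (1/2) ^ Suc n" using assms by simp
    ultimately show ?thesis using Suc by linarith
  next
    case False
    have "0 \<le> (\<Sum>i<Suc n. x * (1/2) ^ i * of_bool (x * (1/2) ^ Suc i \<le> a))"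
      using assms by (intro sum_nonneg) auto
    then show ?thesis using False by linarith
  qed
qed simp

text \<open>The ratio is an abstract function \<open>rh\<close> with bounds at every real argument,
  not just almost everywhere; estimates on finite products then hold for every environment.\<close>

locale random_env = iid \<nu> for \<nu> :: "real measure" +
  fixes rh :: "real \<Rightarrow> real" and h \<kappa> s r :: real
  assumes rh_measurable [measurable]: "rh \<in> borel_measurable borel"
    and rh_pos: "0 < rh u" and rh_le: "rh u \<le> h" and rh_ge: "1 / h \<le> rh u"
    and s_pos: "0 < s" and s_less: "s < \<kappa>" and kappa_less_1: "\<kappa> < 1"
    and moment_kappa: "(\<integral>u. rh u powr \<kappa> \<partial>\<nu>) = 1"
    and moment_s: "(\<integral>u. rh u powr s \<partial>\<nu>) = r" and r_less_1: "r < 1"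
begin

abbreviation env :: "(int \<Rightarrow> real) measure" where
  "env \<equiv> PP"

sublocale env: prob_space env
  by (rule prob_space_PP)

lemma h_pos: "0 < h"
  using rh_pos[of 0] rh_le[of 0] by simp

lemma r_nonneg: "0 \<le> r"
  using moment_s by (auto simp flip: moment_s intro!: Bochner_Integration.integral_nonneg)

lemma h_ge_1: "1 \<le> h"
proof -
  have "1 \<le> h * h" using order.trans[OF rh_ge[of 0] rh_le[of 0]] h_pos by (simp add: field_simps)
  then show ?thesis using h_pos mult_strict_mono[of h 1 h 1] by (cases "h < 1") auto
qed

section \<open>Products of ratios: bounds, moments and independence\<close>

definition rprod :: "(int \<Rightarrow> real) \<Rightarrow> int \<Rightarrow> nat \<Rightarrow> real" where
  "rprod \<omega> b k = (\<Prod>l\<in>{b + 1..b + int k}. rh (\<omega> l))"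

lemma rprod_0 [simp]: "rprod \<omega> b 0 = 1"
  by (simp add: rprod_def)

lemma rprod_pos: "0 < rprod \<omega> b k"
  by (simp add: rprod_def prod_pos rh_pos)

lemma rprod_nonneg: "0 \<le> rprod \<omega> b k"
  using rprod_pos less_imp_le by blast

lemma rprod_add: "rprod \<omega> b (k + l) = rprod \<omega> b k * rprod \<omega> (b + int k) l"
proof -
  have "{b + 1..b + int (k + l)} = {b + 1..b + int k} \<union> {b + int k + 1..b + int k + int l}" by auto
  then show ?thesis by (simp add: rprod_def prod.union_disjoint)
qed

lemma rprod_1: "rprod \<omega> b (Suc 0) = rh (\<omega> (b + 1))"
  by (simp add: rprod_def)

lemma rprod_Suc: "rprod \<omega> b (Suc k) = rprod \<omega> b k * rh (\<omega> (b + int k + 1))"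
  using rprod_add[of \<omega> b k 1] by (simp add: rprod_1)

lemma rprod_split: "j \<le> k \<Longrightarrow> rprod \<omega> b k = rprod \<omega> b j * rprod \<omega> (b + int j) (k - j)"
  using rprod_add[of \<omega> b j "k - j"] by simp

lemma rprod_le: "rprod \<omega> b k \<le> h ^ k"
proof (induction k)
  case (Suc k)
  have "rprod \<omega> b k * rh (\<omega> (b + int k + 1)) \<le> h ^ k * h"
    using Suc h_pos by (intro mult_mono rh_le) (auto simp: rprod_nonneg less_imp_le rh_pos)
  then show ?case by (simp add: rprod_Suc mult.commute)
qed simp

lemma rprod_ge: "(1 / h) ^ k \<le> rprod \<omega> b k"
proof (induction k)
  case (Suc k)
  have "(1 / h) ^ k * (1 / h) \<le> rprod \<omega> b k * rh (\<omega> (b + int k + 1))"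
    using Suc h_pos by (intro mult_mono rh_ge) (auto simp: rprod_nonneg less_imp_le)
  then show ?case by (simp add: rprod_Suc mult.commute)
qed simp

lemma measurable_rprod [measurable]: "(\<lambda>\<omega>. rprod \<omega> b k) \<in> borel_measurable env"
  unfolding rprod_def by measurable

lemma dep_rprod: "{b + 1..b + int k} \<subseteq> I \<Longrightarrow> dep I (\<lambda>\<omega>. rprod \<omega> b k)"
  unfolding rprod_def by (intro dep_prod dep_comp[of _ "\<lambda>\<omega>. \<omega> _" rh] dep_coord) auto

lemma abs_rprod_powr_le: "\<bar>rprod \<omega> b k powr a\<bar> \<le> (h ^ k) powr \<bar>a\<bar>"
proof (cases "0 \<le> a")
  case True
  then show ?thesis using rprod_le[of \<omega> b k] by (auto intro!: powr_mono2 rprod_nonneg)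
next
  case False
  have "rprod \<omega> b k powr a = (1 / rprod \<omega> b k) powr \<bar>a\<bar>"
    using False rprod_pos[of \<omega> b k] by (simp add: powr_divide powr_minus_divide)
  also have "\<dots> \<le> (h ^ k) powr \<bar>a\<bar>"
  proof (rule powr_mono2)
    show "1 / rprod \<omega> b k \<le> h ^ k"
      using rprod_ge[of k \<omega> b] rprod_pos[of \<omega> b k] h_pos by (simp add: field_simps)
  qed (use rprod_nonneg in auto)
  finally show ?thesis by simp
qed

lemma integrable_rprod_powr: "integrable env (\<lambda>\<omega>. rprod \<omega> b k powr a)"
  by (rule integrable_bounded[OF _ abs_rprod_powr_le]) measurable

lemma integrable_mult_rprod_powr:
  assumes [measurable]: "f \<in> borel_measurable env" and "\<And>\<omega>. \<bar>f \<omega>\<bar> \<le> B"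
  shows "integrable env (\<lambda>\<omega>. f \<omega> * rprod \<omega> b k powr a)"
proof (rule integrable_bounded)
  show "\<bar>f \<omega> * rprod \<omega> b k powr a\<bar> \<le> B * (h ^ k) powr \<bar>a\<bar>" for \<omega>
    unfolding abs_mult using assms(2)[of \<omega>] abs_rprod_powr_le
    by (intro mult_mono) auto
qed measurable

lemma expectation_rprod_powr:
  "(\<integral>\<omega>. rprod \<omega> b k powr a \<partial>env) = (\<integral>u. rh u powr a \<partial>\<nu>) ^ k"
proof (induction k)
  case 0
  then show ?case using env.prob_space by simp
next
  case (Suc k)
  have one: "(\<integral>\<omega>. rprod \<omega> (b + int k) (Suc 0) powr a \<partial>env) = (\<integral>u. rh u powr a \<partial>\<nu>)"
    unfolding rprod_1 by (rule expectation_coord[where g = "\<lambda>u. rh u powr a"]) measurable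
  have "(\<integral>\<omega>. rprod \<omega> b (Suc k) powr a \<partial>env)
      = (\<integral>\<omega>. rprod \<omega> b k powr a * rprod \<omega> (b + int k) (Suc 0) powr a \<partial>env)"
    using rprod_add[of _ b k "Suc 0"] by (simp add: powr_mult rprod_nonneg)
  also have "\<dots> = (\<integral>\<omega>. rprod \<omega> b k powr a \<partial>env) * (\<integral>\<omega>. rprod \<omega> (b + int k) (Suc 0) powr a \<partial>env)"
    by (rule expectation_mult[where I = "{b + 1..b + int k}" and J = "{b + int k + 1..b + int k + 1}"])
       (auto intro!: integrable_rprod_powr dep_comp[of _ _ "\<lambda>x. x powr a"] dep_rprod)
  finally show ?case by (simp add: Suc one)
qed

lemmas moment_rprod_s = expectation_rprod_powr[of _ _ s, unfolded moment_s]
lemmas moment_rprod_kappa = expectation_rprod_powr[of _ _ \<kappa>, unfolded moment_kappa power_one]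

text \<open>For \<open>a = \<kappa>\<close> the last factor is 1: this is the martingale property in
  the form in which a fresh product may be appended to, or dropped from, an expectation.\<close>

lemma expectation_mult_rprod_powr:
  assumes f: "f \<in> borel_measurable env" "\<And>\<omega>. \<bar>f \<omega>\<bar> \<le> B" "dep {..b} f"
  shows "(\<integral>\<omega>. f \<omega> * rprod \<omega> b k powr a \<partial>env) = (\<integral>\<omega>. f \<omega> \<partial>env) * (\<integral>u. rh u powr a \<partial>\<nu>) ^ k"
proof -
  have "(\<integral>\<omega>. f \<omega> * rprod \<omega> b k powr a \<partial>env)
      = (\<integral>\<omega>. f \<omega> \<partial>env) * (\<integral>\<omega>. rprod \<omega> b k powr a \<partial>env)"
    by (rule expectation_mult[where I = "{..b}" and J = "{b + 1..b + int k}"])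
       (auto intro!: integrable_rprod_powr integrable_bounded[OF f(1,2)] f(3)
         dep_comp[of _ _ "\<lambda>x. x powr a"] dep_rprod)
  then show ?thesis by (simp add: expectation_rprod_powr)
qed

lemma prob_rprod_ge:
  assumes "0 < x"
  shows "env.prob {\<omega>. x \<le> rprod \<omega> b k} \<le> x powr - s * r ^ k"
proof -
  have "env.prob {\<omega>. x \<le> rprod \<omega> b k} = (\<integral>\<omega>. of_bool (x \<le> rprod \<omega> b k) \<partial>env)"
    by (rule prob_eq_expectation) measurable
  also have "\<dots> \<le> (\<integral>\<omega>. x powr - s * rprod \<omega> b k powr s \<partial>env)"
  proof (intro integral_mono integrable_of_bool integrable_mult_right integrable_rprod_powr)
    fix \<omega>
    have "1 \<le> x powr - s * rprod \<omega> b k powr s" if "x \<le> rprod \<omega> b k"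
    proof -
      have "x powr s \<le> rprod \<omega> b k powr s" using that assms s_pos by (intro powr_mono2) auto
      then have "x powr - s * x powr s \<le> x powr - s * rprod \<omega> b k powr s" by (intro mult_left_mono) auto
      then show ?thesis using assms by (simp add: powr_minus)
    qed
    then show "of_bool (x \<le> rprod \<omega> b k) \<le> x powr - s * rprod \<omega> b k powr s"
      by auto
  qed measurable
  also have "\<dots> = x powr - s * r ^ k" by (simp add: moment_rprod_s)
  finally show ?thesis .
qed

section \<open>First passages of the products over a level\<close>

definition passage :: "real \<Rightarrow> int \<Rightarrow> nat \<Rightarrow> (int \<Rightarrow> real) \<Rightarrow> bool" where
  "passage x b j \<omega> \<longleftrightarrow> x \<le> rprod \<omega> b j \<and> (\<forall>i\<in>{..<j}. rprod \<omega> b i < x)"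

lemma measurable_passage [measurable]: "Measurable.pred env (passage x b j)"
  unfolding passage_def by measurable

lemma dep_passage: "{b + 1..b + int j} \<subseteq> I \<Longrightarrow> dep I (passage x b j)"
  unfolding passage_def
  by (intro dep_comp2[where g = "(\<and>)"] dep_ball dep_comp[of _ _ "\<lambda>y. x \<le> y"]
      dep_comp[of _ _ "\<lambda>y. y < x"] dep_rprod) auto

lemma passage_unique: "passage x b j \<omega> \<Longrightarrow> passage x b j' \<omega> \<Longrightarrow> j = j'"
  unfolding passage_def by (meson lessThan_iff linorder_neqE_nat not_less)

lemma sum_passage_le_1: "finite S \<Longrightarrow> (\<Sum>j\<in>S. of_bool (passage x b j \<omega>)) \<le> (1::real)"
proof (cases "\<exists>j\<in>S. passage x b j \<omega>")
  case True
  assume "finite S"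
  from True obtain j where "j \<in> S" "passage x b j \<omega>" by auto
  then have "(\<Sum>i\<in>S. of_bool (passage x b i \<omega>)) = (\<Sum>i\<in>S. if i = j then 1 else (0::real))"
    by (intro sum.cong) (auto dest: passage_unique)
  then show ?thesis using \<open>finite S\<close> by (simp add: sum.delta)
next
  case False
  then have "(\<Sum>j\<in>S. of_bool (passage x b j \<omega>)) = (0::real)" by (intro sum.neutral) auto
  then show ?thesis by simp
qed

lemma passage_exists:
  assumes "x \<le> rprod \<omega> b k"
  obtains j where "j \<le> k" "passage x b j \<omega>"
proof -
  define j where "j = (LEAST j. x \<le> rprod \<omega> b j)"
  have "x \<le> rprod \<omega> b j" "j \<le> k"
    unfolding j_def using assms by (auto intro: LeastI Least_le)
  moreover have "rprod \<omega> b i < x" if "i < j" for i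
    using that not_less_Least[of i "\<lambda>j. x \<le> rprod \<omega> b j"] by (auto simp: j_def)
  ultimately show thesis using that by (auto simp: passage_def)
qed

lemma passage_overshoot:
  assumes "passage x b j \<omega>" "1 < x"
  shows "rprod \<omega> b j \<le> h * x"
proof (cases j)
  case 0
  then show ?thesis using assms by (simp add: passage_def)
next
  case (Suc i)
  have "rprod \<omega> b i * rh (\<omega> (b + int i + 1)) \<le> x * h"
    using assms Suc by (intro mult_mono rh_le) (auto simp: passage_def rprod_nonneg less_imp_le rh_pos)
  then show ?thesis by (simp add: Suc rprod_Suc mult.commute)
qed

text \<open>Doob's maximal inequality for the martingale \<open>k \<mapsto> rprod \<omega> b k powr \<kappa>\<close>.\<close>
lemma sum_prob_passage_le:
  assumes "0 < x"
  shows "(\<Sum>j\<le>L. env.prob {\<omega>. passage x b j \<omega>}) \<le> x powr - \<kappa>"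
proof -
  have \<kappa>: "0 < \<kappa>" using s_pos s_less by simp
  have "x powr \<kappa> * env.prob {\<omega>. passage x b j \<omega>}
      \<le> (\<integral>\<omega>. of_bool (passage x b j \<omega>) * rprod \<omega> b L powr \<kappa> \<partial>env)" if "j \<le> L" for j
  proof -
    have "x powr \<kappa> * env.prob {\<omega>. passage x b j \<omega>} = (\<integral>\<omega>. x powr \<kappa> * of_bool (passage x b j \<omega>) \<partial>env)"
      by (simp add: prob_eq_expectation)
    also have "\<dots> \<le> (\<integral>\<omega>. of_bool (passage x b j \<omega>) * rprod \<omega> b j powr \<kappa> \<partial>env)"
    proof (intro integral_mono integrable_mult_rprod_powr[where B = 1] integrable_mult_right integrable_of_bool)
      fix \<omega>
      have "x powr \<kappa> \<le> rprod \<omega> b j powr \<kappa>" if "passage x b j \<omega>"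
        using that assms \<kappa> by (intro powr_mono2) (auto simp: passage_def)
      then show "x powr \<kappa> * of_bool (passage x b j \<omega>) \<le> of_bool (passage x b j \<omega>) * rprod \<omega> b j powr \<kappa>"
        by auto
    qed auto
    \<comment> \<open>Appending the independent factor of mean 1 moves the weight from the passage
      index \<open>j\<close> to the common index \<open>L\<close>, where the disjoint passages can
      be summed.\<close>
    also have "\<dots> = (\<integral>\<omega>. (of_bool (passage x b j \<omega>) * rprod \<omega> b j powr \<kappa>) * rprod \<omega> (b + int j) (L - j) powr \<kappa> \<partial>env)"
    proof -
      have "\<bar>of_bool (passage x b j \<omega>) * rprod \<omega> b j powr \<kappa>\<bar> \<le> (h ^ j) powr \<bar>\<kappa>\<bar>" for \<omega>
        using abs_rprod_powr_le[of \<omega> b j \<kappa>] by auto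
      moreover have "dep {..b + int j} (\<lambda>\<omega>. of_bool (passage x b j \<omega>) * rprod \<omega> b j powr \<kappa>)"
        by (intro dep_comp2[where g = "(*)"] dep_comp[of _ _ of_bool] dep_comp[of _ _ "\<lambda>y. y powr \<kappa>"]
            dep_passage dep_rprod) auto
      ultimately show ?thesis
        by (subst expectation_mult_rprod_powr[where B = "(h ^ j) powr \<bar>\<kappa>\<bar>"]) (auto simp: moment_kappa)
    qed
    also have "\<dots> = (\<integral>\<omega>. of_bool (passage x b j \<omega>) * rprod \<omega> b L powr \<kappa> \<partial>env)"
      using rprod_split[OF that, of _ b] by (simp add: powr_mult rprod_nonneg mult.assoc)
    finally show ?thesis .
  qed
  then have "(\<Sum>j\<le>L. x powr \<kappa> * env.prob {\<omega>. passage x b j \<omega>})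
      \<le> (\<Sum>j\<le>L. \<integral>\<omega>. of_bool (passage x b j \<omega>) * rprod \<omega> b L powr \<kappa> \<partial>env)"
    by (intro sum_mono) auto
  also have "\<dots> = (\<integral>\<omega>. (\<Sum>j\<le>L. of_bool (passage x b j \<omega>) * rprod \<omega> b L powr \<kappa>) \<partial>env)"
    by (rule Bochner_Integration.integral_sum[symmetric]) (auto intro!: integrable_mult_rprod_powr[where B = 1])
  also have "\<dots> \<le> (\<integral>\<omega>. rprod \<omega> b L powr \<kappa> \<partial>env)"
  proof (intro integral_mono Bochner_Integration.integrable_sum integrable_mult_rprod_powr[where B = 1] integrable_rprod_powr)
    fix \<omega>
    have "(\<Sum>j\<le>L. of_bool (passage x b j \<omega>)) * rprod \<omega> b L powr \<kappa> \<le> 1 * rprod \<omega> b L powr \<kappa>"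
      by (intro mult_right_mono sum_passage_le_1) auto
    then show "(\<Sum>j\<le>L. of_bool (passage x b j \<omega>) * rprod \<omega> b L powr \<kappa>) \<le> rprod \<omega> b L powr \<kappa>"
      by (simp add: sum_distrib_right)
  qed auto
  also have "\<dots> = 1" by (rule moment_rprod_kappa)
  finally have "x powr \<kappa> * (\<Sum>j\<le>L. env.prob {\<omega>. passage x b j \<omega>}) \<le> 1" by (simp add: sum_distrib_left)
  then show ?thesis using assms by (simp add: powr_minus field_simps)
qed


lemma kappa_pos: "0 < \<kappa>"
  using s_pos s_less by simp

lemma s_less_1: "s < 1"
  using s_less kappa_less_1 by simp

text \<open>This bounds the expected number of indices at which the product is above
  \<open>x\<close>. Passing \<open>x\<close> costs \<open>x powr - \<kappa>\<close>; the overshoot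
  is at most a factor \<open>h\<close>, so every later such index requires a fresh product above
  \<open>1 / h\<close>, and moment \<open>s\<close> makes these probabilities geometric. For
  \<open>x \<le> 1\<close> moment \<open>s\<close> alone gives the bound.\<close>

lemma sum_prob_rprod_ge:
  assumes "0 < x"
  shows "(\<Sum>k<K. env.prob {\<omega>. x \<le> rprod \<omega> b k}) \<le> h powr s / (1 - r) * x powr - \<kappa>"
proof (cases "x \<le> 1")
  case True
  have "(\<Sum>k<K. env.prob {\<omega>. x \<le> rprod \<omega> b k}) \<le> (\<Sum>k<K. x powr - s * r ^ k)"
    by (intro sum_mono prob_rprod_ge assms)
  also have "\<dots> \<le> x powr - s * (1 / (1 - r))"
    unfolding sum_distrib_left[symmetric]
    using r_nonneg r_less_1 by (intro mult_left_mono geometric_partial_sum_le) auto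
  also have "\<dots> \<le> (h powr s * x powr - \<kappa>) * (1 / (1 - r))"
  proof (intro mult_right_mono)
    have "1 * x powr - s \<le> h powr s * x powr - \<kappa>"
      using h_ge_1 s_pos True assms s_less by (intro mult_mono powr_mono' ge_one_powr_ge_zero) auto
    then show "x powr - s \<le> h powr s * x powr - \<kappa>" by simp
  qed (use r_less_1 in simp)
  finally show ?thesis by simp
next
  case False
  define p where "p j = env.prob {\<omega>. passage x b j \<omega>}" for j
  have p_nonneg: "0 \<le> p j" for j by (simp add: p_def)
  have step: "env.prob {\<omega>. x \<le> rprod \<omega> b k} \<le> (\<Sum>j\<le>k. p j * (h powr s * r ^ (k - j)))" for k
  proof -
    have "env.prob {\<omega>. x \<le> rprod \<omega> b k}
        \<le> env.prob {\<omega>. \<exists>j\<in>{..k}. passage x b j \<omega> \<and> 1 / h \<le> rprod \<omega> (b + int j) (k - j)}"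
    proof (rule prob_mono_pred)
      fix \<omega> assume x: "x \<le> rprod \<omega> b k"
      then obtain j where j: "j \<le> k" "passage x b j \<omega>" by (rule passage_exists)
      have "x \<le> rprod \<omega> b j * rprod \<omega> (b + int j) (k - j)"
        using x rprod_split[OF j(1)] by simp
      also have "\<dots> \<le> (h * x) * rprod \<omega> (b + int j) (k - j)"
        using passage_overshoot[OF j(2)] False by (intro mult_right_mono) (auto simp: rprod_nonneg)
      finally have "1 / h \<le> rprod \<omega> (b + int j) (k - j)"
        using h_pos assms by (simp add: field_simps)
      with j show "\<exists>j\<in>{..k}. passage x b j \<omega> \<and> 1 / h \<le> rprod \<omega> (b + int j) (k - j)" by auto
    qed measurable
    also have "\<dots> \<le> (\<Sum>j\<in>{..k}. env.prob {\<omega>. passage x b j \<omega> \<and> 1 / h \<le> rprod \<omega> (b + int j) (k - j)})"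
      by (rule prob_bex_le) auto
    also have "\<dots> \<le> (\<Sum>j\<le>k. p j * (h powr s * r ^ (k - j)))"
    proof (rule sum_mono)
      fix j assume "j \<in> {..k}"
      have "env.prob {\<omega>. passage x b j \<omega> \<and> 1 / h \<le> rprod \<omega> (b + int j) (k - j)}
          = p j * env.prob {\<omega>. 1 / h \<le> rprod \<omega> (b + int j) (k - j)}"
        unfolding p_def
        by (rule prob_conj_eq_mult[where I = "{b + 1..b + int j}" and J = "{b + int j + 1..b + int j + int (k - j)}"])
           (auto intro!: dep_passage dep_comp[of _ _ "\<lambda>y. 1 / h \<le> y"] dep_rprod)
      also have "\<dots> \<le> p j * ((1 / h) powr - s * r ^ (k - j))"
        using h_pos by (intro mult_left_mono prob_rprod_ge p_nonneg) auto
      also have "(1 / h) powr - s = h powr s" using h_pos by (simp add: powr_divide powr_minus_divide)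
      finally show "env.prob {\<omega>. passage x b j \<omega> \<and> 1 / h \<le> rprod \<omega> (b + int j) (k - j)}
        \<le> p j * (h powr s * r ^ (k - j))" .
    qed
    finally show ?thesis .
  qed
  have "(\<Sum>k<K. env.prob {\<omega>. x \<le> rprod \<omega> b k}) \<le> (\<Sum>k<K. \<Sum>j\<le>k. p j * (h powr s * r ^ (k - j)))"
    by (intro sum_mono step)
  also have "\<dots> = (\<Sum>k<K. \<Sum>j\<le>K. if j \<le> k then p j * (h powr s * r ^ (k - j)) else 0)"
  proof (rule sum.cong[OF refl])
    fix k assume "k \<in> {..<K}"
    then have "{..k} = {j \<in> {..K}. j \<le> k}" by auto
    then show "(\<Sum>j\<le>k. p j * (h powr s * r ^ (k - j))) = (\<Sum>j\<le>K. if j \<le> k then p j * (h powr s * r ^ (k - j)) else 0)"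
      by (simp only: sum.inter_filter[OF finite_atMost])
  qed
  also have "\<dots> = (\<Sum>j\<le>K. \<Sum>k<K. if j \<le> k then p j * (h powr s * r ^ (k - j)) else 0)"
    by (rule sum.swap)
  also have "\<dots> \<le> (\<Sum>j\<le>K. p j * (h powr s * (1 / (1 - r))))"
  proof (rule sum_mono)
    fix j
    have "(\<Sum>k<K. if j \<le> k then p j * (h powr s * r ^ (k - j)) else 0)
        = (\<Sum>k\<in>{k \<in> {..<K}. j \<le> k}. p j * (h powr s * r ^ (k - j)))"
      by (simp only: sum.inter_filter[OF finite_lessThan])
    also have "\<dots> = p j * (h powr s * (\<Sum>k\<in>{k \<in> {..<K}. j \<le> k}. r ^ (k - j)))"
      by (simp add: sum_distrib_left)
    also have "(\<Sum>k\<in>{k \<in> {..<K}. j \<le> k}. r ^ (k - j)) = (\<Sum>l\<in>(\<lambda>k. k - j) ` {k \<in> {..<K}. j \<le> k}. r ^ l)"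
      by (subst sum.reindex) (auto simp: inj_on_def)
    also have "\<dots> \<le> 1 / (1 - r)"
      using r_nonneg r_less_1 by (intro geometric_partial_sum_le) auto
    finally show "(\<Sum>k<K. if j \<le> k then p j * (h powr s * r ^ (k - j)) else 0) \<le> p j * (h powr s * (1 / (1 - r)))"
      using p_nonneg by (simp add: mult_left_mono)
  qed
  also have "\<dots> = h powr s * (1 / (1 - r)) * (\<Sum>j\<le>K. p j)"
    unfolding sum_distrib_left by (intro sum.cong refl) simp
  also have "\<dots> \<le> h powr s * (1 / (1 - r)) * x powr - \<kappa>"
    using r_less_1 sum_prob_passage_le[OF assms, of b K] by (intro mult_left_mono) (auto simp: p_def)
  finally show ?thesis by simp
qed

text \<open>The value of a geometric series over the dyadic levels below the truncation. Its ratio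
  \<open>2 powr (\<kappa> - 1)\<close> is less than 1 because \<open>\<kappa> < 1\<close>.\<close>

definition C_trunc :: real where
  "C_trunc = h powr s / (1 - r) * 2 powr \<kappa> * (1 / (1 - 2 powr (\<kappa> - 1)))"

lemma C_trunc_pos: "0 < C_trunc"
proof -
  have "2 powr (\<kappa> - 1) < 2 powr (0::real)" using kappa_less_1 by (intro powr_less_mono) auto
  then show ?thesis using h_pos r_less_1 by (simp add: C_trunc_def)
qed

text \<open>By Jensen's inequality the first moment of \<open>rh\<close> is at least 1, so without
  truncation these sums would diverge as \<open>K\<close> grows. Truncated at \<open>x\<close>, they
  are controlled by the tail sums of \<open>sum_prob_rprod_ge\<close>.\<close>

lemma sum_truncated_expectation_le:
  assumes "0 < x"
  shows "(\<Sum>k<K. \<integral>\<omega>. min (rprod \<omega> b k) x \<partial>env) \<le> C_trunc * x powr (1 - \<kappa>)"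
proof -
  define D where "D = h powr s / (1 - r)"
  define q where "q = 2 powr (\<kappa> - 1)"
  have D: "0 \<le> D" using r_less_1 by (simp add: D_def)
  have q: "0 \<le> q" "q < 1"
  proof -
    have "2 powr (\<kappa> - 1) < 2 powr (0::real)" using kappa_less_1 by (intro powr_less_mono) auto
    then show "q < 1" by (simp add: q_def)
  qed (simp add: q_def)
  have int_bool: "integrable env (\<lambda>\<omega>. x * (1/2) ^ i * of_bool (x * (1/2) ^ Suc i \<le> rprod \<omega> b k))" for i k
    by (intro integrable_mult_right integrable_of_bool) measurable
  have key: "(\<Sum>k<K. \<integral>\<omega>. min (rprod \<omega> b k) x \<partial>env) \<le> (real K * x) * (1/2) ^ n + C_trunc * x powr (1 - \<kappa>)" for n
  proof -
    have "(\<integral>\<omega>. min (rprod \<omega> b k) x \<partial>env)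
        \<le> x * (1/2) ^ n + (\<Sum>i<n. x * (1/2) ^ i * env.prob {\<omega>. x * (1/2) ^ Suc i \<le> rprod \<omega> b k})" for k
    proof -
      have "(\<integral>\<omega>. min (rprod \<omega> b k) x \<partial>env)
        \<le> (\<integral>\<omega>. x * (1/2) ^ n + (\<Sum>i<n. x * (1/2) ^ i * of_bool (x * (1/2) ^ Suc i \<le> rprod \<omega> b k)) \<partial>env)"
      proof (rule integral_mono)
        show "integrable env (\<lambda>\<omega>. min (rprod \<omega> b k) x)"
          by (rule integrable_bounded[where B = x]) (use assms rprod_nonneg in auto)
        show "integrable env (\<lambda>\<omega>. x * (1/2) ^ n + (\<Sum>i<n. x * (1/2) ^ i * of_bool (x * (1/2) ^ Suc i \<le> rprod \<omega> b k)))"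
          by (intro Bochner_Integration.integrable_add Bochner_Integration.integrable_sum int_bool env.integrable_const)
      qed (use assms min_le_dyadic in auto)
      also have "\<dots> = x * (1/2) ^ n + (\<Sum>i<n. x * (1/2) ^ i * env.prob {\<omega>. x * (1/2) ^ Suc i \<le> rprod \<omega> b k})"
      proof -
        have "(\<integral>\<omega>. (\<Sum>i<n. x * (1/2) ^ i * of_bool (x * (1/2) ^ Suc i \<le> rprod \<omega> b k)) \<partial>env)
            = (\<Sum>i<n. \<integral>\<omega>. x * (1/2) ^ i * of_bool (x * (1/2) ^ Suc i \<le> rprod \<omega> b k) \<partial>env)"
          by (rule Bochner_Integration.integral_sum) (rule int_bool)
        also have "\<dots> = (\<Sum>i<n. x * (1/2) ^ i * env.prob {\<omega>. x * (1/2) ^ Suc i \<le> rprod \<omega> b k})"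
          by (intro sum.cong refl) (simp add: prob_eq_expectation del: power_Suc)
        moreover have "(\<integral>\<omega>. x * (1/2) ^ n + (\<Sum>i<n. x * (1/2) ^ i * of_bool (x * (1/2) ^ Suc i \<le> rprod \<omega> b k)) \<partial>env)
            = (\<integral>\<omega>. x * (1/2) ^ n \<partial>env) + (\<integral>\<omega>. (\<Sum>i<n. x * (1/2) ^ i * of_bool (x * (1/2) ^ Suc i \<le> rprod \<omega> b k)) \<partial>env)"
          by (intro Bochner_Integration.integral_add env.integrable_const Bochner_Integration.integrable_sum int_bool)
        moreover have "(\<integral>\<omega>. x * (1/2) ^ n \<partial>env) = x * (1/2) ^ n"
          using env.prob_space by simp
        ultimately show ?thesis by presburger
      qed
      finally show ?thesis .
    qed
    then have "(\<Sum>k<K. \<integral>\<omega>. min (rprod \<omega> b k) x \<partial>env)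
        \<le> (\<Sum>k<K. x * (1/2) ^ n + (\<Sum>i<n. x * (1/2) ^ i * env.prob {\<omega>. x * (1/2) ^ Suc i \<le> rprod \<omega> b k}))"
      by (intro sum_mono)
    also have "\<dots> = (real K * x) * (1/2) ^ n + (\<Sum>i<n. x * (1/2) ^ i * (\<Sum>k<K. env.prob {\<omega>. x * (1/2) ^ Suc i \<le> rprod \<omega> b k}))"
      unfolding sum.distrib sum_distrib_left by (subst sum.swap) simp
    also have "(\<Sum>i<n. x * (1/2) ^ i * (\<Sum>k<K. env.prob {\<omega>. x * (1/2) ^ Suc i \<le> rprod \<omega> b k}))
        \<le> (\<Sum>i<n. x * (1/2) ^ i * (D * (x * (1/2) ^ Suc i) powr - \<kappa>))"
      unfolding D_def using assms by (intro sum_mono mult_left_mono sum_prob_rprod_ge) auto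
    also have "\<dots> = (\<Sum>i<n. D * 2 powr \<kappa> * x powr (1 - \<kappa>) * q ^ i)"
    proof (intro sum.cong refl)
      fix i
      have e: "(1/2) ^ i = (2::real) powr - real i" for i
        by (simp add: powr_minus powr_realpow power_one_over inverse_eq_divide)
      have "(x * (1/2) ^ Suc i) powr - \<kappa> = x powr - \<kappa> * 2 powr (real (Suc i) * \<kappa>)"
      proof -
        have "(2 powr - real (Suc i)) powr - \<kappa> = (2::real) powr (real (Suc i) * \<kappa>)"
          by (simp only: powr_powr minus_mult_minus)
        then show ?thesis unfolding e using assms by (subst powr_mult) (auto simp del: of_nat_Suc)
      qed
      moreover have "x * (1/2) ^ i = x powr 1 * 2 powr - real i"
        unfolding e using assms by simp
      ultimately have "x * (1/2) ^ i * (D * (x * (1/2) ^ Suc i) powr - \<kappa>)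
          = D * (x powr 1 * x powr - \<kappa>) * (2 powr - real i * 2 powr (real (Suc i) * \<kappa>))"
        by (simp only: ac_simps)
      also have "\<dots> = D * x powr (1 - \<kappa>) * 2 powr (\<kappa> + real i * (\<kappa> - 1))"
        by (simp only: powr_add[symmetric]) (simp add: algebra_simps)
      also have "\<dots> = D * 2 powr \<kappa> * x powr (1 - \<kappa>) * q ^ i"
        by (simp add: powr_add q_def powr_power mult.commute)
      finally show "x * (1/2) ^ i * (D * (x * (1/2) ^ Suc i) powr - \<kappa>) = D * 2 powr \<kappa> * x powr (1 - \<kappa>) * q ^ i" .
    qed
    also have "\<dots> = D * 2 powr \<kappa> * x powr (1 - \<kappa>) * (\<Sum>i<n. q ^ i)"
      by (simp add: sum_distrib_left)
    also have "\<dots> \<le> D * 2 powr \<kappa> * x powr (1 - \<kappa>) * (1 / (1 - q))"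
      using D q by (intro mult_left_mono geometric_partial_sum_le) auto
    also have "\<dots> = C_trunc * x powr (1 - \<kappa>)" by (simp add: C_trunc_def D_def q_def)
    finally show ?thesis by simp
  qed
  \<comment> \<open>The remainder carries the factor \<open>K\<close> but vanishes as the number
    \<open>n\<close> of dyadic levels grows; this is why the bound is free of
    \<open>K\<close>.\<close>
  have "(\<lambda>n. (real K * x) * (1/2) ^ n + C_trunc * x powr (1 - \<kappa>)) \<longlonglongrightarrow> (real K * x) * 0 + C_trunc * x powr (1 - \<kappa>)"
    by (intro tendsto_intros LIMSEQ_power_zero) auto
  then show ?thesis
    by (intro LIMSEQ_le_const[where X = "\<lambda>n. (real K * x) * (1/2) ^ n + C_trunc * x powr (1 - \<kappa>)"])
       (auto intro: key)
qed


section \<open>Right barriers: probability from above, from below, and for pairs of sites\<close>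

text \<open>Recording the barrier as a first passage makes the events over \<open>j\<close> disjoint.\<close>
definition trap_right :: "nat \<Rightarrow> real \<Rightarrow> real \<Rightarrow> int \<Rightarrow> (int \<Rightarrow> real) \<Rightarrow> bool" where
  "trap_right L T C b \<omega> \<longleftrightarrow>
     (\<exists>j\<in>{..L}. passage T b j \<omega> \<and> (\<Sum>z\<in>{1..j}. 1 / rprod \<omega> b z) \<le> C)"

lemma measurable_trap_right [measurable]: "Measurable.pred env (trap_right L T C b)"
  unfolding trap_right_def by measurable

lemma dep_shape: "{b + 1..b + int j} \<subseteq> I \<Longrightarrow> dep I (\<lambda>\<omega>. (\<Sum>z\<in>{1..j}. 1 / rprod \<omega> b z) \<le> C)"
  by (intro dep_comp[of _ _ "\<lambda>y. y \<le> C"] dep_sum dep_comp[of _ _ "\<lambda>y. 1 / y"] dep_rprod) auto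

lemma dep_trap_right: "{b + 1..b + int L} \<subseteq> I \<Longrightarrow> dep I (trap_right L T C b)"
  unfolding trap_right_def
  by (intro dep_comp2[where g = "(\<and>)"] dep_bex dep_passage dep_shape) auto

lemma prob_trap_right_le:
  assumes "0 < T"
  shows "env.prob {\<omega>. trap_right L T C b \<omega>} \<le> T powr - \<kappa>"
proof -
  have "env.prob {\<omega>. trap_right L T C b \<omega>} \<le> env.prob {\<omega>. \<exists>j\<in>{..L}. passage T b j \<omega>}"
    by (rule prob_mono_pred) (auto simp: trap_right_def)
  also have "\<dots> \<le> (\<Sum>j\<in>{..L}. env.prob {\<omega>. passage T b j \<omega>})"
    by (rule prob_bex_le) auto
  finally show ?thesis using sum_prob_passage_le[OF assms, of b L] by simp
qed

text \<open>An exponential change of measure: weighting by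
  \<open>rprod \<omega> b L powr \<kappa>\<close>, of mean 1, makes high barriers typical. The
  weight of environments that end below \<open>T\<close>, and of those with too much mass on the
  slope, is at most 1/4 each. The remaining weight 1/2 lies on the events \<open>E j\<close>, where
  the product at the passage is at most \<open>h * T\<close>, so unweighting costs a factor of at
  most \<open>(h * T) powr \<kappa>\<close>.\<close>

lemma prob_trap_right_ge:
  assumes T: "1 < T" and C: "0 < C" "C powr - (\<kappa> - s) / (1 - r) \<le> 1 / 4"
    and L: "T powr (\<kappa> - s) * r ^ L \<le> 1 / 4"
  shows "1 / 2 * (h * T) powr - \<kappa> \<le> env.prob {\<omega>. trap_right L T C b \<omega>}"
proof -
  define d where "d = \<kappa> - s"
  have d: "0 < d" "d \<le> 1" using s_less s_pos kappa_less_1 by (auto simp: d_def)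
  define E where "E j \<omega> \<longleftrightarrow> passage T b j \<omega> \<and> (\<Sum>z\<in>{1..j}. 1 / rprod \<omega> b z) \<le> C" for j \<omega>
  have [measurable]: "Measurable.pred env (E j)" for j unfolding E_def by measurable
  let ?f1 = "\<lambda>\<omega>. T powr d * rprod \<omega> b L powr s"
  \<comment> \<open>Excess mass is penalised with the power \<open>d = \<kappa> - s\<close>.
    Multiplied by the weight, \<open>(1 / rprod \<omega> b z) powr d\<close> leaves moment
    \<open>s\<close> up to \<open>z\<close> and moment \<open>\<kappa>\<close> beyond, with
    expectation \<open>r ^ z\<close>.\<close>
  let ?g = "\<lambda>z \<omega>. C powr - d * (rprod \<omega> b z powr s * rprod \<omega> (b + int z) (L - z) powr \<kappa>)"
  let ?f3 = "\<lambda>j \<omega>. of_bool (E j \<omega>) * rprod \<omega> b L powr \<kappa>"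
  have ig: "integrable env (?g z)" for z
    by (intro integrable_mult_right integrable_mult_rprod_powr[OF _ abs_rprod_powr_le]) measurable
  have if3: "integrable env (?f3 j)" for j
    by (rule integrable_mult_rprod_powr[where B = 1]) auto
  have pointwise: "rprod \<omega> b L powr \<kappa> \<le> ?f1 \<omega> + (\<Sum>z\<in>{1..L}. ?g z \<omega>) + (\<Sum>j\<le>L. ?f3 j \<omega>)" for \<omega>
  proof -
    have nn: "0 \<le> ?f1 \<omega>" "0 \<le> (\<Sum>z\<in>{1..L}. ?g z \<omega>)" "0 \<le> (\<Sum>j\<le>L. ?f3 j \<omega>)"
      by (auto intro!: sum_nonneg)
    consider "rprod \<omega> b L < T" | "C < (\<Sum>z\<in>{1..L}. 1 / rprod \<omega> b z)"
      | "T \<le> rprod \<omega> b L" "(\<Sum>z\<in>{1..L}. 1 / rprod \<omega> b z) \<le> C" by linarith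
    then show ?thesis
    proof cases
      case 1
      have "rprod \<omega> b L powr \<kappa> = rprod \<omega> b L powr d * rprod \<omega> b L powr s"
        by (simp add: powr_add[symmetric] d_def)
      also have "\<dots> \<le> ?f1 \<omega>"
        using 1 d by (intro mult_right_mono powr_mono2) (auto simp: rprod_nonneg)
      finally show ?thesis using nn by linarith
    next
      case 2
      have "1 = C powr - d * C powr d" using C by (simp add: powr_minus)
      also have "\<dots> \<le> C powr - d * (\<Sum>z\<in>{1..L}. 1 / rprod \<omega> b z) powr d"
        using 2 C d by (intro mult_left_mono powr_mono2) auto
      also have "\<dots> \<le> C powr - d * (\<Sum>z\<in>{1..L}. (1 / rprod \<omega> b z) powr d)"
        using d by (intro mult_left_mono sum_powr_le) (auto simp: rprod_nonneg)
      finally have "1 * rprod \<omega> b L powr \<kappa> \<le> (C powr - d * (\<Sum>z\<in>{1..L}. (1 / rprod \<omega> b z) powr d)) * rprod \<omega> b L powr \<kappa>"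
        by (intro mult_right_mono) auto
      also have "\<dots> = (\<Sum>z\<in>{1..L}. ?g z \<omega>)"
        unfolding sum_distrib_left sum_distrib_right
      proof (intro sum.cong refl)
        fix z assume z: "z \<in> {1..L}"
        then have "rprod \<omega> b L powr \<kappa> = rprod \<omega> b z powr \<kappa> * rprod \<omega> (b + int z) (L - z) powr \<kappa>"
          by (subst rprod_split[of z]) (auto simp: powr_mult rprod_nonneg)
        moreover have "(1 / rprod \<omega> b z) powr d * rprod \<omega> b z powr \<kappa> = rprod \<omega> b z powr s"
        proof -
          have "(1 / rprod \<omega> b z) powr d = rprod \<omega> b z powr - d"
            using rprod_pos[of \<omega> b z] by (simp add: powr_divide powr_minus_divide)
          then show ?thesis by (simp add: powr_add[symmetric] d_def)
        qed
        ultimately show "C powr - d * (1 / rprod \<omega> b z) powr d * rprod \<omega> b L powr \<kappa> = ?g z \<omega>"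
          by (simp only: ac_simps) (simp only: mult.assoc[symmetric])
      qed
      finally show ?thesis using nn by linarith
    next
      case 3
      then obtain j where j: "j \<le> L" "passage T b j \<omega>" by (auto elim: passage_exists)
      have "(\<Sum>z\<in>{1..j}. 1 / rprod \<omega> b z) \<le> (\<Sum>z\<in>{1..L}. 1 / rprod \<omega> b z)"
        using j by (intro sum_mono2) (auto simp: rprod_nonneg)
      then have "E j \<omega>" using j 3 by (simp add: E_def)
      then have "rprod \<omega> b L powr \<kappa> = ?f3 j \<omega>" by simp
      also have "\<dots> \<le> (\<Sum>j\<le>L. ?f3 j \<omega>)"
        using j(1) by (intro member_le_sum) auto
      finally show ?thesis using nn by linarith
    qed
  qed
  have e1: "(\<integral>\<omega>. ?f1 \<omega> \<partial>env) \<le> 1 / 4"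
    using L by (simp add: moment_rprod_s d_def)
  have e2: "(\<integral>\<omega>. (\<Sum>z\<in>{1..L}. ?g z \<omega>) \<partial>env) \<le> 1 / 4"
  proof -
    have "(\<integral>\<omega>. ?g z \<omega> \<partial>env) = C powr - d * r ^ z" for z
    proof -
      have "(\<integral>\<omega>. rprod \<omega> b z powr s * rprod \<omega> (b + int z) (L - z) powr \<kappa> \<partial>env)
          = (\<integral>\<omega>. rprod \<omega> b z powr s \<partial>env) * (\<integral>u. rh u powr \<kappa> \<partial>\<nu>) ^ (L - z)"
        by (rule expectation_mult_rprod_powr[OF _ abs_rprod_powr_le])
           (auto intro!: dep_comp[of _ _ "\<lambda>y. y powr s"] dep_rprod)
      then show ?thesis by (simp add: moment_rprod_s moment_kappa)
    qed
    then have "(\<integral>\<omega>. (\<Sum>z\<in>{1..L}. ?g z \<omega>) \<partial>env) = (\<Sum>z\<in>{1..L}. C powr - d * r ^ z)"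
      by (subst Bochner_Integration.integral_sum) (auto simp only: ig)
    also have "\<dots> \<le> C powr - d * (1 / (1 - r))"
      unfolding sum_distrib_left[symmetric]
      using r_nonneg r_less_1 by (intro mult_left_mono geometric_partial_sum_le) auto
    also have "\<dots> \<le> 1 / 4" using C(2) by (simp add: d_def)
    finally show ?thesis .
  qed
  have e3: "(\<integral>\<omega>. ?f3 j \<omega> \<partial>env) \<le> (h * T) powr \<kappa> * (\<integral>\<omega>. of_bool (E j \<omega>) \<partial>env)" if "j \<le> L" for j
  proof -
    have "(\<integral>\<omega>. ?f3 j \<omega> \<partial>env) = (\<integral>\<omega>. (of_bool (E j \<omega>) * rprod \<omega> b j powr \<kappa>) * rprod \<omega> (b + int j) (L - j) powr \<kappa> \<partial>env)"
      using rprod_split[OF that, of _ b] by (simp add: powr_mult rprod_nonneg mult.assoc)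
    also have "\<dots> = (\<integral>\<omega>. of_bool (E j \<omega>) * rprod \<omega> b j powr \<kappa> \<partial>env)"
    proof -
      have "\<bar>of_bool (E j \<omega>) * rprod \<omega> b j powr \<kappa>\<bar> \<le> (h ^ j) powr \<bar>\<kappa>\<bar>" for \<omega>
        using abs_rprod_powr_le[of \<omega> b j \<kappa>] by auto
      moreover have "dep {..b + int j} (\<lambda>\<omega>. of_bool (E j \<omega>) * rprod \<omega> b j powr \<kappa>)"
        unfolding E_def
        by (intro dep_comp2[where g = "(*)"] dep_comp2[where g = "(\<and>)"] dep_comp[of _ _ of_bool]
            dep_comp[of _ _ "\<lambda>y. y powr \<kappa>"] dep_passage dep_rprod dep_shape) auto
      ultimately show ?thesis
        by (subst expectation_mult_rprod_powr[where B = "(h ^ j) powr \<bar>\<kappa>\<bar>"]) (auto simp: moment_kappa)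
    qed
    also have "\<dots> \<le> (\<integral>\<omega>. (h * T) powr \<kappa> * of_bool (E j \<omega>) \<partial>env)"
    proof (intro integral_mono integrable_mult_rprod_powr[where B = 1] integrable_mult_right integrable_of_bool)
      fix \<omega>
      have "rprod \<omega> b j powr \<kappa> \<le> (h * T) powr \<kappa>" if "E j \<omega>"
        using that passage_overshoot[OF _ T] kappa_pos
        by (intro powr_mono2) (auto simp: E_def rprod_nonneg)
      then show "of_bool (E j \<omega>) * rprod \<omega> b j powr \<kappa> \<le> (h * T) powr \<kappa> * of_bool (E j \<omega>)" by auto
    qed auto
    finally show ?thesis by simp
  qed
  have "1 = (\<integral>\<omega>. rprod \<omega> b L powr \<kappa> \<partial>env)" by (simp add: moment_rprod_kappa)
  also have "\<dots> \<le> (\<integral>\<omega>. ?f1 \<omega> + (\<Sum>z\<in>{1..L}. ?g z \<omega>) + (\<Sum>j\<le>L. ?f3 j \<omega>) \<partial>env)"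
    by (intro integral_mono pointwise Bochner_Integration.integrable_add Bochner_Integration.integrable_sum
        ig if3 integrable_mult_right integrable_rprod_powr)
  also have "\<dots> = (\<integral>\<omega>. ?f1 \<omega> \<partial>env) + (\<integral>\<omega>. (\<Sum>z\<in>{1..L}. ?g z \<omega>) \<partial>env) + (\<Sum>j\<le>L. \<integral>\<omega>. ?f3 j \<omega> \<partial>env)"
  proof -
    have "(\<integral>\<omega>. (\<Sum>j\<le>L. ?f3 j \<omega>) \<partial>env) = (\<Sum>j\<le>L. \<integral>\<omega>. ?f3 j \<omega> \<partial>env)"
      by (intro Bochner_Integration.integral_sum if3)
    moreover have "integrable env (\<lambda>\<omega>. (\<Sum>z\<in>{1..L}. ?g z \<omega>))" "integrable env (\<lambda>\<omega>. (\<Sum>j\<le>L. ?f3 j \<omega>))"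
        "integrable env ?f1"
      by (intro Bochner_Integration.integrable_sum ig if3 integrable_mult_right integrable_rprod_powr)+
    ultimately show ?thesis
      using Bochner_Integration.integral_add[OF Bochner_Integration.integrable_add, of env ?f1 "\<lambda>\<omega>. (\<Sum>z\<in>{1..L}. ?g z \<omega>)" "\<lambda>\<omega>. (\<Sum>j\<le>L. ?f3 j \<omega>)"]
        Bochner_Integration.integral_add[of env ?f1 "\<lambda>\<omega>. (\<Sum>z\<in>{1..L}. ?g z \<omega>)"]
      by presburger
  qed
  also have "\<dots> \<le> 1 / 4 + 1 / 4 + (\<Sum>j\<le>L. (h * T) powr \<kappa> * (\<integral>\<omega>. of_bool (E j \<omega>) \<partial>env))"
    by (intro add_mono e1 e2 sum_mono e3) auto
  also have "(\<Sum>j\<le>L. (h * T) powr \<kappa> * (\<integral>\<omega>. of_bool (E j \<omega>) \<partial>env))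
      = (h * T) powr \<kappa> * (\<integral>\<omega>. (\<Sum>j\<le>L. of_bool (E j \<omega>)) \<partial>env)"
    unfolding sum_distrib_left[symmetric]
    by (subst Bochner_Integration.integral_sum) (auto intro!: integrable_of_bool)
  also have "(\<integral>\<omega>. (\<Sum>j\<le>L. of_bool (E j \<omega>) :: real) \<partial>env) \<le> (\<integral>\<omega>. of_bool (trap_right L T C b \<omega>) \<partial>env)"
  proof (intro integral_mono Bochner_Integration.integrable_sum integrable_of_bool)
    fix \<omega>
    show "(\<Sum>j\<le>L. of_bool (E j \<omega>)) \<le> (of_bool (trap_right L T C b \<omega>) :: real)"
    proof (cases "trap_right L T C b \<omega>")
      case True
      have "(\<Sum>j\<le>L. of_bool (E j \<omega>)) \<le> (\<Sum>j\<le>L. of_bool (passage T b j \<omega>) :: real)"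
        by (intro sum_mono) (auto simp: E_def)
      also have "\<dots> \<le> 1" by (intro sum_passage_le_1) auto
      finally show ?thesis using True by simp
    next
      case False
      then have "(\<Sum>j\<le>L. of_bool (E j \<omega>)) = (0::real)"
        by (intro sum.neutral) (auto simp: E_def trap_right_def)
      then show ?thesis using False by simp
    qed
  qed auto
  also have "(\<integral>\<omega>. of_bool (trap_right L T C b \<omega>) \<partial>env) = env.prob {\<omega>. trap_right L T C b \<omega>}"
    by (simp add: prob_eq_expectation)
  finally have "1 / 2 \<le> (h * T) powr \<kappa> * env.prob {\<omega>. trap_right L T C b \<omega>}"
    by (simp add: mult_left_mono)
  then show ?thesis using h_pos T by (simp add: powr_minus field_simps)
qed

text \<open>If the first barrier is not completed within \<open>k\<close> sites, its mass bound
  forces \<open>rprod \<omega> b k\<close> to be at least \<open>1 / C\<close>. Both alternatives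
  are decided by the sites up to \<open>b + int k\<close>, hence independent of the second
  barrier.\<close>

lemma prob_trap_right_pair_le:
  assumes T: "0 < T" and C: "0 < C" and "1 \<le> k"
  shows "env.prob {\<omega>. trap_right L T C b \<omega> \<and> trap_right L T C (b + int k) \<omega>}
    \<le> (T powr - \<kappa> + C powr s * r ^ k) * T powr - \<kappa>"
proof -
  define E where "E \<omega> \<longleftrightarrow> (\<exists>j\<in>{..k}. passage T b j \<omega>) \<or> 1 / C \<le> rprod \<omega> b k" for \<omega>
  have [measurable]: "Measurable.pred env E" unfolding E_def by measurable
  have "env.prob {\<omega>. trap_right L T C b \<omega> \<and> trap_right L T C (b + int k) \<omega>}
      \<le> env.prob {\<omega>. E \<omega> \<and> trap_right L T C (b + int k) \<omega>}"
  proof (rule prob_mono_pred)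
    fix \<omega> assume asm: "trap_right L T C b \<omega> \<and> trap_right L T C (b + int k) \<omega>"
    then obtain j where j: "j \<le> L" "passage T b j \<omega>" "(\<Sum>z\<in>{1..j}. 1 / rprod \<omega> b z) \<le> C"
      by (auto simp: trap_right_def)
    have "1 / C \<le> rprod \<omega> b k" if "k < j"
    proof -
      have "1 / rprod \<omega> b k \<le> (\<Sum>z\<in>{1..j}. 1 / rprod \<omega> b z)"
        using that assms(3) by (intro member_le_sum) (auto simp: rprod_nonneg)
      then have "1 / rprod \<omega> b k \<le> C" using j by simp
      then show ?thesis using rprod_pos[of \<omega> b k] C by (simp add: field_simps)
    qed
    then show "E \<omega> \<and> trap_right L T C (b + int k) \<omega>"
      using asm j by (cases "k < j") (auto simp: E_def)
  qed measurable
  also have "\<dots> = env.prob {\<omega>. E \<omega>} * env.prob {\<omega>. trap_right L T C (b + int k) \<omega>}"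
  proof (rule prob_conj_eq_mult)
    show "dep {b + 1..b + int k} E"
      unfolding E_def
      by (intro dep_comp2[where g = "(\<or>)"] dep_bex dep_passage dep_comp[of _ _ "\<lambda>y. 1 / C \<le> y"] dep_rprod) auto
    show "dep {b + int k + 1..b + int k + int L} (trap_right L T C (b + int k))"
      by (rule dep_trap_right) auto
  qed auto
  also have "\<dots> \<le> (T powr - \<kappa> + C powr s * r ^ k) * T powr - \<kappa>"
  proof (intro mult_mono prob_trap_right_le T)
    have "env.prob {\<omega>. E \<omega>} \<le> env.prob {\<omega>. \<exists>j\<in>{..k}. passage T b j \<omega>} + env.prob {\<omega>. 1 / C \<le> rprod \<omega> b k}"
      unfolding E_def by (rule prob_disj_le) measurable
    also have "env.prob {\<omega>. \<exists>j\<in>{..k}. passage T b j \<omega>} \<le> (\<Sum>j\<in>{..k}. env.prob {\<omega>. passage T b j \<omega>})"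
      by (rule prob_bex_le) auto
    also have "\<dots> \<le> T powr - \<kappa>" using sum_prob_passage_le[OF T, of b k] by simp
    also have "env.prob {\<omega>. 1 / C \<le> rprod \<omega> b k} \<le> (1 / C) powr - s * r ^ k"
      using C by (intro prob_rprod_ge) auto
    also have "(1 / C) powr - s = C powr s" using C by (simp add: powr_divide powr_minus_divide)
    finally show "env.prob {\<omega>. E \<omega>} \<le> T powr - \<kappa> + C powr s * r ^ k" by simp
  qed (use r_nonneg in auto)
  finally show ?thesis .
qed


text \<open>Started from the value \<open>\<beta>\<close> at site \<open>m\<close>, this is the chain \<open>W i = 1 + rh (\<omega> i) * W (i - 1)\<close>
  at site \<open>m + k\<close>; its sum over a stretch of sites bounds the expected crossing time.\<close>
definition wchain :: "(int \<Rightarrow> real) \<Rightarrow> int \<Rightarrow> real \<Rightarrow> nat \<Rightarrow> real" where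
  "wchain \<omega> m \<beta> k = (\<Sum>j\<in>{1..k}. rprod \<omega> (m + int j) (k - j)) + \<beta> * rprod \<omega> m k"

lemma wchain_0 [simp]: "wchain \<omega> m \<beta> 0 = \<beta>"
  by (simp add: wchain_def)

lemma wchain_Suc: "wchain \<omega> m \<beta> (Suc k) = 1 + rh (\<omega> (m + int k + 1)) * wchain \<omega> m \<beta> k"
proof -
  have "rprod \<omega> (m + int j) (Suc k - j) = rprod \<omega> (m + int j) (k - j) * rh (\<omega> (m + int k + 1))"
    if "j \<in> {1..k}" for j
    using that by (simp add: Suc_diff_le rprod_Suc of_nat_diff)
  then have "(\<Sum>j\<in>{1..k}. rprod \<omega> (m + int j) (Suc k - j))
      = (\<Sum>j\<in>{1..k}. rprod \<omega> (m + int j) (k - j)) * rh (\<omega> (m + int k + 1))"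
    by (simp add: sum_distrib_right)
  then show ?thesis by (simp add: wchain_def rprod_Suc algebra_simps)
qed

lemma measurable_wchain [measurable]: "(\<lambda>\<omega>. wchain \<omega> m \<beta> k) \<in> borel_measurable env"
  unfolding wchain_def by measurable

lemma dep_wchain:
  assumes "{m + 1..m + int k} \<subseteq> I"
  shows "dep I (\<lambda>\<omega>. wchain \<omega> m \<beta> k)"
  unfolding wchain_def
proof (intro dep_comp2[where g = "(+)"] dep_sum dep_comp[of _ _ "\<lambda>y. \<beta> * y"] dep_rprod assms)
  fix j assume "j \<in> {1..k}"
  then have "{m + int j + 1..m + int j + int (k - j)} \<subseteq> {m + 1..m + int k}" by auto
  then show "{m + int j + 1..m + int j + int (k - j)} \<subseteq> I" using assms by blast
qed

text \<open>By subadditivity of \<open>powr s\<close> the chain has an \<open>s\<close>-th moment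
  bounded uniformly in \<open>k\<close>, apart from the contribution of \<open>\<beta>\<close>,
  which decays like \<open>r ^ k\<close>.\<close>

lemma prob_wchain_gt:
  assumes "0 < C" "0 \<le> \<beta>"
  shows "env.prob {\<omega>. C < wchain \<omega> m \<beta> k} \<le> C powr - s * (1 / (1 - r) + \<beta> powr s * r ^ k)"
proof -
  let ?f = "\<lambda>\<omega>. C powr - s * ((\<Sum>j\<in>{1..k}. rprod \<omega> (m + int j) (k - j) powr s) + \<beta> powr s * rprod \<omega> m k powr s)"
  have int: "integrable env (\<lambda>\<omega>. \<Sum>j\<in>{1..k}. rprod \<omega> (m + int j) (k - j) powr s)"
    by (intro Bochner_Integration.integrable_sum integrable_rprod_powr)
  have "env.prob {\<omega>. C < wchain \<omega> m \<beta> k} \<le> (\<integral>\<omega>. ?f \<omega> \<partial>env)"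
  proof (rule prob_le_expectation)
    show "integrable env ?f"
      by (intro integrable_mult_right Bochner_Integration.integrable_add int integrable_rprod_powr)
    fix \<omega> assume "C < wchain \<omega> m \<beta> k"
    have "1 = C powr - s * C powr s" using assms by (simp add: powr_minus)
    also have "\<dots> \<le> C powr - s * wchain \<omega> m \<beta> k powr s"
      using \<open>C < _\<close> assms s_pos by (intro mult_left_mono powr_mono2) auto
    also have "wchain \<omega> m \<beta> k powr s \<le> (\<Sum>j\<in>{1..k}. rprod \<omega> (m + int j) (k - j)) powr s + (\<beta> * rprod \<omega> m k) powr s"
      unfolding wchain_def using assms s_pos s_less_1
      by (intro powr_add_le) (auto intro!: sum_nonneg simp: rprod_nonneg)
    also have "(\<Sum>j\<in>{1..k}. rprod \<omega> (m + int j) (k - j)) powr s \<le> (\<Sum>j\<in>{1..k}. rprod \<omega> (m + int j) (k - j) powr s)"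
      using s_pos s_less_1 by (intro sum_powr_le) (auto simp: rprod_nonneg)
    also have "(\<beta> * rprod \<omega> m k) powr s = \<beta> powr s * rprod \<omega> m k powr s"
      using assms by (simp add: powr_mult rprod_nonneg)
    finally show "1 \<le> ?f \<omega>" by (simp add: mult_left_mono)
  qed (auto intro!: mult_nonneg_nonneg add_nonneg_nonneg sum_nonneg)
  also have "\<dots> = C powr - s * ((\<Sum>j\<in>{1..k}. r ^ (k - j)) + \<beta> powr s * r ^ k)"
    using int integrable_rprod_powr
    by (simp add: moment_rprod_s Bochner_Integration.integral_sum)
  also have "(\<Sum>j\<in>{1..k}. r ^ (k - j)) = (\<Sum>l\<in>(\<lambda>j. k - j) ` {1..k}. r ^ l)"
    by (subst sum.reindex) (auto simp: inj_on_def)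
  also have "\<dots> \<le> 1 / (1 - r)"
    using r_nonneg r_less_1 by (intro geometric_partial_sum_le) auto
  finally show ?thesis by (simp add: mult_left_mono)
qed

text \<open>Truncating each term at \<open>x\<close> preserves the event, because a single term
  above \<open>x\<close> still contributes \<open>x\<close>. Markov's inequality can then be applied
  to the truncated sum.\<close>

lemma prob_sum_rprod_ge:
  assumes x: "0 < x"
  shows "env.prob {\<omega>. x \<le> (\<Sum>j\<in>{1..k}. \<Sum>l<k. rprod \<omega> (m + int j) l)} \<le> real k * C_trunc * x powr - \<kappa>"
proof -
  let ?f = "\<lambda>\<omega>. (\<Sum>j\<in>{1..k}. \<Sum>l<k. min (rprod \<omega> (m + int j) l) x) / x"
  have int: "integrable env (\<lambda>\<omega>. min (rprod \<omega> b l) x)" for b l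
    by (rule integrable_bounded[where B = x]) (use x rprod_nonneg in auto)
  have "env.prob {\<omega>. x \<le> (\<Sum>j\<in>{1..k}. \<Sum>l<k. rprod \<omega> (m + int j) l)} \<le> (\<integral>\<omega>. ?f \<omega> \<partial>env)"
  proof (rule prob_le_expectation)
    show "integrable env ?f"
      by (intro integrable_divide Bochner_Integration.integrable_sum int)
    show "0 \<le> ?f \<omega>" for \<omega>
      using x by (auto intro!: divide_nonneg_pos sum_nonneg simp: rprod_nonneg)
    fix \<omega> assume big: "x \<le> (\<Sum>j\<in>{1..k}. \<Sum>l<k. rprod \<omega> (m + int j) l)"
    have "x \<le> (\<Sum>j\<in>{1..k}. \<Sum>l<k. min (rprod \<omega> (m + int j) l) x)"
    proof (cases "\<exists>j\<in>{1..k}. \<exists>l\<in>{..<k}. x \<le> rprod \<omega> (m + int j) l")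
      case True
      then obtain j l where jl: "j \<in> {1..k}" "l \<in> {..<k}" "x \<le> rprod \<omega> (m + int j) l" by auto
      have "x = min (rprod \<omega> (m + int j) l) x" using jl by simp
      also have "\<dots> \<le> (\<Sum>l<k. min (rprod \<omega> (m + int j) l) x)"
        using jl x by (intro member_le_sum[where f = "\<lambda>l. min (rprod \<omega> (m + int j) l) x"]) (auto simp: rprod_nonneg)
      also have "\<dots> \<le> (\<Sum>j\<in>{1..k}. \<Sum>l<k. min (rprod \<omega> (m + int j) l) x)"
        using jl x by (intro member_le_sum[where f = "\<lambda>j. \<Sum>l<k. min (rprod \<omega> (m + int j) l) x"])
          (auto intro!: sum_nonneg simp: rprod_nonneg)
      finally show ?thesis .
    next
      case False
      then have "(\<Sum>j\<in>{1..k}. \<Sum>l<k. min (rprod \<omega> (m + int j) l) x) = (\<Sum>j\<in>{1..k}. \<Sum>l<k. rprod \<omega> (m + int j) l)"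
        by (intro sum.cong refl) (auto simp: not_le)
      then show ?thesis using big by simp
    qed
    then show "1 \<le> ?f \<omega>" using x by simp
  qed measurable
  also have "\<dots> = (\<Sum>j\<in>{1..k}. \<Sum>l<k. \<integral>\<omega>. min (rprod \<omega> (m + int j) l) x \<partial>env) / x"
  proof -
    have "(\<integral>\<omega>. (\<Sum>j\<in>{1..k}. \<Sum>l<k. min (rprod \<omega> (m + int j) l) x) \<partial>env)
        = (\<Sum>j\<in>{1..k}. \<integral>\<omega>. (\<Sum>l<k. min (rprod \<omega> (m + int j) l) x) \<partial>env)"
      by (intro Bochner_Integration.integral_sum Bochner_Integration.integrable_sum int)
    also have "\<dots> = (\<Sum>j\<in>{1..k}. \<Sum>l<k. \<integral>\<omega>. min (rprod \<omega> (m + int j) l) x \<partial>env)"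
      by (intro sum.cong refl Bochner_Integration.integral_sum int)
    finally show ?thesis by simp
  qed
  also have "\<dots> \<le> (\<Sum>j\<in>{1..k}. C_trunc * x powr (1 - \<kappa>)) / x"
    using x by (intro divide_right_mono sum_mono sum_truncated_expectation_le) auto
  also have "\<dots> = real k * C_trunc * x powr - \<kappa>"
    using x powr_add[of x 1 "- \<kappa>"] by simp
  finally show ?thesis .
qed

lemma prob_start_ge:
  assumes "0 < x" "0 \<le> \<beta>"
  shows "env.prob {\<omega>. x \<le> \<beta> + \<beta> * (\<Sum>i<k. rprod \<omega> m i)} \<le> x powr - s * (\<beta> powr s * (1 + 1 / (1 - r)))"
proof -
  let ?f = "\<lambda>\<omega>. x powr - s * (\<beta> powr s * (1 + (\<Sum>i<k. rprod \<omega> m i powr s)))"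
  have "env.prob {\<omega>. x \<le> \<beta> + \<beta> * (\<Sum>i<k. rprod \<omega> m i)} \<le> (\<integral>\<omega>. ?f \<omega> \<partial>env)"
  proof (rule prob_le_expectation)
    show "integrable env ?f"
      by (intro integrable_mult_right Bochner_Integration.integrable_add Bochner_Integration.integrable_sum
          integrable_rprod_powr env.integrable_const)
    fix \<omega> assume le: "x \<le> \<beta> + \<beta> * (\<Sum>i<k. rprod \<omega> m i)"
    have "1 = x powr - s * x powr s" using assms by (simp add: powr_minus)
    also have "\<dots> \<le> x powr - s * (\<beta> * (1 + (\<Sum>i<k. rprod \<omega> m i))) powr s"
      using le assms s_pos by (intro mult_left_mono powr_mono2) (auto simp: algebra_simps)
    also have "(\<beta> * (1 + (\<Sum>i<k. rprod \<omega> m i))) powr s = \<beta> powr s * (1 + (\<Sum>i<k. rprod \<omega> m i)) powr s"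
      using assms by (intro powr_mult)
    also have "(1 + (\<Sum>i<k. rprod \<omega> m i)) powr s \<le> 1 powr s + (\<Sum>i<k. rprod \<omega> m i) powr s"
      using s_pos s_less_1 by (intro powr_add_le) (auto intro!: sum_nonneg simp: rprod_nonneg)
    also have "(\<Sum>i<k. rprod \<omega> m i) powr s \<le> (\<Sum>i<k. rprod \<omega> m i powr s)"
      using s_pos s_less_1 by (intro sum_powr_le) (auto simp: rprod_nonneg)
    finally show "1 \<le> ?f \<omega>" by (simp add: mult_left_mono)
  qed (auto intro!: mult_nonneg_nonneg add_nonneg_nonneg sum_nonneg)
  also have "\<dots> = x powr - s * (\<beta> powr s * (1 + (\<Sum>i<k. r ^ i)))"
  proof -
    have "(\<integral>\<omega>. 1 + (\<Sum>i<k. rprod \<omega> m i powr s) \<partial>env) = (\<integral>\<omega>. 1 \<partial>env) + (\<integral>\<omega>. (\<Sum>i<k. rprod \<omega> m i powr s) \<partial>env)"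
      by (intro Bochner_Integration.integral_add Bochner_Integration.integrable_sum
          integrable_rprod_powr env.integrable_const)
    also have "(\<integral>\<omega>. (\<Sum>i<k. rprod \<omega> m i powr s) \<partial>env) = (\<Sum>i<k. r ^ i)"
      by (subst Bochner_Integration.integral_sum) (auto simp: moment_rprod_s intro!: integrable_rprod_powr)
    finally show ?thesis using env.prob_space by simp
  qed
  also have "\<dots> \<le> x powr - s * (\<beta> powr s * (1 + 1 / (1 - r)))"
    using r_nonneg r_less_1 by (intro mult_left_mono add_left_mono geometric_partial_sum_le) auto
  finally show ?thesis .
qed

text \<open>\<open>\<beta>\<close> occurs twice: as the value of the chain at \<open>m\<close> and
  as a bound for the time spent to the left of \<open>m\<close>. The condition thus involves only
  the sites after \<open>m\<close>.\<close>

definition trap_left :: "int \<Rightarrow> real \<Rightarrow> real \<Rightarrow> real \<Rightarrow> nat \<Rightarrow> (int \<Rightarrow> real) \<Rightarrow> bool" where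
  "trap_left m \<beta> C x k \<omega> \<longleftrightarrow> wchain \<omega> m \<beta> k \<le> C \<and> \<beta> + (\<Sum>i<k. wchain \<omega> m \<beta> i) \<le> x"

lemma measurable_trap_left [measurable]: "Measurable.pred env (trap_left m \<beta> C x k)"
  unfolding trap_left_def by measurable

lemma dep_trap_left: "{m + 1..m + int k} \<subseteq> I \<Longrightarrow> dep I (trap_left m \<beta> C x k)"
  unfolding trap_left_def
proof (intro dep_comp2[where g = "(\<and>)"] dep_comp[of _ _ "\<lambda>y. y \<le> C"] dep_comp[of _ _ "\<lambda>y. \<beta> + y \<le> x"]
    dep_sum dep_wchain)
  fix i assume "{m + 1..m + int k} \<subseteq> I" "i \<in> {..<k}"
  then show "{m + 1..m + int i} \<subseteq> I" by (auto simp: subset_iff)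
qed

lemma prob_trap_left_ge:
  assumes "0 < C" "0 \<le> \<beta>" "0 < x"
  shows "1 - (C powr - s * (1 / (1 - r) + \<beta> powr s * r ^ k)
      + real k * C_trunc * (x / 2) powr - \<kappa>
      + (x / 2) powr - s * (\<beta> powr s * (1 + 1 / (1 - r)))) \<le> env.prob {\<omega>. trap_left m \<beta> C x k \<omega>}"
proof -
  \<comment> \<open>\<open>A\<close> is a failure at the end of the stretch. The time budget
    \<open>x\<close> is halved: \<open>B\<close> charges the excursions created inside the stretch,
    \<open>D\<close> those due to \<open>\<beta>\<close>.\<close>
  define A where "A \<omega> \<longleftrightarrow> C < wchain \<omega> m \<beta> k" for \<omega>
  define B where "B \<omega> \<longleftrightarrow> x / 2 \<le> (\<Sum>j\<in>{1..k}. \<Sum>l<k. rprod \<omega> (m + int j) l)" for \<omega>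
  define D where "D \<omega> \<longleftrightarrow> x / 2 \<le> \<beta> + \<beta> * (\<Sum>i<k. rprod \<omega> m i)" for \<omega>
  have [measurable]: "Measurable.pred env A" "Measurable.pred env B" "Measurable.pred env D"
    unfolding A_def B_def D_def by measurable
  have bad: "A \<omega> \<or> B \<omega> \<or> D \<omega>" if "\<not> trap_left m \<beta> C x k \<omega>" for \<omega>
  proof (rule ccontr)
    assume not: "\<not> (A \<omega> \<or> B \<omega> \<or> D \<omega>)"
    have "(\<Sum>i<k. wchain \<omega> m \<beta> i)
        = (\<Sum>i<k. \<Sum>j\<in>{1..i}. rprod \<omega> (m + int j) (i - j)) + \<beta> * (\<Sum>i<k. rprod \<omega> m i)"
      by (simp add: wchain_def sum.distrib sum_distrib_left)
    also have "(\<Sum>i<k. \<Sum>j\<in>{1..i}. rprod \<omega> (m + int j) (i - j)) \<le> (\<Sum>j\<in>{1..k}. \<Sum>l<k. rprod \<omega> (m + int j) l)"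
      by (rule sum_triangle_le) (rule rprod_nonneg)
    finally have "\<beta> + (\<Sum>i<k. wchain \<omega> m \<beta> i) \<le> x"
      using not by (simp add: B_def D_def)
    then show False using that not by (simp add: trap_left_def A_def)
  qed
  have "1 - env.prob {\<omega>. trap_left m \<beta> C x k \<omega>} = env.prob {\<omega>. \<not> trap_left m \<beta> C x k \<omega>}"
  proof -
    have "{\<omega>. trap_left m \<beta> C x k \<omega>} \<in> env.events"
      using measurable_trap_left[of m \<beta> C x k] by (simp add: pred_def)
    from env.prob_compl[OF this] show ?thesis
      by (simp add: Compl_eq_Diff_UNIV[symmetric] Collect_neg_eq)
  qed
  also have "\<dots> \<le> env.prob {\<omega>. A \<omega> \<or> B \<omega> \<or> D \<omega>}"
    by (rule prob_mono_pred) (auto dest: bad)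
  also have "\<dots> \<le> env.prob {\<omega>. A \<omega>} + env.prob {\<omega>. B \<omega> \<or> D \<omega>}"
    by (rule prob_disj_le) auto
  also have "env.prob {\<omega>. B \<omega> \<or> D \<omega>} \<le> env.prob {\<omega>. B \<omega>} + env.prob {\<omega>. D \<omega>}"
    by (rule prob_disj_le) auto
  also have "env.prob {\<omega>. A \<omega>} \<le> C powr - s * (1 / (1 - r) + \<beta> powr s * r ^ k)"
    unfolding A_def using assms by (intro prob_wchain_gt)
  also have "env.prob {\<omega>. B \<omega>} \<le> real k * C_trunc * (x / 2) powr - \<kappa>"
    unfolding B_def using assms by (intro prob_sum_rprod_ge) auto
  also have "env.prob {\<omega>. D \<omega>} \<le> (x / 2) powr - s * (\<beta> powr s * (1 + 1 / (1 - r)))"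
    unfolding D_def using assms by (intro prob_start_ge) auto
  finally show ?thesis by simp
qed


section \<open>Valleys inside one finite block\<close>

definition trap_block :: "real \<Rightarrow> real \<Rightarrow> real \<Rightarrow> nat \<Rightarrow> int \<Rightarrow> real \<Rightarrow> (int \<Rightarrow> real) \<Rightarrow> bool" where
  "trap_block C \<delta> T N m \<beta> \<omega> \<longleftrightarrow> (\<exists>k\<in>{1..N}. \<exists>j\<in>{1..N}.
     trap_left m \<beta> C (\<delta> * T) k \<omega> \<and> T \<le> rprod \<omega> (m + int k) j
     \<and> (\<Sum>z\<in>{1..j}. 1 / rprod \<omega> (m + int k) z) \<le> C)"

lemma measurable_trap_block [measurable]: "Measurable.pred env (trap_block C \<delta> T N m \<beta>)"
  unfolding trap_block_def by measurable

lemma dep_trap_block: "{m + 1..m + 2 * int N} \<subseteq> I \<Longrightarrow> dep I (trap_block C \<delta> T N m \<beta>)"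
  unfolding trap_block_def
proof (intro dep_bex dep_comp2[where g = "(\<and>)"] dep_trap_left dep_comp[of _ _ "\<lambda>y. T \<le> y"] dep_rprod dep_shape)
  fix k j assume "{m + 1..m + 2 * int N} \<subseteq> I" and kj: "k \<in> {1..N}" "j \<in> {1..N}"
  then have "{m + 1..m + int k} \<subseteq> {m + 1..m + 2 * int N}"
    "{m + int k + 1..m + int k + int j} \<subseteq> {m + 1..m + 2 * int N}" by auto
  then show "{m + 1..m + int k} \<subseteq> I" "{m + int k + 1..m + int k + int j} \<subseteq> I" "{m + int k + 1..m + int k + int j} \<subseteq> I"
    using \<open>{m + 1..m + 2 * int N} \<subseteq> I\<close> by blast+
qed

text \<open>The last grid site with a right barrier is determined by the environment to its right, so it
  is independent of the condition on the environment to its left.\<close>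
lemma prob_last_trap_ge:
  assumes T: "1 < T" and C: "0 < C" "C powr - (\<kappa> - s) / (1 - r) \<le> 1 / 4"
    and L: "T powr (\<kappa> - s) * r ^ L \<le> 1 / 4"
    and J: "1 \<le> J" "C powr s * r ^ J / (1 - r) \<le> h powr - \<kappa> / 16"
    and I: "real I * T powr - \<kappa> \<le> h powr - \<kappa> / 16"
    and left: "1 / 2 \<le> env.prob {\<omega>. trap_left m \<beta> C x (J * i) \<omega>}"
    and i: "I < i" "i \<le> 2 * I"
  shows "T powr - \<kappa> * h powr - \<kappa> / 8 \<le> env.prob {\<omega>. trap_left m \<beta> C x (J * i) \<omega> \<and>
      (trap_right L T C (m + int (J * i)) \<omega> \<and>
        \<not> (\<exists>i'\<in>{i<..2 * I}. trap_right L T C (m + int (J * i')) \<omega>))}"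
proof -
  define b where "b i = m + int (J * i)" for i
  define R where "R i = trap_right L T C (b i)" for i
  have [measurable]: "Measurable.pred env (R i)" for i unfolding R_def by measurable
  have pair: "env.prob {\<omega>. R i \<omega> \<and> R i' \<omega>} \<le> T powr - \<kappa> * (T powr - \<kappa> + C powr s * r ^ J * r ^ (i' - i - 1))"
    if i': "i' \<in> {i<..2 * I}" for i'
  proof -
    define k where "k = J * (i' - i)"
    obtain d where d: "i' = i + 1 + d" using i' less_imp_add_positive[of i i'] by (auto dest: less_imp_Suc_add)
    have k: "b i' = b i + int k" "1 \<le> k" using J(1) by (auto simp: b_def k_def d algebra_simps)
    \<comment> \<open>Here \<open>k = J * (d + 1)\<close>. The split gives a factor
      \<open>r ^ J\<close>, small by the choice of \<open>J\<close>, and a factor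
      \<open>r ^ d\<close>, summable over the later sites.\<close>
    have "J + d \<le> k" using J(1) by (cases J) (auto simp: k_def d)
    then have "r ^ k \<le> r ^ (J + d)" using r_nonneg r_less_1 by (intro power_decreasing) auto
    then have "C powr s * r ^ k \<le> C powr s * r ^ J * r ^ (i' - i - 1)"
      by (simp add: d power_add mult_left_mono mult.assoc)
    then have "(T powr - \<kappa> + C powr s * r ^ k) * T powr - \<kappa>
        \<le> T powr - \<kappa> * (T powr - \<kappa> + C powr s * r ^ J * r ^ (i' - i - 1))"
      by (subst mult.commute) (intro mult_left_mono add_left_mono, auto)
    moreover have "env.prob {\<omega>. R i \<omega> \<and> R i' \<omega>} \<le> (T powr - \<kappa> + C powr s * r ^ k) * T powr - \<kappa>"
      unfolding R_def k(1) using T C k by (intro prob_trap_right_pair_le) auto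
    ultimately show ?thesis by linarith
  qed
  have "(\<Sum>i'\<in>{i<..2 * I}. env.prob {\<omega>. R i \<omega> \<and> R i' \<omega>})
      \<le> (\<Sum>i'\<in>{i<..2 * I}. T powr - \<kappa> * (T powr - \<kappa> + C powr s * r ^ J * r ^ (i' - i - 1)))"
    by (rule sum_mono) (rule pair)
  also have "\<dots> = T powr - \<kappa> * (real (2 * I - i) * T powr - \<kappa> + C powr s * r ^ J * (\<Sum>i'\<in>{i<..2 * I}. r ^ (i' - i - 1)))"
    by (simp add: sum_distrib_left[symmetric] sum.distrib)
  also have "\<dots> \<le> T powr - \<kappa> * (h powr - \<kappa> / 16 + h powr - \<kappa> / 16)"
  proof (intro mult_left_mono add_mono)
    have "real (2 * I - i) * T powr - \<kappa> \<le> real I * T powr - \<kappa>"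
      using i by (intro mult_right_mono) auto
    then show "real (2 * I - i) * T powr - \<kappa> \<le> h powr - \<kappa> / 16" using I by simp
    have "(\<Sum>i'\<in>{i<..2 * I}. r ^ (i' - i - 1)) = (\<Sum>l\<in>(\<lambda>i'. i' - i - 1) ` {i<..2 * I}. r ^ l)"
      by (subst sum.reindex) (auto simp: inj_on_def)
    also have "\<dots> \<le> 1 / (1 - r)"
      using r_nonneg r_less_1 by (intro geometric_partial_sum_le) auto
    finally have "C powr s * r ^ J * (\<Sum>i'\<in>{i<..2 * I}. r ^ (i' - i - 1)) \<le> C powr s * r ^ J * (1 / (1 - r))"
      using r_nonneg by (intro mult_left_mono) auto
    also have "\<dots> = C powr s * r ^ J / (1 - r)" by simp
    also note J(2)
    finally show "C powr s * r ^ J * (\<Sum>i'\<in>{i<..2 * I}. r ^ (i' - i - 1)) \<le> h powr - \<kappa> / 16" .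
  qed auto
  finally have later: "(\<Sum>i'\<in>{i<..2 * I}. env.prob {\<omega>. R i \<omega> \<and> R i' \<omega>}) \<le> T powr - \<kappa> * h powr - \<kappa> / 8"
    by simp
  define Q where "Q \<omega> \<longleftrightarrow> R i \<omega> \<and> \<not> (\<exists>i'\<in>{i<..2 * I}. R i' \<omega>)" for \<omega>
  have [measurable]: "Measurable.pred env Q" unfolding Q_def by measurable
  have "1 / 2 * (h * T) powr - \<kappa> \<le> env.prob {\<omega>. R i \<omega>}"
    unfolding R_def by (intro prob_trap_right_ge T C L)
  also have "\<dots> \<le> env.prob {\<omega>. Q \<omega> \<or> (\<exists>i'\<in>{i<..2 * I}. R i \<omega> \<and> R i' \<omega>)}"
    by (rule prob_mono_pred) (auto simp: Q_def)
  also have "\<dots> \<le> env.prob {\<omega>. Q \<omega>} + env.prob {\<omega>. \<exists>i'\<in>{i<..2 * I}. R i \<omega> \<and> R i' \<omega>}"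
    by (rule prob_disj_le) auto
  also have "env.prob {\<omega>. \<exists>i'\<in>{i<..2 * I}. R i \<omega> \<and> R i' \<omega>} \<le> (\<Sum>i'\<in>{i<..2 * I}. env.prob {\<omega>. R i \<omega> \<and> R i' \<omega>})"
    by (rule prob_bex_le) auto
  also note later
  finally have "1 / 2 * (h * T) powr - \<kappa> \<le> env.prob {\<omega>. Q \<omega>} + T powr - \<kappa> * h powr - \<kappa> / 8"
    by simp
  moreover have "(h * T) powr - \<kappa> = T powr - \<kappa> * h powr - \<kappa>"
    using T h_pos by (simp add: powr_mult)
  moreover have "0 \<le> T powr - \<kappa> * h powr - \<kappa>" by simp
  ultimately have Q: "T powr - \<kappa> * h powr - \<kappa> / 4 \<le> env.prob {\<omega>. Q \<omega>}"
    by linarith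
  have "env.prob {\<omega>. trap_left m \<beta> C x (J * i) \<omega> \<and> Q \<omega>}
      = env.prob {\<omega>. trap_left m \<beta> C x (J * i) \<omega>} * env.prob {\<omega>. Q \<omega>}"
  proof (rule prob_conj_eq_mult[where I = "{m + 1..b i}" and J = "{b i + 1..}"])
    show "dep {m + 1..b i} (trap_left m \<beta> C x (J * i))"
      by (rule dep_trap_left) (simp add: b_def)
    show "dep {b i + 1..} Q"
      unfolding Q_def
    proof (intro dep_comp2[where g = "(\<and>)"] dep_comp[of _ _ Not] dep_bex)
      have "dep {b i + 1..} (R i')" if "i \<le> i'" for i'
      proof -
        have "b i \<le> b i'" using that by (simp add: b_def mult_left_mono)
        then show ?thesis unfolding R_def by (intro dep_trap_right) auto
      qed
      then show "dep {b i + 1..} (R i)" "\<And>x. x \<in> {i<..2 * I} \<Longrightarrow> dep {b i + 1..} (R x)" by auto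
    qed
  qed auto
  moreover have "1 / 2 * (T powr - \<kappa> * h powr - \<kappa> / 4)
      \<le> env.prob {\<omega>. trap_left m \<beta> C x (J * i) \<omega>} * env.prob {\<omega>. Q \<omega>}"
    by (intro mult_mono left Q) auto
  ultimately show ?thesis by (simp add: Q_def R_def b_def)
qed

lemma trap_block_prob_ge:
  assumes "0 < \<delta>"
  obtains C q where "0 < C" "0 < q"
    "\<And>\<beta> t0. 0 \<le> \<beta> \<Longrightarrow> \<exists>t\<ge>t0. \<exists>N. \<forall>m. q \<le> env.prob {\<omega>. trap_block C \<delta> (real t) N m \<beta> \<omega>}"
proof -
  define a where "a = h powr - \<kappa>"
  have a: "0 < a" using h_pos by (simp add: a_def)
  have r1: "0 < 1 - r" using r_less_1 by simp
  \<comment> \<open>The first entry limits the weight of overly massive barriers to 1/4, the second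
    the stationary part of the failure \<open>C < wchain\<close> to 1/16.\<close>
  define C where "C = max (((1 - r) / 4) powr (- 1 / (\<kappa> - s))) (((1 - r) / 16) powr (- 1 / s))"
  have C0: "0 < C" using r1 by (auto simp: C_def less_max_iff_disj)
  have C1: "C powr - (\<kappa> - s) / (1 - r) \<le> 1 / 4"
  proof -
    have "C powr - (\<kappa> - s) \<le> (((1 - r) / 4) powr (- 1 / (\<kappa> - s))) powr - (\<kappa> - s)"
      using r1 s_less by (intro powr_mono2') (auto simp: C_def)
    also have "\<dots> = (1 - r) / 4"
    proof -
      have "(- 1 / (\<kappa> - s)) * - (\<kappa> - s) = 1" using s_less by (simp add: field_simps)
      then show ?thesis using r1 by (simp only: powr_powr) simp
    qed
    finally show ?thesis using r1 by (simp add: field_simps)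
  qed
  have C2: "C powr - s * (1 / (1 - r)) \<le> 1 / 16"
  proof -
    have "C powr - s \<le> (((1 - r) / 16) powr (- 1 / s)) powr - s"
      using r1 s_pos by (intro powr_mono2') (auto simp: C_def)
    also have "\<dots> = (1 - r) / 16" using r1 s_pos by (simp add: powr_powr)
    finally show ?thesis using r1 by (simp add: field_simps)
  qed
  \<comment> \<open>Candidate bottoms are placed \<open>J\<close> sites apart, so that two of them
    rarely share one barrier.\<close>
  obtain J0 where J0: "r ^ J0 < a / 16 * (1 - r) * C powr - s"
    using real_arch_pow_inv[of "a / 16 * (1 - r) * C powr - s" r] a r1 C0 r_less_1 by auto
  define J where "J = Suc J0"
  have J1: "1 \<le> J" by (simp add: J_def)
  have J2: "C powr s * r ^ J / (1 - r) \<le> a / 16"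
  proof -
    have "r ^ J \<le> r ^ J0" using r_nonneg r_less_1 by (intro power_decreasing) (auto simp: J_def)
    then have "C powr s * r ^ J \<le> C powr s * (a / 16 * (1 - r) * C powr - s)"
      using J0 by (intro mult_left_mono) auto
    also have "\<dots> = a / 16 * (1 - r)" using C0 by (simp add: powr_minus)
    finally show ?thesis using r1 by (simp add: field_simps)
  qed
  define D where "D = 2 * real J * C_trunc * (\<delta> / 2) powr - \<kappa>"
  have D: "0 < D" using J1 C_trunc_pos assms by (simp add: D_def)
  \<comment> \<open>The bound \<open>a / 16\<close> limits coincidences of separate barriers, the
    bound \<open>1 / (8 * D)\<close> the probability that the crossing takes longer than
    \<open>\<delta> * T\<close>.\<close>
  define \<eta> where "\<eta> = min (a / 16) (1 / (8 * D))"
  have \<eta>: "0 < \<eta>" "\<eta> \<le> a / 16" "\<eta> * D \<le> 1 / 8"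
    using a D by (auto simp: \<eta>_def min_def field_simps)
  \<comment> \<open>There will be at least \<open>\<eta> * T powr \<kappa> / 2\<close> candidates,
    each succeeding with probability at least \<open>T powr - \<kappa> * a / 8\<close>; the product
    is free of \<open>T\<close>.\<close>
  define q where "q = \<eta> * a / 16"
  have q: "0 < q" using a \<eta> by (simp add: q_def)
  have main: "\<exists>t\<ge>t0. \<exists>N. \<forall>m. q \<le> env.prob {\<omega>. trap_block C \<delta> (real t) N m \<beta> \<omega>}" if \<beta>: "0 \<le> \<beta>" for \<beta> t0
  proof -
    \<comment> \<open>After \<open>I0\<close> sites the starting value \<open>\<beta>\<close>
      contributes at most 1/16 to the failure probability.\<close>
    obtain I0 where I0: "r ^ I0 < 1 / 16 / (C powr - s * (\<beta> powr s) + 1)"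
    proof -
      have "0 < 1 / 16 / (C powr - s * (\<beta> powr s) + 1)"
        using C0 by (intro divide_pos_pos add_nonneg_pos) auto
      then show thesis using that real_arch_pow_inv[OF _ r_less_1] by blast
    qed
    define Y where "Y = \<beta> powr s * (1 + 1 / (1 - r))"
    have "eventually (\<lambda>t. (real I0 + 2) / \<eta> \<le> real t powr \<kappa>) sequentially"
      "eventually (\<lambda>t. 8 * Y * (\<delta> / 2) powr - s \<le> real t powr s) sequentially"
      "eventually (\<lambda>t. t \<ge> max t0 2) sequentially"
      by (rule powr_eventually_ge[OF kappa_pos], rule powr_eventually_ge[OF s_pos], rule eventually_ge_at_top)
    then have "eventually (\<lambda>t. (real I0 + 2) / \<eta> \<le> real t powr \<kappa> \<and> 8 * Y * (\<delta> / 2) powr - s \<le> real t powr s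
        \<and> t \<ge> max t0 2) sequentially"
      by eventually_elim auto
    then obtain t where t: "(real I0 + 2) / \<eta> \<le> real t powr \<kappa>" "8 * Y * (\<delta> / 2) powr - s \<le> real t powr s"
      "t \<ge> t0" "t \<ge> 2"
      by (auto simp: eventually_sequentially)
    define T where "T = real t"
    have T: "1 < T" using t by (simp add: T_def)
    \<comment> \<open>The grid has \<open>2 * I\<close> sites: the first \<open>I\<close> serve to
      forget \<open>\<beta>\<close>, the others are the candidates.\<close>
    define I where "I = nat \<lfloor>\<eta> * T powr \<kappa>\<rfloor>"
    have big: "real I0 + 2 \<le> \<eta> * T powr \<kappa>" using t(1) \<eta> by (simp add: T_def field_simps)
    have I_le: "real I \<le> \<eta> * T powr \<kappa>" and I_ge: "\<eta> * T powr \<kappa> / 2 \<le> real I" and "I0 \<le> I"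
      using big unfolding I_def by linarith+
    have TT: "T powr \<kappa> * T powr - \<kappa> = 1" using T by (simp add: powr_minus)
    have IT: "real I * T powr - \<kappa> \<le> \<eta>"
    proof -
      have "real I * T powr - \<kappa> \<le> (\<eta> * T powr \<kappa>) * T powr - \<kappa>" using I_le by (intro mult_right_mono) auto
      then show ?thesis by (simp add: mult.assoc TT)
    qed
    obtain L where L0: "r ^ L < 1 / 4 * T powr - (\<kappa> - s)"
      using real_arch_pow_inv[of "1 / 4 * T powr - (\<kappa> - s)" r] T r_less_1 by auto
    have L: "T powr (\<kappa> - s) * r ^ L \<le> 1 / 4"
    proof -
      have "T powr (\<kappa> - s) * r ^ L \<le> T powr (\<kappa> - s) * (1 / 4 * T powr - (\<kappa> - s))"
        using L0 by (intro mult_left_mono) auto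
      also have "\<dots> = 1 / 4" using T by (simp add: powr_add[symmetric])
      finally show ?thesis .
    qed
    define N where "N = max (J * (2 * I)) L"
    have "q \<le> env.prob {\<omega>. trap_block C \<delta> T N m \<beta> \<omega>}" for m
    proof -
      define G where "G i \<omega> \<longleftrightarrow> trap_left m \<beta> C (\<delta> * T) (J * i) \<omega> \<and>
        (trap_right L T C (m + int (J * i)) \<omega> \<and>
        \<not> (\<exists>i'\<in>{i<..2 * I}. trap_right L T C (m + int (J * i')) \<omega>))" for i \<omega>
      have [measurable]: "Measurable.pred env (G i)" for i unfolding G_def by measurable
      have G: "T powr - \<kappa> * a / 8 \<le> env.prob {\<omega>. G i \<omega>}" if i: "i \<in> {I<..2 * I}" for i
        unfolding G_def a_def
      proof (rule prob_last_trap_ge[OF T C0 C1 L J1 J2[unfolded a_def]])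
        show "real I * T powr - \<kappa> \<le> h powr - \<kappa> / 16" using IT \<eta> by (simp add: a_def)
        have "C powr - s * (1 / (1 - r) + \<beta> powr s * r ^ (J * i)) \<le> 1 / 16 + 1 / 16"
        proof -
          have "I0 \<le> J * i" using i \<open>I0 \<le> I\<close> J1 by (cases J) auto
          then have "r ^ (J * i) \<le> r ^ I0" using r_nonneg r_less_1 by (intro power_decreasing) auto
          then have "r ^ (J * i) \<le> 1 / 16 / (C powr - s * (\<beta> powr s) + 1)" using I0 by simp
          moreover have "0 < C powr - s * (\<beta> powr s) + 1" by (intro add_nonneg_pos) auto
          ultimately have "(C powr - s * (\<beta> powr s) + 1) * r ^ (J * i) \<le> 1 / 16"
            by (metis mult.commute pos_le_divide_eq)
          then have "C powr - s * (\<beta> powr s * r ^ (J * i)) + r ^ (J * i) \<le> 1 / 16"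
            by (simp add: algebra_simps)
          moreover have "0 \<le> r ^ (J * i)" using r_nonneg by simp
          ultimately have "C powr - s * (\<beta> powr s * r ^ (J * i)) \<le> 1 / 16" by linarith
          then show ?thesis using C2 unfolding distrib_left by (rule add_mono[rotated])
        qed
        moreover have "real (J * i) * C_trunc * (\<delta> * T / 2) powr - \<kappa> \<le> 1 / 8"
        proof -
          have "(\<delta> * T / 2) powr - \<kappa> = (\<delta> / 2) powr - \<kappa> * T powr - \<kappa>"
            using assms T powr_mult[of "\<delta> / 2" T "- \<kappa>"] by simp
          then have "real (J * i) * C_trunc * (\<delta> * T / 2) powr - \<kappa>
              = (real J * C_trunc * (\<delta> / 2) powr - \<kappa> * T powr - \<kappa>) * real i" by simp
          also have "\<dots> \<le> (real J * C_trunc * (\<delta> / 2) powr - \<kappa> * T powr - \<kappa>) * (2 * real I)"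
            using i C_trunc_pos by (intro mult_left_mono) auto
          also have "\<dots> = D * (real I * T powr - \<kappa>)" by (simp add: D_def)
          also have "\<dots> \<le> D * \<eta>" using D IT by (intro mult_left_mono) auto
          finally show ?thesis using \<eta> by (simp add: mult.commute)
        qed
        moreover have "(\<delta> * T / 2) powr - s * (\<beta> powr s * (1 + 1 / (1 - r))) \<le> 1 / 8"
        proof -
          have "(\<delta> * T / 2) powr - s = (\<delta> / 2) powr - s * T powr - s"
            using assms T powr_mult[of "\<delta> / 2" T "- s"] by simp
          then have "(\<delta> * T / 2) powr - s * (\<beta> powr s * (1 + 1 / (1 - r))) = (8 * Y * (\<delta> / 2) powr - s) * T powr - s / 8"
            by (simp add: Y_def)
          also have "\<dots> \<le> T powr s * T powr - s / 8"
            using t(2) by (intro divide_right_mono mult_right_mono) (auto simp: T_def)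
          also have "\<dots> = 1 / 8" using T by (simp add: powr_minus)
          finally show ?thesis .
        qed
        ultimately show "1 / 2 \<le> env.prob {\<omega>. trap_left m \<beta> C (\<delta> * T) (J * i) \<omega>}"
          using prob_trap_left_ge[OF C0 \<beta>, of "\<delta> * T" "J * i" m] assms T by auto
      qed (use i in auto)
      have "q \<le> (\<Sum>i\<in>{I<..2 * I}. T powr - \<kappa> * a / 8)"
      proof -
        have "q = (\<eta> * (T powr \<kappa> * T powr - \<kappa>) / 2) * a / 8" by (simp only: TT) (simp add: q_def)
        also have "\<dots> = (\<eta> * T powr \<kappa> / 2) * (T powr - \<kappa> * a / 8)" by simp
        also have "\<dots> \<le> real I * (T powr - \<kappa> * a / 8)"
          using I_ge a by (intro mult_right_mono) auto
        finally show ?thesis by simp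
      qed
      also have "\<dots> \<le> (\<Sum>i\<in>{I<..2 * I}. env.prob {\<omega>. G i \<omega>})" by (intro sum_mono G)
      also have "\<dots> = (\<integral>\<omega>. (\<Sum>i\<in>{I<..2 * I}. of_bool (G i \<omega>)) \<partial>env)"
        by (subst Bochner_Integration.integral_sum) (auto intro!: integrable_of_bool simp: prob_eq_expectation)
      also have "\<dots> \<le> (\<integral>\<omega>. of_bool (trap_block C \<delta> T N m \<beta> \<omega>) \<partial>env)"
      proof (intro integral_mono Bochner_Integration.integrable_sum integrable_of_bool)
        fix \<omega>
        show "(\<Sum>i\<in>{I<..2 * I}. of_bool (G i \<omega>)) \<le> (of_bool (trap_block C \<delta> T N m \<beta> \<omega>) :: real)"
        proof (cases "\<exists>i\<in>{I<..2 * I}. G i \<omega>")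
          case True
          then obtain i where i: "i \<in> {I<..2 * I}" "G i \<omega>" by auto
          \<comment> \<open>Of two distinct indices the smaller one would have a later right
            barrier, which \<open>G\<close> forbids. The events \<open>G i\<close> are therefore
            disjoint and their probabilities add up.\<close>
          have uniq: "i' = i" if "i' \<in> {I<..2 * I}" "G i' \<omega>" for i'
          proof (rule ccontr)
            assume "i' \<noteq> i"
            then have "i' \<in> {i<..2 * I} \<or> i \<in> {i'<..2 * I}" using that(1) i(1) by auto
            then show False using that(2) i(2) unfolding G_def by blast
          qed
          have "(\<Sum>i'\<in>{I<..2 * I}. of_bool (G i' \<omega>)) = (\<Sum>i'\<in>{I<..2 * I}. if i' = i then 1 else (0::real))"
          proof (rule sum.cong[OF refl])
            fix i' assume i': "i' \<in> {I<..2 * I}"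
            show "of_bool (G i' \<omega>) = (if i' = i then 1 else (0::real))"
            proof (cases "i' = i")
              case False
              then have "\<not> G i' \<omega>" using uniq[OF i'] by blast
              then show ?thesis using False by simp
            qed (use i(2) in simp)
          qed
          also have "\<dots> \<le> 1" by (simp add: sum.delta)
          finally have "(\<Sum>i'\<in>{I<..2 * I}. of_bool (G i' \<omega>)) \<le> (1::real)" .
          moreover have "trap_block C \<delta> T N m \<beta> \<omega>"
          proof -
            obtain j where j: "j \<le> L" "passage T (m + int (J * i)) j \<omega>"
              "(\<Sum>z\<in>{1..j}. 1 / rprod \<omega> (m + int (J * i)) z) \<le> C"
              using i(2) unfolding G_def trap_right_def by auto
            have "T \<le> rprod \<omega> (m + int (J * i)) j" using j(2) by (simp add: passage_def)
            moreover from this have "j \<noteq> 0" using T by (cases j) auto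
            then have "j \<in> {1..N}" using j by (auto simp: N_def)
            moreover have "trap_left m \<beta> C (\<delta> * T) (J * i) \<omega>" using i(2) by (simp add: G_def)
            moreover have "J * i \<in> {1..N}"
            proof -
              have "J * i \<le> J * (2 * I)" using i by (intro mult_le_mono) auto
              moreover have "1 \<le> J * i" using i J1 by (cases "J * i") auto
              ultimately show ?thesis unfolding N_def atLeastAtMost_iff by linarith
            qed
            ultimately show ?thesis
              unfolding trap_block_def using j(3) by blast
          qed
          ultimately show ?thesis by simp
        next
          case False
          then have "(\<Sum>i\<in>{I<..2 * I}. of_bool (G i \<omega>)) = (0::real)" by (intro sum.neutral) auto
          then show ?thesis by simp
        qed
      qed auto
      also have "\<dots> = env.prob {\<omega>. trap_block C \<delta> T N m \<beta> \<omega>}"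
        by (simp add: prob_eq_expectation)
      finally show ?thesis .
    qed
    then show ?thesis using t(3) by (auto simp: T_def)
  qed
  show thesis by (rule that[OF C0 q main])
qed


section \<open>The stationary chain and valleys in almost every environment\<close>

definition W :: "(int \<Rightarrow> real) \<Rightarrow> int \<Rightarrow> real" where
  "W \<omega> i = (\<Sum>k. rprod \<omega> (i - int k) k)"

text \<open>Kept apart from \<open>W\<close>, because \<open>suminf\<close> says nothing about a
  divergent series; the recursion and the sign of \<open>W\<close> are available only under this
  condition.\<close>

definition W_conv :: "(int \<Rightarrow> real) \<Rightarrow> bool" where
  "W_conv \<omega> \<longleftrightarrow> (\<forall>i. summable (\<lambda>k. rprod \<omega> (i - int k) k))"

lemma measurable_W [measurable]: "(\<lambda>\<omega>. W \<omega> i) \<in> borel_measurable env"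
  unfolding W_def by measurable

lemma W_rec:
  assumes "W_conv \<omega>"
  shows "W \<omega> i = 1 + rh (\<omega> i) * W \<omega> (i - 1)"
proof -
  have "rprod \<omega> (i - int (Suc k)) (Suc k) = rh (\<omega> i) * rprod \<omega> (i - 1 - int k) k" for k
    using rprod_Suc[of \<omega> "i - 1 - int k" k] by (simp add: algebra_simps)
  then have "(\<Sum>k. rprod \<omega> (i - int (Suc k)) (Suc k)) = rh (\<omega> i) * W \<omega> (i - 1)"
    using assms by (simp only: W_def) (rule suminf_mult, simp add: W_conv_def)
  moreover have "summable (\<lambda>k. rprod \<omega> (i - int k) k)" using assms by (simp add: W_conv_def)
  ultimately show ?thesis using suminf_split_head[of "\<lambda>k. rprod \<omega> (i - int k) k"] by (simp add: W_def)
qed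

lemma W_nonneg:
  assumes "W_conv \<omega>"
  shows "0 \<le> W \<omega> i"
  unfolding W_def using assms by (intro suminf_nonneg) (auto simp: W_conv_def rprod_nonneg)

text \<open>The \<open>s\<close>-th powers of the terms have summable expectations
  \<open>r ^ k\<close>. Almost surely these powers are thus summable, the terms are eventually at
  most 1, and as \<open>s < 1\<close> each is then below its \<open>s\<close>-th power.\<close>

lemma AE_W_conv: "AE \<omega> in env. W_conv \<omega>"
  unfolding W_conv_def
proof (rule AE_all_countable[THEN iffD2], rule allI)
  fix i
  have "(\<integral>\<^sup>+\<omega>. (\<Sum>k. ennreal (rprod \<omega> (i - int k) k powr s)) \<partial>env)
      = (\<Sum>k. \<integral>\<^sup>+\<omega>. ennreal (rprod \<omega> (i - int k) k powr s) \<partial>env)"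
    by (rule nn_integral_suminf) measurable
  also have "\<dots> = (\<Sum>k. ennreal (r ^ k))"
    by (intro suminf_cong) (simp add: nn_integral_eq_integral integrable_rprod_powr moment_rprod_s)
  also have "\<dots> < \<infinity>"
    using r_nonneg r_less_1 by (simp add: suminf_ennreal2 summable_geometric)
  finally have "AE \<omega> in env. (\<Sum>k. ennreal (rprod \<omega> (i - int k) k powr s)) \<noteq> \<infinity>"
    by (intro nn_integral_noteq_infinite) auto
  then show "AE \<omega> in env. summable (\<lambda>k. rprod \<omega> (i - int k) k)"
  proof eventually_elim
    case (elim \<omega>)
    then have sum: "summable (\<lambda>k. rprod \<omega> (i - int k) k powr s)"
      by (intro summable_suminf_not_top) auto
    then have "(\<lambda>k. rprod \<omega> (i - int k) k powr s) \<longlonglongrightarrow> 0" by (rule summable_LIMSEQ_zero)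
    then have "eventually (\<lambda>k. rprod \<omega> (i - int k) k powr s < 1) sequentially"
      by (rule order_tendstoD) simp
    then have "eventually (\<lambda>k. norm (rprod \<omega> (i - int k) k) \<le> rprod \<omega> (i - int k) k powr s) sequentially"
    proof eventually_elim
      case (elim k)
      let ?x = "rprod \<omega> (i - int k) k"
      have "?x \<le> 1"
      proof (rule ccontr)
        assume "\<not> ?x \<le> 1"
        then have "1 \<le> ?x powr s" using s_pos by (intro ge_one_powr_ge_zero) auto
        then show False using elim by simp
      qed
      then have "?x powr 1 \<le> ?x powr s" using s_less_1 rprod_pos by (intro powr_mono') (auto intro: less_imp_le)
      then show ?case using rprod_pos[of \<omega> "i - int k" k] by simp
    qed
    then show ?case using sum by (rule summable_comparison_test_ev)
  qed
qed

lemma W_le_wchain: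
  assumes "W_conv \<omega>" "W \<omega> m \<le> \<beta>"
  shows "W \<omega> (m + int k) \<le> wchain \<omega> m \<beta> k"
proof (induction k)
  case (Suc k)
  have "W \<omega> (m + int (Suc k)) = 1 + rh (\<omega> (m + int k + 1)) * W \<omega> (m + int k)"
    using W_rec[OF assms(1), of "m + int k + 1"] by (simp add: algebra_simps)
  also have "\<dots> \<le> 1 + rh (\<omega> (m + int k + 1)) * wchain \<omega> m \<beta> k"
    using Suc rh_pos by (intro add_left_mono mult_left_mono) (auto intro: less_imp_le)
  finally show ?case by (simp add: wchain_Suc)
qed (use assms in simp)

text \<open>The number \<open>t\<close> is both the height of the barrier and the time scale, and it
  may exceed any \<open>t0\<close>; \<open>C\<close> and \<open>\<delta>\<close> stay fixed.\<close>

definition trap :: "real \<Rightarrow> real \<Rightarrow> nat \<Rightarrow> int \<Rightarrow> (int \<Rightarrow> real) \<Rightarrow> bool" where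
  "trap C \<delta> t0 y \<omega> \<longleftrightarrow> (\<exists>b>y. \<exists>t\<ge>t0. \<exists>j\<ge>1. W \<omega> b \<le> C \<and> (\<Sum>i\<in>{y..b - 1}. W \<omega> i) \<le> \<delta> * real t
     \<and> real t \<le> rprod \<omega> b j \<and> (\<Sum>z\<in>{1..j}. 1 / rprod \<omega> b z) \<le> C)"

lemma measurable_trap [measurable]: "Measurable.pred env (trap C \<delta> t0 y)"
  unfolding trap_def by measurable

lemma trap_if_trap_block:
  assumes block: "trap_block C \<delta> (real t) N m \<beta> \<omega>" and "t0 \<le> t" "y \<le> m"
    and W: "W_conv \<omega>" "W \<omega> m \<le> \<beta>" "(\<Sum>i\<in>{y..m - 1}. W \<omega> i) \<le> \<beta>"
  shows "trap C \<delta> t0 y \<omega>"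
proof -
  obtain k j where kj: "k \<ge> 1" "j \<ge> 1" "wchain \<omega> m \<beta> k \<le> C" "\<beta> + (\<Sum>i<k. wchain \<omega> m \<beta> i) \<le> \<delta> * real t"
    "real t \<le> rprod \<omega> (m + int k) j" "(\<Sum>z\<in>{1..j}. 1 / rprod \<omega> (m + int k) z) \<le> C"
    using block unfolding trap_block_def trap_left_def by auto
  have "W \<omega> (m + int k) \<le> C" using W_le_wchain[OF W(1,2), of k] kj by simp
  moreover have "(\<Sum>i\<in>{y..m + int k - 1}. W \<omega> i) \<le> \<delta> * real t"
  proof -
    have "{y..m + int k - 1} = {y..m - 1} \<union> {m..m + int k - 1}" using assms(3) by auto
    then have "(\<Sum>i\<in>{y..m + int k - 1}. W \<omega> i) = (\<Sum>i\<in>{y..m - 1}. W \<omega> i) + (\<Sum>i\<in>{m..m + int k - 1}. W \<omega> i)"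
      by (simp add: sum.union_disjoint)
    also have "(\<Sum>i\<in>{m..m + int k - 1}. W \<omega> i) = (\<Sum>i<k. W \<omega> (m + int i))"
      by (rule sum.reindex_bij_witness[of _ "\<lambda>i. m + int i" "\<lambda>i. nat (i - m)"]) auto
    also have "\<dots> \<le> (\<Sum>i<k. wchain \<omega> m \<beta> i)"
      by (intro sum_mono W_le_wchain W)
    finally show ?thesis using W(3) kj(4) by simp
  qed
  ultimately show ?thesis
    unfolding trap_def using kj assms(2,3)
    by (intro exI[of _ "m + int k"] conjI exI[of _ t] exI[of _ j]) auto
qed

theorem AE_trap:
  assumes "0 < \<delta>"
  obtains C where "0 < C" "\<And>t0 y. AE \<omega> in env. trap C \<delta> t0 y \<omega>"
proof -
  obtain C q where C: "0 < C" and q: "0 < q" and block: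
    "\<And>\<beta> t0. 0 \<le> \<beta> \<Longrightarrow> \<exists>t\<ge>t0. \<exists>N. \<forall>m. q \<le> env.prob {\<omega>. trap_block C \<delta> (real t) N m \<beta> \<omega>}"
    using trap_block_prob_ge[OF assms] by blast
  obtain Nul where Nul: "Nul \<in> null_sets env" "{\<omega>. \<not> W_conv \<omega>} \<subseteq> Nul"
    using AE_W_conv by (auto simp: eventually_ae_filter)
  have "AE \<omega> in env. trap C \<delta> t0 y \<omega>" for t0 y
  proof -
    define H where "H \<omega> \<longleftrightarrow> \<not> trap C \<delta> t0 y \<omega>" for \<omega>
    have [measurable]: "Measurable.pred env H" unfolding H_def by measurable
    have "env.prob {\<omega>. H \<omega>} = 0"
    proof (rule prob_eq_0_by_contraction[where \<I> = "{{..m} |m. y \<le> m}" and q = q and ?I0.0 = "{..y}"])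
      fix I G and \<epsilon> :: real
      assume "I \<in> {{..m} |m. y \<le> m}" and G: "Measurable.pred env G" "dep I G" and \<epsilon>: "0 < \<epsilon>"
      then obtain m where m: "I = {..m}" "y \<le> m" by auto
      define X where "X \<omega> = max (W \<omega> m) (\<Sum>i\<in>{y..m - 1}. W \<omega> i)" for \<omega>
      have [measurable]: "X \<in> borel_measurable env" unfolding X_def by measurable
      \<comment> \<open>The environment up to \<open>m\<close> influences the next block only
        through \<open>X\<close>, which is replaced by a constant at the price of probability
        \<open>\<epsilon>\<close>.\<close>
      obtain n :: nat where n: "env.prob {\<omega>. real n < X \<omega>} \<le> \<epsilon>"
        by (rule prob_gt_small[OF _ \<epsilon>, of X]) measurable
      obtain t N where t: "t0 \<le> t" and N: "\<And>m. q \<le> env.prob {\<omega>. trap_block C \<delta> (real t) N m (real n) \<omega>}"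
        using block[of "real n" t0] by auto
      define B where "B = trap_block C \<delta> (real t) N m (real n)"
      note [measurable] = G(1)
      have [measurable]: "Measurable.pred env B" unfolding B_def by measurable
      have depB: "dep {m + 1..m + 2 * int N} B" unfolding B_def by (rule dep_trap_block) simp
      have "env.prob {\<omega>. G \<omega> \<and> \<not> B \<omega>} = env.prob {\<omega>. G \<omega>} * env.prob {\<omega>. \<not> B \<omega>}"
        by (rule prob_conj_eq_mult[where I = I and J = "{m + 1..m + 2 * int N}"])
           (use G m(1) in \<open>auto intro: dep_comp[OF depB]\<close>)
      also have "env.prob {\<omega>. \<not> B \<omega>} = 1 - env.prob {\<omega>. B \<omega>}"
        using env.prob_compl[of "{\<omega>. B \<omega>}"] measurable_pred_iff_sets[of B]
        by (simp add: Compl_eq_Diff_UNIV[symmetric] Collect_neg_eq)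
      also have "env.prob {\<omega>. G \<omega>} * (1 - env.prob {\<omega>. B \<omega>}) \<le> env.prob {\<omega>. G \<omega>} * (1 - q)"
        using N[of m] by (intro mult_left_mono) (auto simp: B_def)
      finally have 1: "env.prob {\<omega>. G \<omega> \<and> \<not> B \<omega>} \<le> (1 - q) * env.prob {\<omega>. G \<omega>}" by (simp add: mult.commute)
      \<comment> \<open>Environments with a divergent series are put into the null set
        \<open>Nul\<close>, whose measurability is immediate.\<close>
      have Nul_pred: "Measurable.pred env (\<lambda>\<omega>. \<omega> \<in> Nul)"
        using Nul(1) by (simp add: pred_def null_sets_def)
      have "env.prob {\<omega>. H \<omega> \<and> G \<omega> \<and> \<not> (G \<omega> \<and> \<not> B \<omega>)} \<le> env.prob {\<omega>. real n < X \<omega> \<or> \<omega> \<in> Nul}"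
      proof (rule prob_mono_pred)
        fix \<omega> assume asm: "H \<omega> \<and> G \<omega> \<and> \<not> (G \<omega> \<and> \<not> B \<omega>)"
        show "real n < X \<omega> \<or> \<omega> \<in> Nul"
        proof (rule ccontr)
          assume "\<not> (real n < X \<omega> \<or> \<omega> \<in> Nul)"
          then have "trap C \<delta> t0 y \<omega>"
            using asm Nul(2) t m(2) by (intro trap_if_trap_block[where m = m and \<beta> = "real n" and t = t and N = N])
              (auto simp: B_def X_def)
          then show False using asm by (simp add: H_def)
        qed
      qed (use Nul_pred in measurable)
      also have "\<dots> \<le> env.prob {\<omega>. real n < X \<omega>} + env.prob {\<omega>. \<omega> \<in> Nul}"
        by (rule prob_disj_le) (auto simp: Nul_pred)
      also have "env.prob {\<omega>. \<omega> \<in> Nul} = 0" using Nul(1) by (simp add: null_sets_def measure_def)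
      finally have 2: "env.prob {\<omega>. H \<omega> \<and> G \<omega> \<and> \<not> (G \<omega> \<and> \<not> B \<omega>)} \<le> \<epsilon>" using n by simp
      have "dep {..m + 2 * int N} (\<lambda>\<omega>. G \<omega> \<and> \<not> B \<omega>)"
        by (rule dep_comp2[where g = "\<lambda>a b. a \<and> \<not> b"])
           (use G(2) depB m in \<open>auto intro: dep_mono\<close>)
      moreover have "{..m + 2 * int N} \<in> {{..m} |m. y \<le> m}" using m by auto
      moreover have "Measurable.pred env (\<lambda>\<omega>. G \<omega> \<and> \<not> B \<omega>)" by measurable
      ultimately show "\<exists>J\<in>{{..m} |m. y \<le> m}. \<exists>G'. Measurable.pred env G' \<and> dep J G' \<and>
        env.prob {\<omega>. G' \<omega>} \<le> (1 - q) * env.prob {\<omega>. G \<omega>} \<and> env.prob {\<omega>. H \<omega> \<and> G \<omega> \<and> \<not> G' \<omega>} \<le> \<epsilon>"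
        using 1 2 by blast
    qed (use q in auto)
    then show ?thesis using AE_of_prob_eq_0[of H] by (simp add: H_def)
  qed
  then show thesis using that C by blast
qed

end

section \<open>Meetings of independent walkers\<close>

abbreviation uniform01 :: "real measure" where
  "uniform01 \<equiv> uniform_measure lborel {0..1}"

interpretation drive: iid uniform01
proof -
  interpret prob_space uniform01
    by (rule prob_space_uniform_measure) auto
  show "iid uniform01" by unfold_locales simp
qed

abbreviation Drive :: "(nat \<times> nat \<Rightarrow> real) measure" where
  "Drive \<equiv> PiM UNIV (\<lambda>_. uniform01)"

interpretation Drive: prob_space Drive
  by (rule drive.prob_space_PP)

lemma prob_coord_less:
  fixes i :: "nat \<times> nat"
  assumes "0 \<le> a" "a \<le> 1"
  shows "Drive.prob {U. U i < a} = a"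
proof -
  have "Drive.prob {U. U i < a} = (\<integral>U. of_bool (U i < a) \<partial>Drive)"
    by (rule drive.prob_eq_expectation) measurable
  also have "\<dots> = (\<integral>u. of_bool (u < a) \<partial>uniform01)"
    by (rule drive.expectation_coord[where g = "\<lambda>u. of_bool (u < a)"]) measurable
  also have "\<dots> = (\<integral>u. indicat_real {..<a} u \<partial>uniform01)"
    by (intro Bochner_Integration.integral_cong) (auto simp: indicator_def)
  also have "\<dots> = measure uniform01 {..<a}" by simp
  also have "\<dots> = measure lborel ({0..1} \<inter> {..<a}) / measure lborel {0..1::real}"
    by (rule measure_uniform_measure) auto
  also have "{0..1} \<inter> {..<a} = {0..<a}" using assms by auto
  finally show ?thesis using assms by simp
qed

lemma walk_add: "walk w x U (n + t) = walk w (walk w x U n) (\<lambda>k. U (n + k)) t"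
  by (induction t) (auto simp: Let_def)

lemma walk_parity: "even (walk w x U n - x - int n)"
  by (induction n) (auto simp: Let_def)

lemma walk_bound: "\<bar>walk w x U n - x\<bar> \<le> int n"
  by (induction n) (auto simp: Let_def)

lemma walk_cong: "(\<And>k. k < t \<Longrightarrow> U k = V k) \<Longrightarrow> walk w x U t = walk w x V t"
  by (induction t) (auto simp: Let_def)

lemma measurable_walk [measurable]:
  "(\<lambda>U. walk w x (\<lambda>k. U (j, n + k)) t) \<in> Drive \<rightarrow>\<^sub>M count_space UNIV"
proof (induction t)
  case (Suc t)
  note [measurable] = Suc
  show ?case unfolding walk.simps Let_def by measurable
qed simp

lemma dep_walk: "dep ({j} \<times> {n..<n + t}) (\<lambda>U. walk w x (\<lambda>k. U (j, n + k)) t)"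
  by (intro depI walk_cong) auto

context quenched
begin

text \<open>The time offset \<open>n\<close> makes the statement apply to walks restarted at time
  \<open>n\<close> with the driving variables from then on; this is the form in which the Markov
  property is used.\<close>

lemma prob_walk_eq: "Drive.prob {U. walk w x (\<lambda>k. U (j, n + k)) t = z} = pk t x z"
proof (induction t arbitrary: z)
  case 0
  then show ?case using Drive.prob_space by simp
next
  case (Suc t)
  define X where "X U = walk w x (\<lambda>k. U (j, n + k)) t" for U :: "nat \<times> nat \<Rightarrow> real"
  have [measurable]: "X \<in> Drive \<rightarrow>\<^sub>M count_space UNIV" unfolding X_def by measurable
  define A where "A = {U. X U = z - 1 \<and> U (j, n + t) < w (z - 1)}"
  define B where "B = {U. X U = z + 1 \<and> \<not> U (j, n + t) < w (z + 1)}"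
  have "{U. walk w x (\<lambda>k. U (j, n + k)) (Suc t) = z} = A \<union> B"
    by (auto simp: A_def B_def X_def Let_def split: if_splits)
  moreover have "Drive.prob (A \<union> B) = Drive.prob A + Drive.prob B"
  proof (rule Drive.finite_measure_Union)
    show "A \<in> Drive.events" "B \<in> Drive.events"
      unfolding A_def B_def drive.measurable_pred_iff_sets[symmetric] by measurable
  qed (auto simp: A_def B_def)
  moreover have depX: "dep ({j} \<times> {n..<n + t}) (\<lambda>U. X U = y)" for y
    unfolding X_def by (rule dep_comp[OF dep_walk])
  have depU: "dep {(j, n + t)} (\<lambda>U. P (U (j, n + t)))" for P :: "real \<Rightarrow> bool"
    by (rule dep_comp[of _ _ P]) (rule dep_coord, simp)
  have "Drive.prob A = Drive.prob {U. X U = z - 1} * Drive.prob {U. U (j, n + t) < w (z - 1)}"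
    unfolding A_def by (rule drive.prob_conj_eq_mult[OF _ depX _ depU]) auto
  moreover have "Drive.prob B = Drive.prob {U. X U = z + 1} * Drive.prob {U. \<not> U (j, n + t) < w (z + 1)}"
    unfolding B_def by (rule drive.prob_conj_eq_mult[OF _ depX _ depU]) auto
  moreover have "Drive.prob {U. \<not> U (j, n + t) < w (z + 1)} = 1 - Drive.prob {U. U (j, n + t) < w (z + 1)}"
    using Drive.prob_compl[of "{U. U (j, n + t) < w (z + 1)}"]
      drive.measurable_pred_iff_sets[of "\<lambda>U. U (j, n + t) < w (z + 1)"]
    by (simp add: Compl_eq_Diff_UNIV[symmetric] Collect_neg_eq)
  ultimately show ?case
    using Suc[of "z - 1"] Suc[of "z + 1"] w_pos w_less_1
    by (simp add: X_def prob_coord_less less_imp_le)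
qed

lemma prob_walks_eq:
  assumes "finite S"
  shows "Drive.prob {U. \<forall>j\<in>S. walk w (x j) (\<lambda>k. U (j, n + k)) t = z} = (\<Prod>j\<in>S. pk t (x j) z)"
  using assms
proof (induction S)
  case empty
  then show ?case using Drive.prob_space by simp
next
  case (insert j S)
  have "Drive.prob {U. \<forall>j\<in>insert j S. walk w (x j) (\<lambda>k. U (j, n + k)) t = z}
     = Drive.prob {U. walk w (x j) (\<lambda>k. U (j, n + k)) t = z \<and> (\<forall>j\<in>S. walk w (x j) (\<lambda>k. U (j, n + k)) t = z)}"
    by simp
  also have "\<dots> = Drive.prob {U. walk w (x j) (\<lambda>k. U (j, n + k)) t = z}
      * Drive.prob {U. \<forall>j\<in>S. walk w (x j) (\<lambda>k. U (j, n + k)) t = z}"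
  proof (rule drive.prob_conj_eq_mult)
    show "dep ({j} \<times> UNIV) (\<lambda>U. walk w (x j) (\<lambda>k. U (j, n + k)) t = z)"
      by (rule dep_comp[OF dep_mono[OF dep_walk]]) auto
    show "dep (S \<times> UNIV) (\<lambda>U. \<forall>j\<in>S. walk w (x j) (\<lambda>k. U (j, n + k)) t = z)"
      by (rule dep_ball, rule dep_comp[OF dep_mono[OF dep_walk]]) auto
    show "Measurable.pred Drive (\<lambda>U. \<forall>j\<in>S. walk w (x j) (\<lambda>k. U (j, n + k)) t = z)"
      using insert(1) by measurable
  qed (use insert in auto)
  finally show ?case using insert by (simp add: prob_walk_eq)
qed

definition meet :: "nat set \<Rightarrow> (nat \<Rightarrow> int) \<Rightarrow> nat \<Rightarrow> (nat \<times> nat \<Rightarrow> real) \<Rightarrow> bool" where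
  "meet S x n U \<longleftrightarrow> (\<forall>j\<in>S. \<forall>k\<in>S. walk w (x j) (\<lambda>m. U (j, m)) n = walk w (x k) (\<lambda>m. U (k, m)) n)"

lemma measurable_walk0 [measurable]:
  "(\<lambda>U. walk w x (\<lambda>k. U (j, k)) t) \<in> Drive \<rightarrow>\<^sub>M count_space UNIV"
  using measurable_walk[of w x j 0 t] by simp

lemma dep_walk0: "dep (UNIV \<times> {..<t}) (\<lambda>U. walk w x (\<lambda>k. U (j, k)) t)"
  using dep_mono[OF dep_walk[of j 0 t w x], of "UNIV \<times> {..<t}"] by fastforce

lemma measurable_meet: "finite S \<Longrightarrow> Measurable.pred Drive (meet S x n)"
  unfolding meet_def by measurable

text \<open>Only \<open>c\<close> has to be uniform: the time \<open>t\<close> and the site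
  \<open>b\<close> may depend on the current positions. Whatever happened up to time
  \<open>n\<close>, a meeting follows within a finite window with conditional probability at least
  \<open>c ^ card S\<close>.\<close>

lemma AE_infinite_meet:
  assumes S: "finite S" and c: "0 < c"
    and par: "\<And>j k. j \<in> S \<Longrightarrow> k \<in> S \<Longrightarrow> even (x j - x k)"
    and reach: "\<And>v. (\<And>j k. j \<in> S \<Longrightarrow> k \<in> S \<Longrightarrow> even (v j - v k)) \<Longrightarrow>
      \<exists>t\<ge>1. \<exists>b. \<forall>j\<in>S. c \<le> pk t (v j) b"
  shows "AE U in Drive. infinite {n. meet S x n U}"
proof -
  note [measurable] = measurable_meet[OF S]
  have "Drive.prob {U. \<forall>n>n0. \<not> meet S x n U} = 0" for n0
  proof (rule drive.prob_eq_0_by_contraction[where \<I> = "{UNIV \<times> {..<n} |n. n0 \<le> n}" and q = "c ^ card S"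
        and ?I0.0 = "UNIV \<times> {..<n0}"])
    fix I G and \<epsilon> :: real
    assume "I \<in> {UNIV \<times> {..<n} |n. n0 \<le> n}" and G: "Measurable.pred Drive G" "dep I G" and \<epsilon>: "0 < \<epsilon>"
    then obtain n where n: "I = UNIV \<times> {..<n}" "n0 \<le> n" by auto
    note [measurable] = G(1)
    \<comment> \<open>At time \<open>n\<close> only finitely many joint positions are possible, so
      their individual times \<open>t v\<close> fit below one common horizon
      \<open>m\<close>.\<close>
    define V where "V = {v \<in> PiE S (\<lambda>j. {x j - int n..x j + int n}). \<forall>j\<in>S. \<forall>k\<in>S. even (v j - v k)}"
    have "finite (PiE S (\<lambda>j. {x j - int n..x j + int n}))" by (rule finite_PiE[OF S]) simp
    then have finV: "finite V" unfolding V_def by (rule rev_finite_subset) auto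
    have "\<exists>t b. 1 \<le> t \<and> (\<forall>j\<in>S. c \<le> pk t (v j) b)" if "v \<in> V" for v
      using reach[of v] that unfolding V_def by blast
    then obtain t b where tb: "\<And>v. v \<in> V \<Longrightarrow> 1 \<le> t v" "\<And>v j. v \<in> V \<Longrightarrow> j \<in> S \<Longrightarrow> c \<le> pk (t v) (v j) (b v)"
      by metis
    define m where "m = n + (\<Sum>v\<in>V. t v)"
    have t_le: "n + t v \<le> m" if "v \<in> V" for v
      unfolding m_def using that finV by (simp add: member_le_sum)
    define pos where "pos v U \<longleftrightarrow> (\<forall>j\<in>S. walk w (x j) (\<lambda>k. U (j, k)) n = v j)"
      for v and U :: "nat \<times> nat \<Rightarrow> real"
    define Coll where "Coll v U \<longleftrightarrow> (\<forall>j\<in>S. walk w (v j) (\<lambda>k. U (j, n + k)) (t v) = b v)"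
      for v and U :: "nat \<times> nat \<Rightarrow> real"
    have [measurable]: "Measurable.pred Drive (pos v)" "Measurable.pred Drive (Coll v)" for v
      unfolding pos_def Coll_def using S by measurable
    define G' where "G' U \<longleftrightarrow> G U \<and> (\<forall>s\<in>{n<..m}. \<not> meet S x s U)" for U
    have [measurable]: "Measurable.pred Drive G'" unfolding G'_def by measurable
    have pos_V: "\<exists>v\<in>V. pos v U" for U
    proof (intro bexI)
      define v where "v = restrict (\<lambda>j. walk w (x j) (\<lambda>k. U (j, k)) n) S"
      show "pos v U" by (simp add: pos_def v_def)
      have even: "even (walk w (x j) (\<lambda>k. U (j, k)) n - walk w (x k) (\<lambda>i. U (k, i)) n)" if "j \<in> S" "k \<in> S" for j k
        using walk_parity[of w "x j" "\<lambda>k. U (j, k)" n] walk_parity[of w "x k" "\<lambda>i. U (k, i)" n] par[OF that]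
        by auto
      have "\<forall>j\<in>S. \<forall>k\<in>S. even (v j - v k)"
      proof (intro ballI)
        fix j k assume jk: "j \<in> S" "k \<in> S"
        then have "v j = walk w (x j) (\<lambda>k. U (j, k)) n" "v k = walk w (x k) (\<lambda>i. U (k, i)) n"
          by (simp_all add: v_def)
        then show "even (v j - v k)" using even[OF jk] by simp
      qed
      moreover have "walk w (x j) (\<lambda>k. U (j, k)) n \<in> {x j - int n..x j + int n}" for j
        using walk_bound[of w "x j" "\<lambda>k. U (j, k)" n] by (simp add: abs_le_iff)
      then have "v \<in> PiE S (\<lambda>j. {x j - int n..x j + int n})"
        unfolding v_def restrict_PiE_iff by blast
      ultimately show "v \<in> V" unfolding V_def by blast
    qed
    have coll_meet: "meet S x (n + t v) U" if "pos v U" "Coll v U" for v U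
      using that unfolding meet_def pos_def Coll_def by (simp add: walk_add)
    have "Drive.prob {U. G' U} \<le> Drive.prob {U. \<exists>v\<in>V. (G U \<and> pos v U) \<and> \<not> Coll v U}"
    proof (rule drive.prob_mono_pred)
      fix U assume G': "G' U"
      obtain v where v: "v \<in> V" "pos v U" using pos_V by blast
      have "n + t v \<in> {n<..m}" using tb(1)[OF v(1)] t_le[OF v(1)] by auto
      then have "\<not> Coll v U" using coll_meet[OF v(2)] G' unfolding G'_def by blast
      then show "\<exists>v\<in>V. (G U \<and> pos v U) \<and> \<not> Coll v U" using v G' unfolding G'_def by blast
    qed (use finV in measurable)
    also have "\<dots> \<le> (\<Sum>v\<in>V. Drive.prob {U. (G U \<and> pos v U) \<and> \<not> Coll v U})"
      by (rule drive.prob_bex_le[OF finV]) measurable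
    also have "\<dots> \<le> (\<Sum>v\<in>V. (1 - c ^ card S) * Drive.prob {U. G U \<and> pos v U})"
    proof (rule sum_mono)
      fix v assume v: "v \<in> V"
      have depC: "dep (UNIV \<times> {n..}) (Coll v)"
        unfolding Coll_def by (rule dep_ball, rule dep_comp[OF dep_mono[OF dep_walk]]) auto
      have depA: "dep (UNIV \<times> {..<n}) (\<lambda>U. G U \<and> pos v U)"
        unfolding pos_def using G(2) n(1)
        by (intro dep_comp2[where g = "(\<and>)"] dep_ball dep_comp[OF dep_walk0]) auto
      have "Drive.prob {U. (G U \<and> pos v U) \<and> \<not> Coll v U} = Drive.prob {U. G U \<and> pos v U} * Drive.prob {U. \<not> Coll v U}"
        by (rule drive.prob_conj_eq_mult[OF _ depA _ dep_comp[OF depC]]) auto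
      also have "Drive.prob {U. \<not> Coll v U} = 1 - Drive.prob {U. Coll v U}"
        using Drive.prob_compl[of "{U. Coll v U}"] drive.measurable_pred_iff_sets[of "Coll v"]
        by (simp add: Compl_eq_Diff_UNIV[symmetric] Collect_neg_eq)
      also have "Drive.prob {U. Coll v U} = (\<Prod>j\<in>S. pk (t v) (v j) (b v))"
        unfolding Coll_def by (rule prob_walks_eq[OF S])
      also have "Drive.prob {U. G U \<and> pos v U} * (1 - (\<Prod>j\<in>S. pk (t v) (v j) (b v)))
          \<le> Drive.prob {U. G U \<and> pos v U} * (1 - c ^ card S)"
      proof (intro mult_left_mono diff_left_mono)
        have "(\<Prod>j\<in>S. c) \<le> (\<Prod>j\<in>S. pk (t v) (v j) (b v))"
          using c tb(2)[OF v] by (intro prod_mono) auto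
        then show "c ^ card S \<le> (\<Prod>j\<in>S. pk (t v) (v j) (b v))" by simp
      qed auto
      finally show "Drive.prob {U. (G U \<and> pos v U) \<and> \<not> Coll v U} \<le> (1 - c ^ card S) * Drive.prob {U. G U \<and> pos v U}"
        by (simp add: mult.commute)
    qed
    also have "\<dots> = (1 - c ^ card S) * (\<Sum>v\<in>V. Drive.prob {U. G U \<and> pos v U})"
      by (simp add: sum_distrib_left)
    also have "(\<Sum>v\<in>V. Drive.prob {U. G U \<and> pos v U}) = Drive.prob (\<Union>v\<in>V. {U. G U \<and> pos v U})"
    proof (rule Drive.finite_measure_finite_Union[symmetric, OF finV])
      show "(\<lambda>v. {U. G U \<and> pos v U}) ` V \<subseteq> Drive.events"
        unfolding image_subset_iff drive.measurable_pred_iff_sets[symmetric] by measurable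
      show "disjoint_family_on (\<lambda>v. {U. G U \<and> pos v U}) V"
        unfolding disjoint_family_on_def
      proof (intro ballI impI)
        fix v v' assume v: "v \<in> V" "v' \<in> V" "v \<noteq> v'"
        have "v \<in> PiE S (\<lambda>j. {x j - int n..x j + int n})" "v' \<in> PiE S (\<lambda>j. {x j - int n..x j + int n})"
          using v(1,2) unfolding V_def by blast+
        moreover have "v j = v' j" if "pos v U" "pos v' U" "j \<in> S" for U j
          using that unfolding pos_def by metis
        ultimately have eq: "v = v'" if "pos v U" "pos v' U" for U
          by (rule PiE_ext) (use that in blast)+
        show "{U. G U \<and> pos v U} \<inter> {U. G U \<and> pos v' U} = {}" using v(3) eq by blast
      qed
    qed
    also have "(\<Union>v\<in>V. {U. G U \<and> pos v U}) = {U. G U}" using pos_V by blast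
    finally have 1: "Drive.prob {U. G' U} \<le> (1 - c ^ card S) * Drive.prob {U. G U}" .
    \<comment> \<open>No error arises here: avoiding all meetings after \<open>n0\<close> entails
      avoiding them between \<open>n\<close> and \<open>m\<close>.\<close>
    have "{U. (\<forall>n>n0. \<not> meet S x n U) \<and> G U \<and> \<not> G' U} = {}"
      using n(2) by (auto simp: G'_def)
    then have 2: "Drive.prob {U. (\<forall>n>n0. \<not> meet S x n U) \<and> G U \<and> \<not> G' U} \<le> \<epsilon>"
      using \<epsilon> by (simp only: measure_empty)
    have "n \<le> m" by (simp add: m_def)
    then have "dep (UNIV \<times> {..<m}) G'"
      unfolding G'_def meet_def
      by (intro dep_comp2[where g = "(\<and>)"] dep_ball dep_comp[of _ _ Not] dep_comp2[where g = "(=)"]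
          dep_mono[OF dep_walk0] dep_mono[OF G(2)]) (auto simp: n)
    moreover have "UNIV \<times> {..<m} \<in> {UNIV \<times> {..<n} |n. n0 \<le> n}" using n \<open>n \<le> m\<close> by auto
    moreover have "Measurable.pred Drive G'" by measurable
    ultimately show "\<exists>J\<in>{UNIV \<times> {..<n} |n. n0 \<le> n}. \<exists>G'. Measurable.pred Drive G' \<and> dep J G' \<and>
        Drive.prob {U. G' U} \<le> (1 - c ^ card S) * Drive.prob {U. G U} \<and>
        Drive.prob {U. (\<forall>n>n0. \<not> meet S x n U) \<and> G U \<and> \<not> G' U} \<le> \<epsilon>"
      using 1 2 by (intro bexI[of _ "UNIV \<times> {..<m}"] exI[of _ G'] conjI)
  qed (use c in auto)
  then have "AE U in Drive. \<not> (\<forall>n>n0. \<not> meet S x n U)" for n0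
    by (intro drive.AE_of_prob_eq_0) auto
  then have "AE U in Drive. \<forall>n0. \<exists>n>n0. meet S x n U"
    by (subst AE_all_countable) simp
  then show ?thesis
    by eventually_elim (simp add: infinite_nat_iff_unbounded)
qed

end

context random_env
begin

text \<open>Used with \<open>y\<close> to the right of all walkers; the sites between the walkers and \<open>y\<close> only contribute a
  constant to the crossing time, negligible for large \<open>t0\<close>.\<close>
lemma quenched_meeting_bound:
  assumes w: "\<And>i. 0 < \<omega> i" "\<And>i. \<omega> i < 1" and rh: "\<And>i. rh (\<omega> i) = (1 - \<omega> i) / \<omega> i"
    and conv: "W_conv \<omega>" and C: "0 < C"
    and trap: "\<And>t0 y. trap C (1 / (32 * (1 + h)\<^sup>2)) t0 y \<omega>"
    and S: "finite S" and par: "\<And>j k. j \<in> S \<Longrightarrow> k \<in> S \<Longrightarrow> even (v j - v k)"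
  shows "\<exists>t\<ge>1. \<exists>b. \<forall>j\<in>S. 1 / (16 * (1 + h) * C) \<le> quenched.pk \<omega> t (v j) b"
proof (cases "S = {}")
  case False
  interpret quenched \<omega> by unfold_locales (use w in auto)
  \<comment> \<open>The total crossing sum will be at most \<open>2 * \<delta> * t\<close>.
    Multiplied by \<open>1 + h\<close> this is \<open>t / (16 * (1 + h))\<close>, which equals
    \<open>n / 4\<close> for the smallest admissible \<open>n = t / (4 * (1 + h))\<close>.\<close>
  define \<delta> where "\<delta> = 1 / (32 * (1 + h)\<^sup>2)"
  have \<delta>: "0 < \<delta>" "2 * (1 + h) * \<delta> = 1 / (16 * (1 + h))"
  proof -
    have "2 * c * (1 / (32 * c\<^sup>2)) = 1 / (16 * c)" if "0 < c" for c :: real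
      using that by (simp add: power2_eq_square)
    from this[of "1 + h"] show "2 * (1 + h) * \<delta> = 1 / (16 * (1 + h))" using h_pos by (simp only: \<delta>_def)
  qed (use h_pos in \<open>simp add: \<delta>_def\<close>)
  have rho: "rho i = rh (\<omega> i)" for i by (simp add: rho_def rh)
  define y0 where "y0 = Min (v ` S)"
  define y1 where "y1 = Max (v ` S)"
  have y: "y0 \<le> v j" "v j \<le> y1" if "j \<in> S" for j
    using that S by (auto simp: y0_def y1_def)
  have y01: "y0 \<le> y1" using False y by force
  define D where "D = (\<Sum>i\<in>{y0..y1 - 1}. W \<omega> i)"
  obtain t0 :: nat where t0: "max (D / \<delta>) (4 * (1 + h)) \<le> real t0" using real_arch_simple by blast
  obtain b t j where bt: "y1 < b" "t0 \<le> t" "1 \<le> j" "W \<omega> b \<le> C" "(\<Sum>i\<in>{y1..b - 1}. W \<omega> i) \<le> \<delta> * real t"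
    "real t \<le> rprod \<omega> b j" "(\<Sum>z\<in>{1..j}. 1 / rprod \<omega> b z) \<le> C"
    using trap[of t0 y1] unfolding trap_def \<delta>_def by blast
  define M where "M = b + int j"
  \<comment> \<open>The longest time for which a barrier of height \<open>t\<close> satisfies
    \<open>2 * (1 + h) * n \<le> t\<close>.\<close>
  define n where "n = nat \<lfloor>real t / (2 * (1 + h))\<rfloor>"
  have t_large: "4 * (1 + h) \<le> real t" "D \<le> \<delta> * real t"
  proof -
    have "max (D / \<delta>) (4 * (1 + h)) \<le> real t" using t0 bt(2) by linarith
    then have "D / \<delta> \<le> real t" "4 * (1 + h) \<le> real t" by simp_all
    then show "4 * (1 + h) \<le> real t" "D \<le> \<delta> * real t" using \<delta>(1) by (auto simp: field_simps)
  qed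
  have quot: "2 \<le> real t / (2 * (1 + h))" using t_large(1) h_pos by (simp add: field_simps)
  have n_le: "real n \<le> real t / (2 * (1 + h))" and n_ge: "real t / (2 * (1 + h)) / 2 \<le> real n" and n2: "2 \<le> n"
  proof -
    have "real (nat \<lfloor>q\<rfloor>) \<le> q \<and> q / 2 \<le> real (nat \<lfloor>q\<rfloor>) \<and> 2 \<le> nat \<lfloor>q\<rfloor>" if "2 \<le> q" for q :: real
      using that by (intro conjI; linarith)
    from this[OF quot] show "real n \<le> real t / (2 * (1 + h))" "real t / (2 * (1 + h)) / 2 \<le> real n" "2 \<le> n"
      unfolding n_def by blast+
  qed
  have barrier: "2 * (1 + h) * real n \<le> prod rho {b + 1..M}"
  proof -
    have "2 * (1 + h) * real n \<le> real t" using n_le h_pos by (simp add: field_simps)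
    also have "\<dots> \<le> prod rho {b + 1..M}" using bt(6) by (simp add: rprod_def M_def rho)
    finally show ?thesis .
  qed
  have right: "(\<Sum>z\<in>{b + 1..M}. 1 / prod rho {b + 1..z}) \<le> C"
  proof -
    have "(\<Sum>z\<in>{b + 1..M}. 1 / prod rho {b + 1..z}) = (\<Sum>z\<in>{1..j}. 1 / rprod \<omega> b z)"
      by (rule sum.reindex_bij_witness[of _ "\<lambda>z. b + int z" "\<lambda>z. nat (z - b)"])
         (auto simp: M_def rprod_def rho)
    then show ?thesis using bt(7) by simp
  qed
  have time: "(1 + h) * (\<Sum>i\<in>{y0..b - 1}. W \<omega> i) \<le> real n / 4"
  proof -
    have "{y0..b - 1} = {y0..y1 - 1} \<union> {y1..b - 1}" using y01 bt(1) by auto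
    then have "(\<Sum>i\<in>{y0..b - 1}. W \<omega> i) = D + (\<Sum>i\<in>{y1..b - 1}. W \<omega> i)"
      by (simp add: sum.union_disjoint D_def)
    also have "\<dots> \<le> 2 * (\<delta> * real t)" using t_large(2) bt(5) by simp
    finally have "(1 + h) * (\<Sum>i\<in>{y0..b - 1}. W \<omega> i) \<le> (1 + h) * (2 * (\<delta> * real t))"
      using h_pos by (intro mult_left_mono) auto
    also have "\<dots> = (2 * (1 + h) * \<delta>) * real t" by (simp add: ac_simps)
    also have "\<dots> = real t / (2 * (1 + h)) / 2 / 4" unfolding \<delta>(2) by simp
    also have "\<dots> \<le> real n / 4" using n_ge by (intro divide_right_mono) auto
    finally show ?thesis .
  qed
  obtain j0 where j0: "j0 \<in> S" using False by auto
  \<comment> \<open>One correction by 1 suits all walkers, as they share a parity;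
    \<open>n \<ge> 2\<close> keeps \<open>n \<le> 2 * n'\<close>.\<close>
  define n' where "n' = (if even (int n + v j0 - b) then n else n - 1)"
  have n': "n' \<le> n" "n \<le> 2 * n'" "1 \<le> n'" using n2 by (auto simp: n'_def)
  have even0: "even (int n' + v j0 - b)"
    using n2 by (auto simp: n'_def of_nat_diff)
  have "1 / (16 * (1 + h) * C) \<le> pk n' (v j) b" if j: "j \<in> S" for j
  proof (rule trap_prob_ge[of "W \<omega>" h b C M n y0])
    show "W \<omega> i = 1 + rho i * W \<omega> (i - 1)" for i unfolding rho by (rule W_rec[OF conv])
    show "even (int n' + v j - b)"
    proof -
      have "even ((int n' + v j0 - b) + (v j - v j0))" using even0 par[OF j j0] by (rule dvd_add)
      then show ?thesis by (simp add: algebra_simps)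
    qed
    show "v j \<le> b" using y(2)[OF j] bt(1) by simp
  qed (use bt right barrier time y(1)[OF j] n2 n' in \<open>auto simp: rho rh_le W_nonneg[OF conv] M_def\<close>)
  then show ?thesis using n' by blast
qed auto

end

section \<open>Passage to the annealed law\<close>

lemma measurable_walker:
  fixes \<mu> :: "real measure"
  assumes [measurable_cong]: "sets \<mu> = sets borel"
  shows "(\<lambda>p. walker p x j n) \<in> annealed_space \<mu> \<rightarrow>\<^sub>M count_space UNIV"
  unfolding walker_def
proof (induction n)
  case (Suc n)
  define Y where "Y p = walk (fst p) (x j) (\<lambda>m. snd p (j, m)) n" for p :: "(int \<Rightarrow> real) \<times> (nat \<times> nat \<Rightarrow> real)"
  have [measurable]: "Y \<in> annealed_space \<mu> \<rightarrow>\<^sub>M count_space UNIV" unfolding Y_def by (rule Suc)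
  have 1: "(\<lambda>p. fst p y) \<in> borel_measurable (annealed_space \<mu>)" for y
    unfolding annealed_space_def env_law_def drive_law_def by measurable
  have 2: "(\<lambda>p. snd p (j, n)) \<in> borel_measurable (annealed_space \<mu>)"
    unfolding annealed_space_def env_law_def drive_law_def by measurable
  note [measurable] = 1 2
  \<comment> \<open>The environment is read at the random site \<open>Y p\<close>; since there are
    countably many sites, measurability for each fixed one suffices.\<close>
  have "(\<lambda>p. (\<lambda>y p. if snd p (j, n) < fst p y then y + 1 else y - 1) (Y p) p) \<in> annealed_space \<mu> \<rightarrow>\<^sub>M count_space UNIV"
    by (rule measurable_compose_countable) measurable
  then show ?case unfolding Y_def by (simp add: Let_def)
qed simp

theorem theorem1p1:
  fixes \<mu> :: "real measure" and \<epsilon>0 \<kappa> :: real and d :: nat and x :: "nat \<Rightarrow> int"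
  assumes "prob_space \<mu>" and "sets \<mu> = sets borel"
    and "AE w in \<mu>. 0 < w \<and> w < 1"
    and "0 < \<epsilon>0" and "\<epsilon>0 < 1/2" and "measure \<mu> {\<epsilon>0..1 - \<epsilon>0} = 1"
    and "(\<integral>w. ln ((1 - w) / w) \<partial>\<mu>) < 0"
    and "0 < \<kappa>" and "\<kappa> < 1" and "(\<integral>w. ((1 - w) / w) powr \<kappa> \<partial>\<mu>) = 1"
    and "d \<ge> 2"
    and "\<forall>j\<in>{1..d}. \<forall>k\<in>{1..d}. even (x j - x k)"
  shows "AE p in annealed_space \<mu>.
           infinite {n::nat. \<forall>j\<in>{1..d}. \<forall>k\<in>{1..d}. walker p x j n = walker p x k n}"
proof -
  interpret mu: prob_space \<mu> by fact
  note [measurable_cong] = assms(2)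
  \<comment> \<open>Clamping to the ellipticity interval changes nothing almost surely and makes the
    bounds on the ratio hold everywhere.\<close>
  define cl where "cl u = max \<epsilon>0 (min (1 - \<epsilon>0) u)" for u :: real
  define rh where "rh u = (1 - cl u) / cl u" for u
  define h where "h = (1 - \<epsilon>0) / \<epsilon>0"
  have cl: "\<epsilon>0 \<le> cl u" "cl u \<le> 1 - \<epsilon>0" for u using assms(5) by (auto simp: cl_def)
  have cl_eq: "cl u = u" if "u \<in> {\<epsilon>0..1 - \<epsilon>0}" for u using that by (auto simp: cl_def)
  have rh_measurable [measurable]: "rh \<in> borel_measurable borel" unfolding rh_def cl_def by measurable
  have cl_pos: "0 < cl u" "0 < 1 - cl u" for u using cl[of u] assms(4) by auto
  have rh_pos: "0 < rh u" for u using cl_pos[of u] by (simp add: rh_def)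
  have rh_le: "rh u \<le> h" for u
    unfolding rh_def h_def using cl[of u] assms(4,5) by (intro frac_le) auto
  have rh_ge: "1 / h \<le> rh u" for u
  proof -
    have "1 / h = \<epsilon>0 / (1 - \<epsilon>0)" by (simp add: h_def)
    also have "\<dots> \<le> rh u" unfolding rh_def using cl[of u] cl_pos[of u] assms(4,5) by (intro frac_le) auto
    finally show ?thesis .
  qed
  have borel_mu: "f \<in> borel_measurable \<mu>" if "f \<in> borel_measurable borel" for f :: "real \<Rightarrow> real"
    using that by (simp add: measurable_cong_sets[OF assms(2) refl])
  have ae: "AE u in \<mu>. u \<in> {\<epsilon>0..1 - \<epsilon>0}"
    using mu.AE_in_set_eq_1[of "{\<epsilon>0..1 - \<epsilon>0}"] assms(2,6) by simp
  have ae_rh: "AE u in \<mu>. (1 - u) / u = rh u"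
    using ae by eventually_elim (simp add: rh_def cl_eq)
  have int_powr: "integrable \<mu> (\<lambda>u. rh u powr a)" if "0 < a" for a
  proof (rule mu.integrable_const_bound[where B = "h powr a"])
    have "rh u powr a \<le> h powr a" for u
      using that rh_pos[of u] rh_le[of u] by (intro powr_mono2) auto
    then show "AE u in \<mu>. norm (rh u powr a) \<le> h powr a" by simp
  qed (rule borel_mu, measurable)
  have mk: "(\<integral>u. rh u powr \<kappa> \<partial>\<mu>) = 1"
  proof -
    have "(\<integral>u. rh u powr \<kappa> \<partial>\<mu>) = (\<integral>w. ((1 - w) / w) powr \<kappa> \<partial>\<mu>)"
    proof (rule integral_cong_AE)
      show "AE u in \<mu>. rh u powr \<kappa> = ((1 - u) / u) powr \<kappa>"
        using ae_rh by eventually_elim simp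
      show "(\<lambda>u. rh u powr \<kappa>) \<in> borel_measurable \<mu>"
        by (rule borel_measurable_integrable[OF int_powr[OF assms(8)]])
      show "(\<lambda>w. ((1 - w) / w) powr \<kappa>) \<in> borel_measurable \<mu>"
        by (rule borel_mu, rule powr_real_measurable) measurable
    qed
    then show ?thesis using assms(10) by simp
  qed
  have mln: "(\<integral>u. ln (rh u) \<partial>\<mu>) < 0"
  proof -
    have "(\<integral>u. ln (rh u) \<partial>\<mu>) = (\<integral>w. ln ((1 - w) / w) \<partial>\<mu>)"
    proof (rule integral_cong_AE)
      show "AE u in \<mu>. ln (rh u) = ln ((1 - u) / u)"
        using ae_rh by eventually_elim simp
      show "(\<lambda>u. ln (rh u)) \<in> borel_measurable \<mu>"
        by (rule borel_mu, rule borel_measurable_ln[OF rh_measurable])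
      show "(\<lambda>w. ln ((1 - w) / w)) \<in> borel_measurable \<mu>"
        by (rule borel_mu) measurable
    qed
    then show ?thesis using assms(7) by simp
  qed
  \<comment> \<open>With \<open>s = \<kappa> / 2\<close> the expectation of
    \<open>(rh u powr s - 1)\<^sup>2\<close> is \<open>2 - 2 * r\<close>. If it vanished, the ratio
    would be 1 almost surely, contradicting the negative mean of its logarithm; hence
    \<open>r < 1\<close>.\<close>
  define s where "s = \<kappa> / 2"
  define r where "r = (\<integral>u. rh u powr s \<partial>\<mu>)"
  have "r < 1"
  proof -
    have sq: "(rh u powr s - 1)\<^sup>2 = rh u powr \<kappa> - 2 * rh u powr s + 1" for u
      using powr_add[of "rh u" s s] by (simp add: power2_eq_square algebra_simps s_def)
    have ik: "integrable \<mu> (\<lambda>u. rh u powr \<kappa>)" and int_s: "integrable \<mu> (\<lambda>u. rh u powr s)"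
      using assms(8) by (auto intro: int_powr simp: s_def)
    have int_sq: "integrable \<mu> (\<lambda>u. (rh u powr s - 1)\<^sup>2)"
      unfolding sq using ik int_s by simp
    have "(\<integral>u. (rh u powr s - 1)\<^sup>2 \<partial>\<mu>) = 2 - 2 * r"
      unfolding sq using ik int_s mu.prob_space by (simp add: mk r_def[symmetric])
    moreover have "0 \<le> (\<integral>u. (rh u powr s - 1)\<^sup>2 \<partial>\<mu>)" by simp
    moreover have "(\<integral>u. (rh u powr s - 1)\<^sup>2 \<partial>\<mu>) \<noteq> 0"
    proof
      assume "(\<integral>u. (rh u powr s - 1)\<^sup>2 \<partial>\<mu>) = 0"
      then have "AE u in \<mu>. (rh u powr s - 1)\<^sup>2 = 0"
        using integral_nonneg_eq_0_iff_AE[OF int_sq] by simp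
      then have "AE u in \<mu>. ln (rh u) = 0"
      proof eventually_elim
        case (elim u)
        then have "ln (rh u powr s) = 0" by simp
        then show ?case using rh_pos[of u] assms(8) by (simp add: ln_powr s_def)
      qed
      then have "(\<integral>u. ln (rh u) \<partial>\<mu>) = 0" by (rule integral_eq_zero_AE)
      then show False using mln by simp
    qed
    ultimately show ?thesis by linarith
  qed
  interpret env: random_env \<mu> rh h \<kappa> s r
    by unfold_locales (use assms(2,8,9) rh_pos rh_le rh_ge mk \<open>r < 1\<close> in \<open>auto simp: s_def r_def\<close>)
  obtain C where C: "0 < C" and trap: "\<And>t0 y. AE \<omega> in env_law \<mu>. env.trap C (1 / (32 * (1 + h)\<^sup>2)) t0 y \<omega>"
    using env.AE_trap[of "1 / (32 * (1 + h)\<^sup>2)"] env.h_pos unfolding env_law_def by auto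
  have ae_env: "AE \<omega> in env_law \<mu>. \<forall>i. \<omega> i \<in> {\<epsilon>0..1 - \<epsilon>0}"
    unfolding AE_all_countable env_law_def
    by (intro allI AE_PiM_component ae) (auto intro: mu.prob_space_axioms)
  have quenched: "AE \<omega> in env_law \<mu>. AE U in drive_law.
      infinite {n. \<forall>j\<in>{1..d}. \<forall>k\<in>{1..d}. walker (\<omega>, U) x j n = walker (\<omega>, U) x k n}"
  proof -
    have "AE \<omega> in env_law \<mu>. \<forall>t0 y. env.trap C (1 / (32 * (1 + h)\<^sup>2)) t0 y \<omega>"
      unfolding AE_all_countable using trap by blast
    moreover have "AE \<omega> in env_law \<mu>. env.W_conv \<omega>"
      unfolding env_law_def by (rule env.AE_W_conv)
    ultimately show ?thesis
      using ae_env
    proof eventually_elim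
      case (elim \<omega>)
      have w: "0 < \<omega> i" "\<omega> i < 1" for i
        using elim(3) assms(4) by (force dest: spec[of _ i])+
      interpret quenched \<omega> by unfold_locales (use w in auto)
      have "AE U in Drive. infinite {n. meet {1..d} x n U}"
      proof (rule AE_infinite_meet[where c = "1 / (16 * (1 + h) * C)"])
        show "0 < 1 / (16 * (1 + h) * C)" using C env.h_pos by simp
        show "\<exists>t\<ge>1. \<exists>b. \<forall>j\<in>{1..d}. 1 / (16 * (1 + h) * C) \<le> pk t (v j) b"
          if "\<And>j k. j \<in> {1..d} \<Longrightarrow> k \<in> {1..d} \<Longrightarrow> even (v j - v k)" for v
        proof (rule env.quenched_meeting_bound[OF w _ elim(2) C])
          show "rh (\<omega> i) = (1 - \<omega> i) / \<omega> i" for i using elim(3) cl_eq by (simp add: rh_def)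
          show "env.trap C (1 / (32 * (1 + h)\<^sup>2)) t0 y \<omega>" for t0 y using elim(1) by blast
        qed (simp, rule that)
        show "even (x j - x k)" if "j \<in> {1..d}" "k \<in> {1..d}" for j k using assms(12) that by blast
      qed simp
      then show ?case unfolding drive_law_def meet_def walker_def fst_conv snd_conv .
    qed
  qed
  interpret E: prob_space "env_law \<mu>" unfolding env_law_def by (rule env.prob_space_PP)
  interpret D: prob_space drive_law unfolding drive_law_def by (rule drive.prob_space_PP)
  interpret pair_prob_space "env_law \<mu>" drive_law ..
  note [measurable] = measurable_walker[OF assms(2)]
  \<comment> \<open>Measurability on the product space allows the quenched statement, true for
    almost every environment, to be integrated.\<close>
  have "Measurable.pred (annealed_space \<mu>)
      (\<lambda>p. infinite {n. \<forall>j\<in>{1..d}. \<forall>k\<in>{1..d}. walker p x j n = walker p x k n})"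
    unfolding infinite_nat_iff_unbounded mem_Collect_eq by measurable
  then show ?thesis
    unfolding annealed_space_def
    by (intro AE_pair_measure) (use quenched in \<open>auto simp: pred_def\<close>)
qed

end
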